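(* Let $M$ be a compact $6$-dimensional manifold equipped with a symplectic form $\omega$, and let $\varphi_0$ be a closed, primitive, positive $3$-form on $M$. Then the gradient flow of the Hitchin functional with initial value $\varphi_0$ can be equivalently expressed as $$\partial_t\varphi=d\Lambda_\omega d\hat\varphi .$$ That is, a smooth one-parameter family $\varphi=\varphi(t)$ of closed, primitive, positive $3$-forms on $M$ with $\varphi(0)=\varphi_0$ satisfies the gradient flow $\partial_t\varphi=dd^\dagger\varphi$ of the Hitchin functional if and only if it satisfies $\partial_t\varphi=d\Lambda_\omega d\hat\varphi$.
   Context: $M$ is oriented by $\omega^3$. A $3$-form $\varphi$ is positive if at every point $\varphi=\mathrm{Re}(\theta^1\wedge\theta^2\wedge\theta^3)$ for some complex-valued covectors $\theta^1,\theta^2,\theta^3$ such that $\theta^1,\theta^2,\theta^3,\bar\theta^1,\bar\theta^2,\bar\theta^3$ are linearly independent (equivalently, $\varphi$ reduces the structure group to $\mathrm{SL}(3,\mathbb C)$). Such $\varphi$ determines, together with the orientation, an almost complex structure $J_\varphi$ and a $3$-form $\hat\varphi=J_\varphi\varphi$, i.e. $\hat\varphi(X,Y,Z)=\varphi(J_\varphi X,J_\varphi Y,J_\varphi Z)$, such that $\Omega=\varphi+\sqrt{-1}\,\hat\varphi$ is a nowhere vanishing $(3,0)$-form for $J_\varphi$ and $\varphi\wedge\hat\varphi$ is a positive volume form. $\Lambda_\omega$ is the contraction operator on forms associated with $\omega$, normalized by $\Lambda_\omega\omega=3$; $\varphi$ is primitive if $\Lambda_\omega\varphi=0$ (equivalently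 $\omega\wedge\varphi=0$). For primitive positive $\varphi$, $J_\varphi$ is compatible with $\omega$, and $g_\varphi(X,Y)=\omega(X,J_\varphi Y)$ is a Riemannian metric (positive definiteness of $g_\varphi$ is part of the convention for a primitive form to be positive). The Hitchin functional is $H(\varphi)=\frac12\int_M\varphi\wedge\hat\varphi$. For closed, primitive, positive $\varphi$ and a variation $\delta\varphi=d\,\delta\beta$ within the de Rham class of $\varphi$, one has $\delta H=\int_M\delta\varphi\wedge\hat\varphi=\int_M\langle\delta\beta,d^\dagger\varphi\rangle\,\omega^3/3!$, where $d^\dagger=-{*}d{*}$ is the formal adjoint of $d$ with respect to $g_\varphi$. The gradient flow of the Hitchin functional is accordingly defined as $\partial_t\varphi=dd^\dagger\varphi$ (i.e. $\partial_t\beta=d^\dagger\varphi$ with $\partial_t\varphi=d\,\partial_t\beta$), where at each time $d^\dagger$ is taken with respect to the metric $g_{\varphi(t)}$. *)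

theory Defs
  imports "HOL-Analysis.Analysis"
begin

section \<open>Multilinear algebra on the coordinate space\<close>

text \<open>A \<open>k\<close>-form on \<open>\<real>\<^sup>6\<close> takes its arguments as a list; it is set to \<open>0\<close> on lists whose length
  is not \<open>k\<close>, so that equality of \<open>k\<close>-forms is equality of functions.\<close>

type_synonym 'b form = "(real^6) list \<Rightarrow> 'b"

definition alt_form :: "nat \<Rightarrow> 'b::real_vector form \<Rightarrow> bool" where
  "alt_form k \<alpha> \<longleftrightarrow>
     (\<forall>vs. length vs \<noteq> k \<longrightarrow> \<alpha> vs = 0) \<and>
     (\<forall>vs i. length vs = k \<and> i < k \<longrightarrow> linear (\<lambda>v. \<alpha> (vs[i := v]))) \<and>
     (\<forall>vs i j. length vs = k \<and> i < j \<and> j < k \<and> vs ! i = vs ! j \<longrightarrow> \<alpha> vs = 0)"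

text \<open>Normalization: \<open>(\<alpha> \<and> \<beta>)(v, w) = \<alpha>(v) \<beta>(w) - \<alpha>(w) \<beta>(v)\<close> for \<open>1\<close>-forms.\<close>

definition wedge :: "nat \<Rightarrow> nat \<Rightarrow> 'b::real_normed_field form \<Rightarrow> 'b form \<Rightarrow> 'b form" where
  "wedge k l \<alpha> \<beta> vs =
     (if length vs = k + l
      then (\<Sum>\<sigma> | \<sigma> permutes {..<k + l}.
              of_int (sign \<sigma>) * \<alpha> (map (\<lambda>i. vs ! \<sigma> i) [0..<k])
                              * \<beta> (map (\<lambda>i. vs ! \<sigma> i) [k..<k + l])) / (fact k * fact l)
      else 0)"

definition positive_3form :: "real form \<Rightarrow> bool" where
  "positive_3form \<phi> \<longleftrightarrow>
     (\<exists>\<theta>1 \<theta>2 \<theta>3 :: complex form.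
        alt_form 1 \<theta>1 \<and> alt_form 1 \<theta>2 \<and> alt_form 1 \<theta>3 \<and>
        (\<forall>a1 a2 a3 b1 b2 b3 :: complex.
           (\<forall>v. a1 * \<theta>1 [v] + a2 * \<theta>2 [v] + a3 * \<theta>3 [v]
              + b1 * cnj (\<theta>1 [v]) + b2 * cnj (\<theta>2 [v]) + b3 * cnj (\<theta>3 [v]) = 0) \<longrightarrow>
           a1 = 0 \<and> a2 = 0 \<and> a3 = 0 \<and> b1 = 0 \<and> b2 = 0 \<and> b3 = 0) \<and>
        \<phi> = (\<lambda>vs. Re (wedge 2 1 (wedge 1 1 \<theta>1 \<theta>2) \<theta>3 vs)))"

definition nondegenerate :: "real form \<Rightarrow> bool" where
  "nondegenerate \<omega> \<longleftrightarrow> (\<forall>v. v \<noteq> 0 \<longrightarrow> (\<exists>w. \<omega> [v, w] \<noteq> 0))"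

definition omega_cubed :: "real form \<Rightarrow> real form" where
  "omega_cubed \<omega> = wedge 4 2 (wedge 2 2 \<omega> \<omega>) \<omega>"

definition type_30 :: "(real^6 \<Rightarrow> real^6) \<Rightarrow> complex form \<Rightarrow> bool" where
  "type_30 J \<Omega> \<longleftrightarrow>
     alt_form 3 \<Omega> \<and> (\<forall>X Y Z. \<Omega> [J X, Y, Z] = \<i> * \<Omega> [X, Y, Z])"

definition induces_acs :: "real form \<Rightarrow> real form \<Rightarrow> (real^6 \<Rightarrow> real^6) \<Rightarrow> bool" where
  "induces_acs \<omega> \<phi> J \<longleftrightarrow>
     linear J \<and> (\<forall>v. J (J v) = - v) \<and>
     (let \<psi> = (\<lambda>vs. \<phi> (map J vs)); \<Omega> = (\<lambda>vs. Complex (\<phi> vs) (\<psi> vs)) in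
        type_30 J \<Omega> \<and> (\<exists>vs. \<Omega> vs \<noteq> 0) \<and>
        (\<exists>c>0. \<forall>vs. wedge 3 3 \<phi> \<psi> vs = c * omega_cubed \<omega> vs))"

text \<open>The almost complex structure \<open>J\<^sub>\<phi>\<close> of a positive \<open>\<phi>\<close> and the orientation \<open>\<omega>\<^sup>3\<close>.\<close>

definition acs :: "real form \<Rightarrow> real form \<Rightarrow> real^6 \<Rightarrow> real^6" where
  "acs \<omega> \<phi> = (THE J. induces_acs \<omega> \<phi> J)"

definition hat :: "real form \<Rightarrow> real form \<Rightarrow> real form" where
  "hat \<omega> \<phi> vs = \<phi> (map (acs \<omega> \<phi>) vs)"

definition metric :: "real form \<Rightarrow> real form \<Rightarrow> real^6 \<Rightarrow> real^6 \<Rightarrow> real" where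
  "metric \<omega> \<phi> v w = \<omega> [v, acs \<omega> \<phi> w]"

text \<open>Contraction with the bivector dual to \<open>\<omega>\<close>. The vector
  \<open>b\<^sub>i\<^sup>* = (\<Sum>j. matrix_inv W $ j $ i *\<^sub>R axis j 1)\<close> is determined by \<open>\<omega>(b\<^sub>k, b\<^sub>i\<^sup>*) = \<delta>\<^sub>k\<^sub>i\<close>, and
  \<open>\<Lambda>\<^sub>\<omega> \<alpha> = (1/2) \<Sum>\<^sub>i \<alpha>(b\<^sub>i, b\<^sub>i\<^sup>*, \<dots>)\<close>.\<close>

definition contraction :: "real form \<Rightarrow> real form \<Rightarrow> real form" where
  "contraction \<omega> \<alpha> vs =
     (let W = (\<chi> i j. \<omega> [axis i 1, axis j 1]) :: real^6^6 in
        (\<Sum>i\<in>UNIV. \<Sum>j\<in>UNIV. matrix_inv W $ j $ i * \<alpha> (axis i 1 # axis j 1 # vs)) / 2)"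

text \<open>The inner product of \<open>k\<close>-forms: \<open>e\<^sub>i\<^sub>1 \<and> \<dots> \<and> e\<^sub>i\<^sub>k\<close> with \<open>i\<^sub>1 < \<dots> < i\<^sub>k\<close> are orthonormal for
  the dual \<open>e\<^sub>1, \<dots>, e\<^sub>6\<close> of an orthonormal basis.\<close>

definition form_inner ::
    "(real^6 \<Rightarrow> real^6 \<Rightarrow> real) \<Rightarrow> nat \<Rightarrow> real form \<Rightarrow> real form \<Rightarrow> real" where
  "form_inner g k \<alpha> \<beta> =
     (let G = (\<chi> i j. g (axis i 1) (axis j 1)) :: real^6^6 in
        (\<Sum>is | length is = k. \<Sum>js | length js = k.
           (\<Prod>a<k. matrix_inv G $ (is ! a) $ (js ! a))
             * \<alpha> (map (\<lambda>i. axis i 1) is) * \<beta> (map (\<lambda>j. axis j 1) js)) / fact k)"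

text \<open>The Riemannian volume form of \<open>g\<close> for the orientation given by the \<open>6\<close>-form \<open>\<tau>\<close>: the
  positive multiple of \<open>\<tau>\<close> of unit length.\<close>

definition vol_form :: "(real^6 \<Rightarrow> real^6 \<Rightarrow> real) \<Rightarrow> real form \<Rightarrow> real form" where
  "vol_form g \<tau> vs = \<tau> vs / sqrt (form_inner g 6 \<tau> \<tau>)"

definition hodge_star ::
    "(real^6 \<Rightarrow> real^6 \<Rightarrow> real) \<Rightarrow> real form \<Rightarrow> nat \<Rightarrow> real form \<Rightarrow> real form" where
  "hodge_star g \<tau> k \<beta> =
     (THE \<gamma>. alt_form (6 - k) \<gamma> \<and>
        (\<forall>\<alpha>. alt_form k \<alpha> \<longrightarrow>
           (\<forall>vs. wedge k (6 - k) \<alpha> \<gamma> vs = form_inner g k \<alpha> \<beta> * vol_form g \<tau> vs)))"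


section \<open>Smooth manifolds of dimension six and differential forms\<close>

text \<open>Derivatives are taken within \<open>S\<close>, which is only used for \<open>S\<close> open or the product of a
  nondegenerate interval and an open set, where they are unique.\<close>

primrec Ck_on ::
    "nat \<Rightarrow> 'a::real_normed_vector set \<Rightarrow> ('a \<Rightarrow> 'b::real_normed_vector) \<Rightarrow> bool" where
  "Ck_on 0 S f \<longleftrightarrow> continuous_on S f"
| "Ck_on (Suc n) S f \<longleftrightarrow>
     (\<exists>f'. (\<forall>x\<in>S. (f has_derivative f' x) (at x within S)) \<and> (\<forall>v. Ck_on n S (\<lambda>x. f' x v)))"

definition smooth_on ::
    "'a::real_normed_vector set \<Rightarrow> ('a \<Rightarrow> 'b::real_normed_vector) \<Rightarrow> bool" where
  "smooth_on S f \<longleftrightarrow> (\<forall>n. Ck_on n S f)"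

type_synonym 'a chart = "'a set \<times> ('a \<Rightarrow> real^6)"

definition img :: "'a chart \<Rightarrow> (real^6) set" where
  "img c = snd c ` fst c"

definition transition :: "'a chart \<Rightarrow> 'a chart \<Rightarrow> real^6 \<Rightarrow> real^6" where
  "transition c d = snd d \<circ> inv_into (fst c) (snd c)"

definition smooth_atlas :: "'a topology \<Rightarrow> 'a chart set \<Rightarrow> bool" where
  "smooth_atlas M A \<longleftrightarrow>
     (\<forall>c\<in>A. openin M (fst c) \<and> open (img c) \<and>
        homeomorphic_map (subtopology M (fst c)) (top_of_set (img c)) (snd c)) \<and>
     (\<Union>c\<in>A. fst c) = topspace M \<and>
     (\<forall>c\<in>A. \<forall>d\<in>A. smooth_on (snd c ` (fst c \<inter> fst d)) (transition c d))"

text \<open>A differential form is given by its coordinate expressions: \<open>\<alpha> c x\<close> is the form, in the chart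
  \<open>c\<close>, at the point with coordinates \<open>x\<close>. Only \<open>c \<in> A\<close> and \<open>x \<in> img c\<close> are relevant.\<close>

type_synonym 'a dform = "'a chart \<Rightarrow> real^6 \<Rightarrow> real form"

definition smooth_form :: "'a chart set \<Rightarrow> nat \<Rightarrow> 'a dform \<Rightarrow> bool" where
  "smooth_form A k \<alpha> \<longleftrightarrow>
     (\<forall>c\<in>A. (\<forall>x\<in>img c. alt_form k (\<alpha> c x)) \<and> (\<forall>vs. smooth_on (img c) (\<lambda>x. \<alpha> c x vs))) \<and>
     (\<forall>c\<in>A. \<forall>d\<in>A. \<forall>x \<in> snd c ` (fst c \<inter> fst d). \<forall>vs.
        \<alpha> c x vs =
          \<alpha> d (transition c d x) (map (frechet_derivative (transition c d) (at x)) vs))"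

definition form_eq :: "'a chart set \<Rightarrow> 'a dform \<Rightarrow> 'a dform \<Rightarrow> bool" where
  "form_eq A \<alpha> \<beta> \<longleftrightarrow> (\<forall>c\<in>A. \<forall>x\<in>img c. \<forall>vs. \<alpha> c x vs = \<beta> c x vs)"

definition ext_d :: "'a dform \<Rightarrow> 'a dform" where
  "ext_d \<alpha> c x vs =
     (\<Sum>i<length vs. (-1) ^ i *
        frechet_derivative (\<lambda>y. \<alpha> c y (take i vs @ drop (Suc i) vs)) (at x) (vs ! i))"

definition closed_form :: "'a chart set \<Rightarrow> 'a dform \<Rightarrow> bool" where
  "closed_form A \<alpha> \<longleftrightarrow> form_eq A (ext_d \<alpha>) (\<lambda>c x vs. 0)"

definition symplectic_form :: "'a chart set \<Rightarrow> 'a dform \<Rightarrow> bool" where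
  "symplectic_form A \<omega> \<longleftrightarrow>
     smooth_form A 2 \<omega> \<and> closed_form A \<omega> \<and> (\<forall>c\<in>A. \<forall>x\<in>img c. nondegenerate (\<omega> c x))"

definition Lambda_form :: "'a dform \<Rightarrow> 'a dform \<Rightarrow> 'a dform" where
  "Lambda_form \<omega> \<alpha> c x = contraction (\<omega> c x) (\<alpha> c x)"

definition hat_form :: "'a dform \<Rightarrow> 'a dform \<Rightarrow> 'a dform" where
  "hat_form \<omega> \<phi> c x = hat (\<omega> c x) (\<phi> c x)"

text \<open>Positive definiteness of \<open>g\<^sub>\<phi>\<close> is part of what it means for a primitive form to be positive.\<close>

definition closed_primitive_positive :: "'a chart set \<Rightarrow> 'a dform \<Rightarrow> 'a dform \<Rightarrow> bool" where
  "closed_primitive_positive A \<omega> \<phi> \<longleftrightarrow>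
     smooth_form A 3 \<phi> \<and> closed_form A \<phi> \<and>
     form_eq A (Lambda_form \<omega> \<phi>) (\<lambda>c x vs. 0) \<and>
     (\<forall>c\<in>A. \<forall>x\<in>img c. positive_3form (\<phi> c x) \<and>
        (\<forall>v. v \<noteq> 0 \<longrightarrow> metric (\<omega> c x) (\<phi> c x) v v > 0))"

text \<open>Hodge star of \<open>k\<close>-forms for the metric \<open>g\<^sub>\<phi>\<close> and the orientation \<open>\<omega>\<^sup>3\<close>.\<close>

definition star_form :: "'a dform \<Rightarrow> 'a dform \<Rightarrow> nat \<Rightarrow> 'a dform \<Rightarrow> 'a dform" where
  "star_form \<omega> \<phi> k \<alpha> c x =
     hodge_star (metric (\<omega> c x) (\<phi> c x)) (omega_cubed (\<omega> c x)) k (\<alpha> c x)"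

text \<open>\<open>d\<^sup>\<dagger> = -*d*\<close> on \<open>k\<close>-forms, \<open>1 \<le> k \<le> 6\<close>.\<close>

definition codiff :: "'a dform \<Rightarrow> 'a dform \<Rightarrow> nat \<Rightarrow> 'a dform \<Rightarrow> 'a dform" where
  "codiff \<omega> \<phi> k \<alpha> c x vs =
     - star_form \<omega> \<phi> (7 - k) (ext_d (star_form \<omega> \<phi> k \<alpha>)) c x vs"


section \<open>Flows of forms\<close>

definition smooth_family :: "'a chart set \<Rightarrow> real set \<Rightarrow> (real \<Rightarrow> 'a dform) \<Rightarrow> bool" where
  "smooth_family A I \<phi> \<longleftrightarrow>
     (\<forall>c\<in>A. \<forall>vs. smooth_on (I \<times> img c) (\<lambda>(t, x). \<phi> t c x vs))"

text \<open>\<open>\<partial>\<^sub>t \<phi> = F(\<phi>)\<close> on \<open>I\<close>, with one-sided derivatives at endpoints belonging to \<open>I\<close>.\<close>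

definition satisfies_flow ::
    "'a chart set \<Rightarrow> real set \<Rightarrow> ('a dform \<Rightarrow> 'a dform) \<Rightarrow> (real \<Rightarrow> 'a dform) \<Rightarrow> bool" where
  "satisfies_flow A I F \<phi> \<longleftrightarrow>
     (\<forall>t\<in>I. \<forall>c\<in>A. \<forall>x\<in>img c. \<forall>vs.
        ((\<lambda>s. \<phi> s c x vs) has_real_derivative F (\<phi> t) c x vs) (at t within I))"

text \<open>The first variation of \<open>H(\<phi>) = 1/2 \<integral> \<phi> \<and> \<phi>^\<close> along \<open>\<delta>\<phi> = d \<delta>\<beta>\<close> is
  \<open>\<integral> \<langle>\<delta>\<beta>, d\<^sup>\<dagger>\<phi>\<rangle> \<omega>\<^sup>3/3!\<close>; accordingly the gradient flow is by definition \<open>\<partial>\<^sub>t \<phi> = d d\<^sup>\<dagger> \<phi>\<close>,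
  with \<open>d\<^sup>\<dagger>\<close> taken at time \<open>t\<close> with respect to \<open>g\<^sub>\<phi>\<^sub>(\<^sub>t\<^sub>)\<close>.\<close>

definition hitchin_gradient_flow ::
    "'a chart set \<Rightarrow> 'a dform \<Rightarrow> real set \<Rightarrow> (real \<Rightarrow> 'a dform) \<Rightarrow> bool" where
  "hitchin_gradient_flow A \<omega> I = satisfies_flow A I (\<lambda>\<phi>. ext_d (codiff \<omega> \<phi> 3 \<phi>))"

end

theory Submission
  imports Defs
begin

text \<open>The two right-hand sides are \<open>d\<close> of \<open>d\<^sup>\<dagger>\<phi> = -*d*\<phi>\<close> and of \<open>\<Lambda>\<^sub>\<omega> d\<phi>^\<close>, and already these \<open>2\<close>-forms agree.
  At each point a primitive positive \<open>\<phi>\<close> is the real part of a \<open>(3,0)\<close>-form \<open>\<Omega>\<close> of a hermitian structure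
  \<open>(\<omega>, J)\<close>, so that \<open>*\<phi> = \<phi>^\<close>. Since \<open>d\<phi> = 0\<close>, the real form \<open>\<beta> = d\<phi>^ = -\<i> d\<Omega>\<close> has no component of type
  \<open>(1,3)\<close>, hence is of type \<open>(2,2)\<close>; and \<open>\<omega> \<and> \<beta> = d(\<omega> \<and> \<phi>^) = 0\<close> since \<open>d\<omega> = 0\<close>. On such forms
  \<open>* = -\<Lambda>\<^sub>\<omega>\<close>, which gives \<open>-*d*\<phi> = \<Lambda>\<^sub>\<omega> d\<phi>^\<close>.\<close>

section \<open>Alternating forms and the Hodge star\<close>

text \<open>\<open>acs\<close> and \<open>hodge_star\<close> are definite descriptions at a single
  point, while \<open>hat_form\<close> has to be differentiated. Existence and uniqueness first turn
  each description into an identity: the star is tested on the permuted vectors of one orthonormal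
  frame, so that both star identities become finite checks over 720 permutations. For derivatives,
  \<open>J\<close> is written as a formula in \<omega> and \<phi> that mentions no frame; the frames
  are chosen point by point and are never differentiated. The type argument rests on the following.
  Differentiating a (3,0)-form moves at most one index to the conjugate type, so d\<Omega> has only
  components of types (3,1) and (2,2), even if \<open>J\<close> is not integrable. As d\<phi> = 0,
  d\<Omega> is purely imaginary; its (3,1) part is then minus the conjugate of its (1,3) part, which
  is 0. The proof keeps to real forms and states the result as
  \<open>\<beta>(v, Jv, JX, JY) = \<beta>(v, Jv, X, Y)\<close>, an identity from which the
  derivative of \<open>J\<close> drops out.\<close>

lemma alt_form_length: "alt_form k \<alpha> \<Longrightarrow> length vs \<noteq> k \<Longrightarrow> \<alpha> vs = 0"
  unfolding alt_form_def by blast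

lemma alt_form_linear: "alt_form k \<alpha> \<Longrightarrow> length vs = k \<Longrightarrow> i < k \<Longrightarrow> linear (\<lambda>v. \<alpha> (vs[i := v]))"
  unfolding alt_form_def by blast

lemma alt_form_repeat:
  "alt_form k \<alpha> \<Longrightarrow> length vs = k \<Longrightarrow> i < k \<Longrightarrow> j < k \<Longrightarrow> i \<noteq> j \<Longrightarrow> vs ! i = vs ! j \<Longrightarrow> \<alpha> vs = 0"
  unfolding alt_form_def by (metis linorder_neqE_nat)

lemma alt_form_not_distinct:
  assumes "alt_form k \<alpha>" "\<not> distinct vs" shows "\<alpha> vs = 0"
proof -
  obtain i j where ij: "i < length vs" "j < length vs" "i \<noteq> j" "vs ! i = vs ! j"
    using assms(2) by (auto simp: distinct_conv_nth)
  show ?thesis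
  proof (cases "length vs = k")
    case True
    show ?thesis by (rule alt_form_repeat[OF assms(1) True _ _ ij(3,4)]) (use ij True in auto)
  qed (rule alt_form_length[OF assms(1)])
qed

lemma alt_form_swap:
  assumes \<alpha>: "alt_form k \<alpha>" and vs: "length vs = k" and ij: "i < k" "j < k" "i \<noteq> j"
  shows "\<alpha> (vs[i := vs ! j, j := vs ! i]) = - \<alpha> vs"
proof -
  define F where "F a b = \<alpha> (vs[i := a, j := b])" for a b
  have lj: "linear (F a)" for a
    unfolding F_def by (rule alt_form_linear[OF \<alpha>]) (use vs ij in auto)
  have li: "linear (\<lambda>a. F a b)" for b
    unfolding F_def using alt_form_linear[OF \<alpha>, of "vs[j := b]" i] vs ij
    by (simp add: list_update_swap)
  have d: "F a a = 0" for a
    unfolding F_def by (rule alt_form_repeat[OF \<alpha>, of _ i j]) (use vs ij in auto)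
  have "F a b + F b a = 0" for a b
    using d[of "a + b"] d[of a] d[of b] by (simp add: linear_add[OF lj] linear_add[OF li] add.commute)
  then have "F (vs ! j) (vs ! i) = - F (vs ! i) (vs ! j)" by (simp add: eq_neg_iff_add_eq_0)
  then show ?thesis using ij vs by (simp add: F_def)
qed

lemma alt_form_permute:
  fixes \<alpha> :: "real form"
  assumes \<alpha>: "alt_form k \<alpha>" and "\<sigma> permutes {..<k}" and "length vs = k"
  shows "\<alpha> (map (\<lambda>i. vs ! \<sigma> i) [0..<k]) = of_int (sign \<sigma>) * \<alpha> vs"
proof -
  have fin: "finite {..<k}" by simp
  have "\<forall>vs. length vs = k \<longrightarrow> \<alpha> (map (\<lambda>i. vs ! \<sigma> i) [0..<k]) = of_int (sign \<sigma>) * \<alpha> vs"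
  using assms(2) fin
proof (induction \<sigma> rule: permutes_induct)
  case id
  then show ?case by (auto simp: map_nth)
next
  case (swap a b p)
  show ?case
  proof (intro allI impI)
  fix vs :: "(real^6) list" assume vs: "length vs = k"
  have pp: "p permutes {..<k}" by fact
  then have p: "permutation p" using permutation_permutes by blast
  let ?ws = "vs[a := vs ! b, b := vs ! a]"
  \<comment> \<open>The transposition acts on the positions at which \<open>vs\<close> is read, so
    it is absorbed by exchanging two entries of the list.\<close>
  have "vs ! (Transposition.transpose a b \<circ> p) i = ?ws ! p i" if "i < k" for i
    using swap vs permutes_in_image[OF pp, of i] that
    by (auto simp: Transposition.transpose_def nth_list_update)
  then have eq: "map (\<lambda>i. vs ! (Transposition.transpose a b \<circ> p) i) [0..<k] = map (\<lambda>i. ?ws ! p i) [0..<k]"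
    by auto
  have "\<alpha> (map (\<lambda>i. vs ! (Transposition.transpose a b \<circ> p) i) [0..<k]) = of_int (sign p) * \<alpha> ?ws"
    unfolding eq using swap vs by simp
  also have "\<alpha> ?ws = - \<alpha> vs" by (rule alt_form_swap[OF \<alpha>]) (use swap vs in auto)
  also have "of_int (sign p) * - \<alpha> vs = of_int (sign (Transposition.transpose a b \<circ> p)) * \<alpha> vs"
    using swap by (simp add: sign_compose[OF permutation_swap_id p] sign_swap_id)
  finally show "\<alpha> (map (\<lambda>i. vs ! (Transposition.transpose a b \<circ> p) i) [0..<k])
      = of_int (sign (Transposition.transpose a b \<circ> p)) * \<alpha> vs" .
  qed
qed
  then show ?thesis using assms(3) by blast
qed

lemma alt_form_prefix:
  assumes "alt_form (k + l) \<alpha>" "length ws = l"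
  shows "alt_form k (\<lambda>vs. \<alpha> (vs @ ws))"
  unfolding alt_form_def
proof (intro conjI allI impI)
  fix vs :: "(real^6) list" and i assume "length vs = k \<and> i < k"
  then show "linear (\<lambda>v. \<alpha> (vs[i := v] @ ws))"
    using alt_form_linear[OF assms(1), of "vs @ ws" i] assms(2) by (simp add: list_update_append1)
next
  fix vs :: "(real^6) list" and i j assume "length vs = k \<and> i < j \<and> j < k \<and> vs ! i = vs ! j"
  then show "\<alpha> (vs @ ws) = 0"
    using alt_form_repeat[OF assms(1), of "vs @ ws" i j] assms(2) by (simp add: nth_append)
qed (use alt_form_length[OF assms(1)] assms(2) in simp)

lemma alt_form_suffix:
  assumes "alt_form (k + l) \<alpha>" "length ws = k"
  shows "alt_form l (\<lambda>vs. \<alpha> (ws @ vs))"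
  unfolding alt_form_def
proof (intro conjI allI impI)
  fix vs :: "(real^6) list" and i assume "length vs = l \<and> i < l"
  then show "linear (\<lambda>v. \<alpha> (ws @ vs[i := v]))"
    using alt_form_linear[OF assms(1), of "ws @ vs" "k + i"] assms(2) by (simp add: list_update_append)
next
  fix vs :: "(real^6) list" and i j assume "length vs = l \<and> i < j \<and> j < l \<and> vs ! i = vs ! j"
  then show "\<alpha> (ws @ vs) = 0"
    using alt_form_repeat[OF assms(1), of "ws @ vs" "k + i" "k + j"] assms(2) by (simp add: nth_append)
qed (use alt_form_length[OF assms(1)] assms(2) in simp)

lemma alt_form_diff: "alt_form k \<alpha> \<Longrightarrow> alt_form k \<beta> \<Longrightarrow> alt_form k (\<lambda>vs. \<alpha> vs - \<beta> vs)"
  unfolding alt_form_def by (auto intro: linear_compose_sub)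

lemma alt_form_scale: "alt_form k \<alpha> \<Longrightarrow> alt_form k (\<lambda>vs. c * \<alpha> vs)" for c :: real
  unfolding alt_form_def using linear_compose_scale_right[where c = c and 'b = real] by simp blast

text \<open>Unlike \<open>alt_form\<close>, it says nothing about lists of other lengths. It
  survives fixing the first argument (\<open>multilin_tail\<close>), and the inductions on the
  degree rest on that.\<close>

definition multilin :: "nat \<Rightarrow> real form \<Rightarrow> bool" where
  "multilin k \<alpha> \<longleftrightarrow> (\<forall>vs i. length vs = k \<and> i < k \<longrightarrow> linear (\<lambda>v. \<alpha> (vs[i := v])))"

lemma alt_form_multilin: "alt_form k \<alpha> \<Longrightarrow> multilin k \<alpha>"
  by (simp add: alt_form_def multilin_def)

lemma multilin_tail: "multilin (Suc k) \<alpha> \<Longrightarrow> multilin k (\<lambda>vs. \<alpha> (v # vs))"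
  unfolding multilin_def
proof (intro allI impI)
  fix vs :: "(real^6) list" and i assume *: "\<forall>vs i. length vs = Suc k \<and> i < Suc k \<longrightarrow> linear (\<lambda>v. \<alpha> (vs[i := v]))"
    and "length vs = k \<and> i < k"
  then show "linear (\<lambda>w. \<alpha> (v # vs[i := w]))" using *[rule_format, of "v # vs" "Suc i"] by simp
qed

lemma multilin_head: "multilin (Suc k) \<alpha> \<Longrightarrow> length vs = k \<Longrightarrow> linear (\<lambda>v. \<alpha> (v # vs))"
  unfolding multilin_def by (drule spec[of _ "0 # vs"], drule spec[of _ 0]) simp

text \<open>One slot at a time: by induction the form vanishes once the first slot holds some
  \<open>f m\<close>, and linearity in that slot extends this to the span.\<close>

lemma multilin_eq_0_on_span:
  assumes "multilin k \<alpha>" "span (f ` I) = UNIV"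
    and "\<And>ms. length ms = k \<Longrightarrow> set ms \<subseteq> I \<Longrightarrow> \<alpha> (map f ms) = 0" and "length vs = k"
  shows "\<alpha> vs = 0"
  using assms(1,3,4)
proof (induction k arbitrary: \<alpha> vs)
  case 0
  then show ?case using "0.prems"(2)[of "[]"] by simp
next
  case (Suc k)
  obtain w ws where vs: "vs = w # ws" "length ws = k"
    using Suc.prems(3) by (metis length_Suc_conv)
  have "\<alpha> (f m # ws) = 0" if m: "m \<in> I" for m
  proof (rule Suc.IH[OF multilin_tail[OF Suc.prems(1)] _ vs(2)])
    fix ms assume "length ms = k" "set ms \<subseteq> I"
    then show "\<alpha> (f m # map f ms) = 0" using Suc.prems(2)[of "m # ms"] m by simp
  qed
  then have "\<alpha> (w # ws) = 0"
    using linear_eq_0_on_span[OF multilin_head[OF Suc.prems(1) vs(2)], of "f ` I" w] assms(2) by auto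
  then show ?case using vs by simp
qed

lemma alt_form_eq_0:
  assumes \<alpha>: "alt_form k \<alpha>" and "span (f ` I) = UNIV"
    and "\<And>ms. length ms = k \<Longrightarrow> set ms \<subseteq> I \<Longrightarrow> distinct ms \<Longrightarrow> \<alpha> (map f ms) = 0"
  shows "\<alpha> vs = (0::real)"
proof (cases "length vs = k")
  case True
  show ?thesis
  proof (rule multilin_eq_0_on_span[OF alt_form_multilin[OF \<alpha>] assms(2) _ True])
    fix ms assume "length ms = k" "set ms \<subseteq> I"
    then show "\<alpha> (map f ms) = 0"
      using assms(3) alt_form_not_distinct[OF \<alpha>, of "map f ms"] distinct_map by blast
  qed
qed (simp add: alt_form_length[OF \<alpha>])

section \<open>Permutations with a prescribed prefix\<close>

lemma distinct_list_permutation: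
  assumes "distinct ms" "set ms \<subseteq> {..<n}" "length ms = k"
  obtains \<sigma> where "\<sigma> permutes {..<n}" "map \<sigma> [0..<k] = ms"
proof -
  obtain rs where rs: "set rs = {..<n} - set ms" "distinct rs"
    using finite_distinct_list[of "{..<n} - set ms"] by auto
  define L where "L = ms @ rs"
  have L: "distinct L" "set L = {..<n}" using assms rs by (auto simp: L_def)
  have len: "length L = n" using distinct_card[OF L(1)] L(2) by simp
  define \<sigma> where "\<sigma> i = (if i < n then L ! i else i)" for i
  have "bij_betw (\<lambda>i. L ! i) {..<n} {..<n}"
    by (rule bij_betw_nth[OF L(1)]) (simp_all only: len L(2))
  then have "bij_betw \<sigma> {..<n} {..<n}" 
    by (subst bij_betw_cong[of "{..<n}" \<sigma> "\<lambda>i. L ! i" "{..<n}"]) (simp add: \<sigma>_def)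
  then have "\<sigma> permutes {..<n}" by (rule bij_imp_permutes) (simp add: \<sigma>_def)
  moreover have "k \<le> n" using len assms(3) by (simp add: L_def)
  then have "map \<sigma> [0..<k] = ms"
    using assms(3) by (intro nth_equalityI) (auto simp: \<sigma>_def L_def nth_append)
  ultimately show thesis using that by blast
qed

text \<open>In top degree a list of distinct frame indices is a permutation of
  \<open>[0..<n]\<close>, so every value on frame vectors is a sign times the one value
  compared.\<close>

lemma alt_form_top_eq:
  fixes \<alpha> \<beta> :: "real form"
  assumes "alt_form n \<alpha>" "alt_form n \<beta>" "span (f ` {..<n}) = UNIV"
    and "\<alpha> (map f [0..<n]) = \<beta> (map f [0..<n])"
  shows "\<alpha> vs = \<beta> vs"
proof -
  have "\<alpha> vs - \<beta> vs = 0"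
  proof (rule alt_form_eq_0[OF alt_form_diff[OF assms(1,2)] assms(3)])
    fix ms assume ms: "length ms = n" "set ms \<subseteq> {..<n}" "distinct ms"
    obtain \<sigma> where \<sigma>: "\<sigma> permutes {..<n}" "map \<sigma> [0..<n] = ms"
      by (rule distinct_list_permutation[OF ms(3,2,1)])
    have "map f ms = map (\<lambda>i. map f [0..<n] ! \<sigma> i) [0..<n]"
      unfolding \<sigma>(2)[symmetric] using permutes_in_image[OF \<sigma>(1)] by simp
    then show "\<alpha> (map f ms) - \<beta> (map f ms) = 0"
      using alt_form_permute[OF assms(1) \<sigma>(1)] alt_form_permute[OF assms(2) \<sigma>(1)] assms(4) by simp
  qed
  then show ?thesis by simp
qed

text \<open>These permutations form the coset of \<open>\<sigma>0\<close> under the permutations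
  that move only \<open>k, ..., n - 1\<close>.\<close>

lemma card_permutations_prefix:
  assumes "distinct ms" "set ms \<subseteq> {..<n}" "length ms = k"
  shows "card {\<sigma>. \<sigma> permutes {..<n} \<and> map \<sigma> [0..<k] = ms} = fact (n - k)"
proof -
  obtain \<sigma>0 where \<sigma>0: "\<sigma>0 permutes {..<n}" "map \<sigma>0 [0..<k] = ms"
    using distinct_list_permutation[OF assms] .
  have "k \<le> n" using card_mono[OF _ assms(2)] distinct_card[OF assms(1)] assms(3) by simp
  have "bij_betw (\<lambda>\<pi>. \<sigma>0 \<circ> \<pi>) {\<pi>. \<pi> permutes {k..<n}} {\<sigma>. \<sigma> permutes {..<n} \<and> map \<sigma> [0..<k] = ms}"
  proof (rule bij_betwI[where g = "\<lambda>\<sigma>. inv \<sigma>0 \<circ> \<sigma>"])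
    show "(\<circ>) \<sigma>0 \<in> {\<pi>. \<pi> permutes {k..<n}} \<rightarrow> {\<sigma>. \<sigma> permutes {..<n} \<and> map \<sigma> [0..<k] = ms}"
    proof (clarsimp, intro conjI)
      fix \<pi> assume \<pi>: "\<pi> permutes {k..<n}"
      then have "\<pi> permutes {..<n}" by (rule permutes_subset) auto
      then show "\<sigma>0 \<circ> \<pi> permutes {..<n}" using \<sigma>0(1) by (rule permutes_compose)
      have "\<pi> i = i" if "i < k" for i using \<pi> that by (simp add: permutes_not_in)
      then show "map (\<sigma>0 \<circ> \<pi>) [0..<k] = ms" using \<sigma>0(2) by auto
    qed
    show "(\<lambda>\<sigma>. inv \<sigma>0 \<circ> \<sigma>) \<in> {\<sigma>. \<sigma> permutes {..<n} \<and> map \<sigma> [0..<k] = ms} \<rightarrow> {\<pi>. \<pi> permutes {k..<n}}"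
    proof clarsimp
      fix \<sigma> assume \<sigma>: "\<sigma> permutes {..<n}" "ms = map \<sigma> [0..<k]"
      have p: "inv \<sigma>0 \<circ> \<sigma> permutes {..<n}"
        using \<sigma>(1) permutes_inv[OF \<sigma>0(1)] by (rule permutes_compose)
      have "\<sigma> i = \<sigma>0 i" if "i < k" for i using \<sigma>0(2) \<sigma>(2) that by auto
      then have "(inv \<sigma>0 \<circ> \<sigma>) i = i" if "i < k" for i
        using that by (simp add: permutes_inverses[OF \<sigma>0(1)])
      then show "inv \<sigma>0 \<circ> \<sigma> permutes {k..<n}"
        using p by (intro permutes_superset[OF p]) auto
    qed
  qed (use permutes_inv_o[OF \<sigma>0(1)] in \<open>auto simp: o_assoc\<close>)
  from bij_betw_same_card[OF this] show ?thesis using card_permutations[of "{k..<n}" "n - k"] by simp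
qed

text \<open>Link between two normalizations: \<open>form_inner\<close> sums over index lists,
  \<open>wedge\<close> over permutations. A list without repetition is the prefix of
  \<open>(n - k)!\<close> permutations; lists with repetition contribute 0.\<close>

lemma sum_lists_eq_sum_permutations:
  fixes F :: "nat list \<Rightarrow> real"
  assumes "\<And>ms. length ms = k \<Longrightarrow> set ms \<subseteq> {..<n} \<Longrightarrow> \<not> distinct ms \<Longrightarrow> F ms = 0" and "k \<le> n"
  shows "(\<Sum>\<sigma> | \<sigma> permutes {..<n}. F (map \<sigma> [0..<k])) =
         fact (n - k) * (\<Sum>ms | set ms \<subseteq> {..<n} \<and> length ms = k. F ms)"
proof -
  let ?P = "{\<sigma>. \<sigma> permutes {..<n}}"
  let ?D = "{ms. set ms \<subseteq> {..<n} \<and> length ms = k \<and> distinct ms}"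
  have fin: "finite {ms. set ms \<subseteq> {..<n} \<and> length ms = k}" by (rule finite_lists_length_eq) simp
  have im: "(\<lambda>\<sigma>. map \<sigma> [0..<k]) ` ?P = ?D"
  proof
    show "(\<lambda>\<sigma>. map \<sigma> [0..<k]) ` ?P \<subseteq> ?D"
    proof clarify
      fix \<sigma> assume \<sigma>: "\<sigma> permutes {..<n}"
      have "\<sigma> i < n" if "i < k" for i
        using permutes_in_image[OF \<sigma>, of i] that assms(2) by simp
      then show "set (map \<sigma> [0..<k]) \<subseteq> {..<n} \<and> length (map \<sigma> [0..<k]) = k \<and> distinct (map \<sigma> [0..<k])"
        using permutes_inj_on[OF \<sigma>] by (auto simp: distinct_map)
    qed
    show "?D \<subseteq> (\<lambda>\<sigma>. map \<sigma> [0..<k]) ` ?P"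
    proof clarify
      fix ms assume ms: "set ms \<subseteq> {..<n}" "distinct ms" "k = length ms"
      obtain \<sigma> where "\<sigma> permutes {..<n}" "map \<sigma> [0..<length ms] = ms"
        by (rule distinct_list_permutation[OF ms(2,1) refl])
      then show "ms \<in> (\<lambda>\<sigma>. map \<sigma> [0..<length ms]) ` ?P"
        by (intro image_eqI[of _ _ \<sigma>]) auto
    qed
  qed
  have "(\<Sum>\<sigma>\<in>?P. F (map \<sigma> [0..<k])) =
        (\<Sum>ms\<in>?D. \<Sum>\<sigma> | \<sigma> \<in> ?P \<and> map \<sigma> [0..<k] = ms. F (map \<sigma> [0..<k]))"
    unfolding im[symmetric] by (rule sum.image_gen) (simp add: finite_permutations)
  also have "\<dots> = (\<Sum>ms\<in>?D. fact (n - k) * F ms)"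
  proof (rule sum.cong[OF refl])
    fix ms assume "ms \<in> ?D"
    then have "card {\<sigma>. \<sigma> \<in> ?P \<and> map \<sigma> [0..<k] = ms} = fact (n - k)"
      using card_permutations_prefix[of ms n k] by simp
    moreover have "(\<Sum>\<sigma> | \<sigma> \<in> ?P \<and> map \<sigma> [0..<k] = ms. F (map \<sigma> [0..<k])) =
        (\<Sum>\<sigma> | \<sigma> \<in> ?P \<and> map \<sigma> [0..<k] = ms. F ms)"
      by (rule sum.cong) auto
    ultimately show "(\<Sum>\<sigma> | \<sigma> \<in> ?P \<and> map \<sigma> [0..<k] = ms. F (map \<sigma> [0..<k])) = fact (n - k) * F ms"
      by simp
  qed
  also have "\<dots> = (\<Sum>ms | set ms \<subseteq> {..<n} \<and> length ms = k. fact (n - k) * F ms)"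
    by (rule sum.mono_neutral_left[OF fin]) (use assms in auto)
  finally show ?thesis by (simp add: sum_distrib_left)
qed

section \<open>Multilinearity and alternation of the wedge product\<close>

lemma linear_sum_fun: "(\<And>i. i \<in> I \<Longrightarrow> linear (f i)) \<Longrightarrow> linear (\<lambda>x. \<Sum>i\<in>I. f i x)"
  by (rule linear_compose_sum) auto

lemma map_update_permutation:
  assumes "inj \<sigma>" "i < length vs" "\<sigma> p = i" "a \<le> p" "p < b" "\<sigma> ` {a..<b} \<subseteq> {..<length vs}"
  shows "map (\<lambda>j. vs[i := v] ! \<sigma> j) [a..<b] = (map (\<lambda>j. vs ! \<sigma> j) [a..<b])[p - a := v]"
proof (rule nth_equalityI)
  fix m assume m: "m < length (map (\<lambda>j. vs[i := v] ! \<sigma> j) [a..<b])"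
  have "\<sigma> (a + m) = i \<longleftrightarrow> a + m = p" using inj_eq[OF assms(1), of "a + m" p] assms(3) by simp
  then show "map (\<lambda>j. vs[i := v] ! \<sigma> j) [a..<b] ! m = (map (\<lambda>j. vs ! \<sigma> j) [a..<b])[p - a := v] ! m"
    using m assms by (auto simp: nth_list_update)
qed simp

lemma map_update_permutation':
  assumes "inj \<sigma>" "\<sigma> p = i" "p \<notin> {a..<b}"
  shows "map (\<lambda>j. vs[i := v] ! \<sigma> j) [a..<b] = map (\<lambda>j. vs ! \<sigma> j) [a..<b]"
proof (rule map_cong[OF refl])
  fix j assume "j \<in> set [a..<b]"
  then have "\<sigma> j \<noteq> i" using inj_eq[OF assms(1), of j p] assms(2,3) by auto
  then show "vs[i := v] ! \<sigma> j = vs ! \<sigma> j" by simp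
qed

text \<open>In each summand exactly one factor reads slot \<open>i\<close>, namely the one that
  contains position \<open>inv \<sigma> i\<close>. Alternation comes from the sum itself: if two
  entries agree, composing \<sigma> with their transposition keeps both factors and reverses the
  sign.\<close>

lemma alt_form_wedge:
  fixes \<alpha> \<beta> :: "real form"
  assumes "multilin k \<alpha>" "multilin l \<beta>"
  shows "alt_form (k + l) (wedge k l \<alpha> \<beta>)"
  unfolding alt_form_def
proof (intro conjI allI impI)
  fix vs :: "(real^6) list" and i assume vs: "length vs = k + l \<and> i < k + l"
  let ?a = "\<lambda>vs \<sigma>. \<alpha> (map (\<lambda>i. vs ! \<sigma> i) [0..<k])" and ?b = "\<lambda>vs \<sigma>. \<beta> (map (\<lambda>i. vs ! \<sigma> i) [k..<k + l])"
  have "linear (\<lambda>v. of_int (sign \<sigma>) * ?a (vs[i := v]) \<sigma> * ?b (vs[i := v]) \<sigma>)"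
    if \<sigma>: "\<sigma> permutes {..<k + l}" for \<sigma>
  proof -
    obtain p where p: "\<sigma> p = i" "p < k + l"
    proof
      show "\<sigma> (inv \<sigma> i) = i" by (rule permutes_inverses[OF \<sigma>])
      show "inv \<sigma> i < k + l" using permutes_in_image[OF permutes_inv[OF \<sigma>], of i] vs by simp
    qed
    have inj: "inj \<sigma>" by (rule permutes_inj[OF \<sigma>])
    have im: "\<sigma> ` {0..<k} \<subseteq> {..<length vs}" "\<sigma> ` {k..<k+l} \<subseteq> {..<length vs}"
      by (simp_all add: vs image_subset_iff permutes_in_image[OF \<sigma>, unfolded lessThan_iff])
    show ?thesis
    proof (cases "p < k")
      case True
      have e1: "map (\<lambda>j. vs[i := v] ! \<sigma> j) [0..<k] = (map (\<lambda>j. vs ! \<sigma> j) [0..<k])[p := v]" for v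
        using map_update_permutation[OF inj _ p(1), of vs 0 k v] True im vs by simp
      have e2: "map (\<lambda>j. vs[i := v] ! \<sigma> j) [k..<k+l] = map (\<lambda>j. vs ! \<sigma> j) [k..<k+l]" for v
        by (rule map_update_permutation'[OF inj p(1)]) (use True in auto)
      have l: "linear (\<lambda>v. \<alpha> ((map (\<lambda>j. vs ! \<sigma> j) [0..<k])[p := v]))"
        using assms(1) True by (simp add: multilin_def)
      show ?thesis unfolding e1 e2
        using linear_compose_scale_right[OF l, of "of_int (sign \<sigma>) * ?b vs \<sigma>"]
        by (simp add: mult.assoc mult.commute mult.left_commute)
    next
      case False
      have e1: "map (\<lambda>j. vs[i := v] ! \<sigma> j) [k..<k+l] = (map (\<lambda>j. vs ! \<sigma> j) [k..<k+l])[p - k := v]" for v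
        using map_update_permutation[OF inj _ p(1), of vs k "k+l" v] False im vs p by simp
      have e2: "map (\<lambda>j. vs[i := v] ! \<sigma> j) [0..<k] = map (\<lambda>j. vs ! \<sigma> j) [0..<k]" for v
        by (rule map_update_permutation'[OF inj p(1)]) (use False in auto)
      have l: "linear (\<lambda>v. \<beta> ((map (\<lambda>j. vs ! \<sigma> j) [k..<k+l])[p - k := v]))"
        using assms(2) False p by (simp add: multilin_def)
      show ?thesis unfolding e1 e2
        using linear_compose_scale_right[OF l, of "of_int (sign \<sigma>) * ?a vs \<sigma>"]
        by (simp add: mult.assoc mult.commute mult.left_commute)
    qed
  qed
  then have "linear (\<lambda>v. \<Sum>\<sigma> | \<sigma> permutes {..<k + l}. of_int (sign \<sigma>) * ?a (vs[i := v]) \<sigma> * ?b (vs[i := v]) \<sigma>)"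
    by (intro linear_sum_fun) auto
  from linear_compose_scale_right[OF this, of "1 / (fact k * fact l)"]
  show "linear (\<lambda>v. wedge k l \<alpha> \<beta> (vs[i := v]))"
    using vs by (simp add: wedge_def)
next
  fix vs :: "(real^6) list" and i j
  assume vs: "length vs = k + l \<and> i < j \<and> j < k + l \<and> vs ! i = vs ! j"
  let ?G = "\<lambda>\<sigma>. \<alpha> (map (\<lambda>i. vs ! \<sigma> i) [0..<k]) * \<beta> (map (\<lambda>i. vs ! \<sigma> i) [k..<k + l])"
  let ?S = "\<Sum>\<sigma> | \<sigma> permutes {..<k + l}. of_int (sign \<sigma>) * ?G \<sigma>"
  let ?t = "Transposition.transpose i j"
  have t: "?t permutes {..<k + l}" using vs by (intro permutes_swap_id) auto
  have "?S = (\<Sum>\<sigma> | \<sigma> permutes {..<k + l}. of_int (sign (?t \<circ> \<sigma>)) * ?G (?t \<circ> \<sigma>))"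
    by (rule setum_permutations_compose_left[OF t])
  also have "\<dots> = (\<Sum>\<sigma> | \<sigma> permutes {..<k + l}. - (of_int (sign \<sigma>) * ?G \<sigma>))"
  proof (rule sum.cong[OF refl])
    fix \<sigma> assume "\<sigma> \<in> {\<sigma>. \<sigma> permutes {..<k + l}}"
    then have "permutation \<sigma>" using permutation_permutes by blast
    then have "sign (?t \<circ> \<sigma>) = - sign \<sigma>"
      using vs by (simp add: sign_compose[OF permutation_swap_id] sign_swap_id)
    moreover have "vs ! (?t \<circ> \<sigma>) m = vs ! \<sigma> m" for m
      using vs by (simp add: Transposition.transpose_def)
    ultimately show "of_int (sign (?t \<circ> \<sigma>)) * ?G (?t \<circ> \<sigma>) = - (of_int (sign \<sigma>) * ?G \<sigma>)" by simp
  qed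
  finally have "?S = 0" by (simp add: sum_negf)
  then show "wedge k l \<alpha> \<beta> vs = 0" using vs by (simp add: wedge_def mult_ac)
qed (simp add: wedge_def)

section \<open>Inner products of forms in an orthonormal frame\<close>

lemma sum_lists_Suc:
  assumes "finite A"
  shows "(\<Sum>ms | set ms \<subseteq> A \<and> length ms = Suc k. F ms) =
         (\<Sum>m\<in>A. \<Sum>ms | set ms \<subseteq> A \<and> length ms = k. F (m # ms))"
proof -
  let ?L = "{ms. set ms \<subseteq> A \<and> length ms = k}"
  have "(\<Sum>ms | set ms \<subseteq> A \<and> length ms = Suc k. F ms) = (\<Sum>(ms, m)\<in>?L \<times> A. F (m # ms))"
    unfolding lists_length_Suc_eq by (subst sum.reindex) (auto simp: inj_on_def case_prod_unfold)
  also have "\<dots> = (\<Sum>ms\<in>?L. \<Sum>m\<in>A. F (m # ms))" by (rule sum.cartesian_product[symmetric])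
  also have "\<dots> = (\<Sum>m\<in>A. \<Sum>ms\<in>?L. F (m # ms))" by (rule sum.swap)
  finally show ?thesis .
qed

lemma multilin_head_expand:
  assumes "multilin (Suc k) \<alpha>" "length vs = k"
  shows "\<alpha> (v # vs) = (\<Sum>i\<in>UNIV. v $ i * \<alpha> (axis i 1 # vs))"
proof -
  note l = multilin_head[OF assms]
  have "v = (\<Sum>i\<in>UNIV. (v $ i) *\<^sub>R axis i 1)"
    using basis_expansion[of v] by (simp add: scalar_mult_eq_scaleR)
  then have "\<alpha> (v # vs) = \<alpha> ((\<Sum>i\<in>UNIV. (v $ i) *\<^sub>R axis i 1) # vs)" by simp
  also have "\<dots> = (\<Sum>i\<in>UNIV. v $ i * \<alpha> (axis i 1 # vs))"
    by (simp add: linear_sum[OF l] linear_scale[OF l] o_def)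
  finally show ?thesis .
qed

text \<open>\<open>H\<close> stands for the inverse Gram matrix. Written as a sum of rank-one terms,
  one for each frame vector, it turns the double sum over coordinate indices into a single sum over
  frame indices. The induction splits the first index off both lists.\<close>

lemma form_sum_change_basis:
  fixes H :: "real^6^6" and f :: "nat \<Rightarrow> real^6"
  assumes H: "\<And>i j. H $ i $ j = (\<Sum>m<6. f m $ i * f m $ j)"
    and "multilin k \<alpha>" "multilin k \<beta>"
  shows "(\<Sum>is | length is = k. \<Sum>js | length js = k.
           (\<Prod>a<k. H $ (is ! a) $ (js ! a)) * \<alpha> (map (\<lambda>i. axis i 1) is) * \<beta> (map (\<lambda>j. axis j 1) js))
       = (\<Sum>ms | set ms \<subseteq> {..<6} \<and> length ms = k. \<alpha> (map f ms) * \<beta> (map f ms))"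
  using assms(2,3)
proof (induction k arbitrary: \<alpha> \<beta>)
  case 0
  then show ?case by (simp add: conj_commute cong: conj_cong)
next
  case (Suc k)
  let ?e = "map (\<lambda>i. axis i (1::real)) :: 6 list \<Rightarrow> (real^6) list"
  let ?M = "{ms. set ms \<subseteq> {..<6::nat} \<and> length ms = k}"
  have L: "(\<Sum>is | length is = Suc k. F is) = (\<Sum>i\<in>UNIV. \<Sum>is | length is = k. F (i # is))"
    for F :: "6 list \<Rightarrow> real"
    using sum_lists_Suc[of "UNIV :: 6 set" F k] by simp
  have "(\<Sum>is | length is = Suc k. \<Sum>js | length js = Suc k.
           (\<Prod>a<Suc k. H $ (is ! a) $ (js ! a)) * \<alpha> (?e is) * \<beta> (?e js))
      = (\<Sum>i\<in>UNIV. \<Sum>j\<in>UNIV. \<Sum>is | length is = k. \<Sum>js | length js = k.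
           H $ i $ j * ((\<Prod>a<k. H $ (is ! a) $ (js ! a)) * \<alpha> (axis i 1 # ?e is) * \<beta> (axis j 1 # ?e js)))"
    unfolding L
    by (intro sum.cong[OF refl], subst sum.swap, simp add: prod.lessThan_Suc_shift mult.assoc del: prod.lessThan_Suc)
  also have "\<dots> = (\<Sum>i\<in>UNIV. \<Sum>j\<in>UNIV. H $ i $ j *
       (\<Sum>ms\<in>?M. \<alpha> (axis i 1 # map f ms) * \<beta> (axis j 1 # map f ms)))"
    using Suc.IH[OF multilin_tail[OF Suc.prems(1)] multilin_tail[OF Suc.prems(2)]]
    by (simp add: sum_distrib_left[symmetric])
  also have "\<dots> = (\<Sum>i\<in>UNIV. \<Sum>j\<in>UNIV. \<Sum>m<6. \<Sum>ms\<in>?M.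
       (f m $ i * \<alpha> (axis i 1 # map f ms)) * (f m $ j * \<beta> (axis j 1 # map f ms)))"
    unfolding H sum_product by (intro sum.cong[OF refl]) (simp add: mult_ac)
  also have "\<dots> = (\<Sum>i\<in>UNIV. \<Sum>m<6. \<Sum>ms\<in>?M. \<Sum>j\<in>UNIV.
       (f m $ i * \<alpha> (axis i 1 # map f ms)) * (f m $ j * \<beta> (axis j 1 # map f ms)))"
    by (rule sum.cong[OF refl], subst sum.swap, rule sum.cong[OF refl], rule sum.swap)
  also have "\<dots> = (\<Sum>m<6. \<Sum>ms\<in>?M. \<Sum>i\<in>UNIV. \<Sum>j\<in>UNIV.
       (f m $ i * \<alpha> (axis i 1 # map f ms)) * (f m $ j * \<beta> (axis j 1 # map f ms)))"
    by (subst sum.swap, rule sum.cong[OF refl], rule sum.swap)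
  also have "\<dots> = (\<Sum>m<6. \<Sum>ms\<in>?M. \<alpha> (f m # map f ms) * \<beta> (f m # map f ms))"
  proof (intro sum.cong[OF refl])
    fix m ms assume "ms \<in> ?M"
    then have "length (map f ms) = k" by simp
    then show "(\<Sum>i\<in>UNIV. \<Sum>j\<in>UNIV.
       (f m $ i * \<alpha> (axis i 1 # map f ms)) * (f m $ j * \<beta> (axis j 1 # map f ms))) =
       \<alpha> (f m # map f ms) * \<beta> (f m # map f ms)"
      using multilin_head_expand[OF Suc.prems(1), of "map f ms" "f m"]
        multilin_head_expand[OF Suc.prems(2), of "map f ms" "f m"]
      by (simp only: sum_product)
  qed
  also have "\<dots> = (\<Sum>ms | set ms \<subseteq> {..<6} \<and> length ms = Suc k. \<alpha> (map f ms) * \<beta> (map f ms))"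
    by (simp add: sum_lists_Suc)
  finally show ?case .
qed

lemma matrix_inv_eqI:
  fixes A X :: "real^'n^'n"
  assumes "A ** X = mat 1"
  shows "matrix_inv A = X"
proof -
  have "invertible A" using assms invertible_right_inverse by blast
  then have "\<exists>B. A ** B = mat 1 \<and> B ** A = mat 1" by (simp add: invertible_def)
  then have "matrix_inv A ** A = mat 1" unfolding matrix_inv_def by (rule someI2_ex) simp
  then show ?thesis
    using matrix_mul_assoc[of "matrix_inv A" A X] assms by simp
qed

text \<open>Orthonormality is encoded as the expansion formula. Six vectors that span the space are
  independent, so the formula applied to \<open>f i\<close> forces \<open>g (f i) (f j)\<close> to
  be 1 or 0; in this form it gives spanning and the inverse Gram matrix at once.\<close>

definition onb :: "(real^6 \<Rightarrow> real^6 \<Rightarrow> real) \<Rightarrow> (nat \<Rightarrow> real^6) \<Rightarrow> bool" where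
  "onb g f \<longleftrightarrow> (\<forall>v. linear (g v)) \<and> (\<forall>v. v = (\<Sum>m<6. g v (f m) *\<^sub>R f m))"

lemma onb_expand: "onb g f \<Longrightarrow> (\<Sum>m<6. g v (f m) *\<^sub>R f m) = v"
  unfolding onb_def by (elim conjE, rule sym, erule spec)

lemma onb_span: "onb g f \<Longrightarrow> span (f ` {..<6}) = UNIV"
proof -
  assume "onb g f"
  then have "v \<in> span (f ` {..<6})" for v
    by (subst onb_expand[symmetric], assumption) (intro span_sum span_scale span_base imageI)
  then show ?thesis by blast
qed

lemma linear_expand_axis:
  fixes h :: "real^'n \<Rightarrow> real"
  assumes "linear h" shows "h v = (\<Sum>i\<in>UNIV. v $ i * h (axis i 1))"
proof -
  have "v = (\<Sum>i\<in>UNIV. (v $ i) *\<^sub>R axis i 1)"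
    using basis_expansion[of v] by (simp add: scalar_mult_eq_scaleR)
  then have "h v = h (\<Sum>i\<in>UNIV. (v $ i) *\<^sub>R axis i 1)" by simp
  also have "\<dots> = (\<Sum>i\<in>UNIV. v $ i * h (axis i 1))"
    by (simp add: linear_sum[OF assms] linear_scale[OF assms] o_def)
  finally show ?thesis .
qed

lemma matrix_inv_onb:
  assumes "onb g f"
  shows "matrix_inv (\<chi> i j. g (axis i 1) (axis j 1)) $ i $ j = (\<Sum>m<6. f m $ i * f m $ j)"
proof -
  let ?X = "(\<chi> i j. \<Sum>m<6. f m $ i * f m $ j) :: real^6^6"
  have "(\<Sum>c\<in>UNIV. g (axis a 1) (axis c 1) * (\<Sum>m<6. f m $ c * f m $ b)) = (if a = b then 1 else 0)" for a b
  proof -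
    have "(\<Sum>c\<in>UNIV. g (axis a 1) (axis c 1) * (\<Sum>m<6. f m $ c * f m $ b)) =
       (\<Sum>m<6. (\<Sum>c\<in>UNIV. f m $ c * g (axis a 1) (axis c 1)) * f m $ b)"
      unfolding sum_distrib_left sum_distrib_right
      by (subst sum.swap) (simp add: mult_ac)
    also have "\<dots> = (\<Sum>m<6. g (axis a 1) (f m) * f m $ b)"
    proof (rule sum.cong[OF refl])
      fix m
      have "linear (g (axis a 1))" using assms by (simp add: onb_def)
      from linear_expand_axis[OF this, of "f m"]
      show "(\<Sum>c\<in>UNIV. f m $ c * g (axis a 1) (axis c 1)) * f m $ b = g (axis a 1) (f m) * f m $ b"
        by simp
    qed
    also have "\<dots> = (\<Sum>m<6. g (axis a 1) (f m) *\<^sub>R f m) $ b" by simp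
    also have "(\<Sum>m<6. g (axis a 1) (f m) *\<^sub>R f m) = axis a 1" by (rule onb_expand[OF assms])
    finally show ?thesis by (simp add: axis_def)
  qed
  then have "(\<chi> i j. g (axis i 1) (axis j 1)) ** ?X = mat 1"
    by (simp add: matrix_matrix_mult_def mat_def vec_eq_iff)
  then show ?thesis by (simp add: matrix_inv_eqI)
qed

lemma form_inner_onb:
  assumes "onb g f" "multilin k \<alpha>" "multilin k \<beta>"
  shows "form_inner g k \<alpha> \<beta> =
    (\<Sum>ms | set ms \<subseteq> {..<6} \<and> length ms = k. \<alpha> (map f ms) * \<beta> (map f ms)) / fact k"
  unfolding form_inner_def Let_def
  by (subst form_sum_change_basis[OF matrix_inv_onb[OF assms(1)] assms(2,3)]) simp

lemma alt_form_permuted_basis: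
  fixes \<tau> :: "real form"
  assumes "alt_form n \<tau>" "\<sigma> permutes {..<n}"
  shows "\<tau> (map (\<lambda>i. f (\<sigma> i)) [0..<n]) = of_int (sign \<sigma>) * \<tau> (map f [0..<n])"
proof -
  have eq: "map (\<lambda>i. f (\<sigma> i)) [0..<n] = map (\<lambda>i. map f [0..<n] ! \<sigma> i) [0..<n]"
    using permutes_in_image[OF assms(2)] by simp
  show ?thesis unfolding eq by (rule alt_form_permute[OF assms]) simp
qed

text \<open>All 6! orderings of the frame give the same square, and \<open>form_inner\<close>
  divides by 6!. Hence \<open>vol_form\<close> takes the value 1 on a positive orthonormal
  frame.\<close>

lemma form_inner_self_onb:
  assumes "onb g f" and \<tau>: "alt_form 6 \<tau>"
  shows "form_inner g 6 \<tau> \<tau> = (\<tau> (map f [0..<6]))\<^sup>2"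
proof -
  have "(\<Sum>ms | set ms \<subseteq> {..<6} \<and> length ms = 6. \<tau> (map f ms) * \<tau> (map f ms)) =
        (\<Sum>\<sigma> | \<sigma> permutes {..<6}. \<tau> (map f (map \<sigma> [0..<6])) * \<tau> (map f (map \<sigma> [0..<6])))"
    by (subst sum_lists_eq_sum_permutations) (auto simp: distinct_map intro!: alt_form_not_distinct[OF \<tau>])
  also have "\<dots> = (\<Sum>\<sigma> | \<sigma> permutes {..<6::nat}. (\<tau> (map f [0..<6]))\<^sup>2)"
  proof (rule sum.cong[OF refl])
    fix \<sigma> assume "\<sigma> \<in> {\<sigma>. \<sigma> permutes {..<6::nat}}"
    then have "\<tau> (map f (map \<sigma> [0..<6])) = of_int (sign \<sigma>) * \<tau> (map f [0..<6])"
      using alt_form_permuted_basis[OF \<tau>] by (simp add: o_def)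
    moreover have "of_int (sign \<sigma>) * of_int (sign \<sigma>) = (1::real)" by (simp add: sign_def)
    ultimately show "\<tau> (map f (map \<sigma> [0..<6])) * \<tau> (map f (map \<sigma> [0..<6])) = (\<tau> (map f [0..<6]))\<^sup>2"
      by (simp add: power2_eq_square algebra_simps)
  qed
  also have "\<dots> = fact 6 * (\<tau> (map f [0..<6]))\<^sup>2" by (simp add: card_permutations[of _ 6])
  finally show ?thesis
    by (simp add: form_inner_onb[OF assms(1) alt_form_multilin[OF \<tau>] alt_form_multilin[OF \<tau>]])
qed

lemma wedge_at_basis:
  "wedge k l \<alpha> \<beta> (map f [0..<k + l]) =
     (\<Sum>\<sigma> | \<sigma> permutes {..<k + l}. of_int (sign \<sigma>) * \<alpha> (map (\<lambda>i. f (\<sigma> i)) [0..<k])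
        * \<beta> (map (\<lambda>i. f (\<sigma> i)) [k..<k + l])) / (fact k * fact l)"
proof -
  have eq: "map (\<lambda>i. map f [0..<k + l] ! \<sigma> i) [a..<b] = map (\<lambda>i. f (\<sigma> i)) [a..<b]"
    if \<sigma>: "\<sigma> permutes {..<k + l}" and "b \<le> k + l" for \<sigma> a b
    using permutes_in_image[OF \<sigma>, unfolded lessThan_iff] that by simp
  have "(\<Sum>\<sigma> | \<sigma> permutes {..<k + l}. of_int (sign \<sigma>) * \<alpha> (map (\<lambda>i. map f [0..<k + l] ! \<sigma> i) [0..<k])
        * \<beta> (map (\<lambda>i. map f [0..<k + l] ! \<sigma> i) [k..<k + l])) =
     (\<Sum>\<sigma> | \<sigma> permutes {..<k + l}. of_int (sign \<sigma>) * \<alpha> (map (\<lambda>i. f (\<sigma> i)) [0..<k])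
        * \<beta> (map (\<lambda>i. f (\<sigma> i)) [k..<k + l]))"
    by (rule sum.cong[OF refl]) (simp only: mem_Collect_eq eq le_add1 order_refl)
  then show ?thesis by (simp only: wedge_def length_map length_upt diff_zero if_True refl)
qed

text \<open>The test form is \<tau> contracted with the frame vectors at \<open>js\<close>. In its
  wedge product with \<delta> nothing cancels: each term is 0 or the same number \<open>?c\<close>,
  and at least one term is \<open>?c\<close>.\<close>

lemma wedge_pairing_nondegenerate:
  fixes \<tau> \<delta> :: "real form"
  assumes \<tau>: "alt_form (k + l) \<tau>" "\<tau> (map f [0..<k + l]) \<noteq> 0" and span: "span (f ` {..<k + l}) = UNIV"
    and \<delta>: "alt_form l \<delta>" and 0: "\<And>\<alpha>. alt_form k \<alpha> \<Longrightarrow> wedge k l \<alpha> \<delta> (map f [0..<k + l]) = 0"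
  shows "\<delta> vs = 0"
proof (rule alt_form_eq_0[OF \<delta> span])
  fix js assume js: "length js = l" "set js \<subseteq> {..<k + l}" "distinct js"
  define \<alpha> where "\<alpha> vs = \<tau> (vs @ map f js)" for vs
  have \<alpha>: "alt_form k \<alpha>" unfolding \<alpha>_def using js by (intro alt_form_prefix[OF \<tau>(1)]) simp
  let ?c = "\<tau> (map f [0..<k + l]) * \<delta> (map f js)"
  let ?T = "\<lambda>\<sigma>. of_int (sign \<sigma>) * \<alpha> (map (\<lambda>i. f (\<sigma> i)) [0..<k]) * \<delta> (map (\<lambda>i. f (\<sigma> i)) [k..<k + l])"
  have T: "?T \<sigma> = (if set (map \<sigma> [0..<k]) \<inter> set js = {} then ?c else 0)"
    if \<sigma>: "\<sigma> permutes {..<k + l}" for \<sigma>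
  proof (cases "set (map \<sigma> [0..<k]) \<inter> set js = {}")
    case False
    then have "\<not> distinct (map f (map \<sigma> [0..<k] @ js))" by (auto simp: distinct_map inj_on_def)
    then have "\<tau> (map f (map \<sigma> [0..<k] @ js)) = 0" by (rule alt_form_not_distinct[OF \<tau>(1)])
    then have "\<alpha> (map (\<lambda>i. f (\<sigma> i)) [0..<k]) = 0" by (simp add: \<alpha>_def o_def)
    then show ?thesis using False by simp
  next
    case True
    let ?s = "map \<sigma> [k..<k + l]"
    have inj: "inj_on \<sigma> A" for A by (rule permutes_inj_on[OF \<sigma>])
    have im: "\<sigma> ` {..<k + l} = {..<k + l}" by (rule permutes_image[OF \<sigma>])
    have "set js \<subseteq> \<sigma> ` {..<k + l} - \<sigma> ` {0..<k}" using True js(2) im by auto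
    also have "\<dots> = \<sigma> ` ({..<k + l} - {0..<k})" by (rule inj_on_image_set_diff[symmetric, OF inj]) auto
    also have "{..<k + l} - {0..<k} = {k..<k + l}" by auto
    finally have sub: "set js \<subseteq> set ?s" by simp
    have "card (set ?s) = l" using card_image[OF inj] by simp
    then have "set js = set ?s" using sub js distinct_card[OF js(3)] by (intro card_subset_eq) auto
    then have "mset js = mset ?s" using js(3) inj by (intro set_eq_iff_mset_eq_distinct[THEN iffD1]) (auto simp: distinct_map)
    \<comment> \<open>The last \<open>l\<close> indices read by \<sigma> are \<open>js\<close> in
      some order \<rho>. The sign of \<rho> enters once through \<delta> and once through \<tau>, so
      it cancels, as does the sign of \<sigma>.\<close>
    then obtain \<rho> where \<rho>: "\<rho> permutes {..<length ?s}" "permute_list \<rho> ?s = js"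
      by (rule mset_eq_permutation)
    have \<rho>': "\<rho> permutes {..<l}" using \<rho>(1) by simp
    have js_eq: "map f js = map (\<lambda>i. map f ?s ! \<rho> i) [0..<l]"
      unfolding \<rho>(2)[symmetric] permute_list_def
      using permutes_in_image[OF \<rho>', unfolded lessThan_iff] by simp
    have d: "\<delta> (map f js) = of_int (sign \<rho>) * \<delta> (map f ?s)"
      unfolding js_eq by (rule alt_form_permute[OF \<delta> \<rho>']) simp
    have "\<alpha> (map (\<lambda>i. f (\<sigma> i)) [0..<k]) = \<tau> (map f (map \<sigma> [0..<k]) @ map f js)"
      by (simp add: \<alpha>_def o_def)
    also have "\<dots> = of_int (sign \<rho>) * \<tau> (map f (map \<sigma> [0..<k]) @ map f ?s)"
      unfolding js_eq by (rule alt_form_permute[OF alt_form_suffix[OF \<tau>(1)] \<rho>']) simp_all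
    also have "map f (map \<sigma> [0..<k]) @ map f ?s = map (\<lambda>i. f (\<sigma> i)) [0..<k + l]"
      by (simp add: upt_add_eq_append[of 0 k l] o_def)
    also have "\<tau> \<dots> = of_int (sign \<sigma>) * \<tau> (map f [0..<k + l])"
      by (rule alt_form_permuted_basis[OF \<tau>(1) \<sigma>])
    finally have a: "\<alpha> (map (\<lambda>i. f (\<sigma> i)) [0..<k]) = of_int (sign \<rho>) * (of_int (sign \<sigma>) * \<tau> (map f [0..<k + l]))" .
    have "of_int (sign \<sigma>) * of_int (sign \<sigma>) = (1::real)" by (simp add: sign_def)
    then show ?thesis using True unfolding a d by (simp add: o_def)
  qed
  have "0 = (\<Sum>\<sigma> | \<sigma> permutes {..<k + l}. ?T \<sigma>)" using 0[OF \<alpha>] unfolding wedge_at_basis by simp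
  also have "\<dots> = (\<Sum>\<sigma> | \<sigma> permutes {..<k + l}. if set (map \<sigma> [0..<k]) \<inter> set js = {} then ?c else 0)"
    by (rule sum.cong[OF refl]) (simp only: T mem_Collect_eq)
  also have "\<dots> = real (card {\<sigma>. \<sigma> permutes {..<k + l} \<and> set (map \<sigma> [0..<k]) \<inter> set js = {}}) * ?c"
    by (simp add: sum.If_cases finite_permutations Int_def)
  finally have prod0: "real (card {\<sigma>. \<sigma> permutes {..<k + l} \<and> set (map \<sigma> [0..<k]) \<inter> set js = {}}) * ?c = 0"
    by simp
  obtain rs where rs: "set rs = {..<k + l} - set js" "distinct rs"
    using finite_distinct_list[of "{..<k + l} - set js"] by auto
  have len: "length rs = k" using rs js distinct_card[OF rs(2)] distinct_card[OF js(3)] by (simp add: card_Diff_subset)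
  have sub: "set rs \<subseteq> {..<k + l}" using rs(1) by simp
  obtain \<sigma> where \<sigma>: "\<sigma> permutes {..<k + l}" "map \<sigma> [0..<k] = rs"
    by (rule distinct_list_permutation[OF rs(2) sub len])
  have "set (map \<sigma> [0..<k]) \<inter> set js = {}" unfolding \<sigma>(2) rs(1) by blast
  then have "\<sigma> \<in> {\<sigma>. \<sigma> permutes {..<k + l} \<and> set (map \<sigma> [0..<k]) \<inter> set js = {}}"
    using \<sigma>(1) by (intro CollectI conjI)
  moreover have "finite {\<sigma>. \<sigma> permutes {..<k + l} \<and> set (map \<sigma> [0..<k]) \<inter> set js = {}}"
    by (rule finite_subset[OF _ finite_permutations[of "{..<k + l}"]]) auto
  ultimately have "card {\<sigma>. \<sigma> permutes {..<k + l} \<and> set (map \<sigma> [0..<k]) \<inter> set js = {}} \<noteq> 0"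
    by auto
  then show "\<delta> (map f js) = 0" using prod0 \<tau>(2) by simp
qed

text \<open>The star is recognized on one frame: \<beta> on \<open>k\<close> frame vectors against
  \<gamma> on the complementary ones, up to sign. The defining equation compares two top forms and
  is therefore checked on the frame; uniqueness is nondegeneracy of the wedge pairing.\<close>

lemma hodge_star_eqI:
  assumes f: "onb g f" and \<tau>: "alt_form 6 \<tau>" "\<tau> (map f [0..<6]) > 0"
    and \<beta>: "alt_form k \<beta>" and \<gamma>: "alt_form (6 - k) \<gamma>" and k: "k \<le> 6"
    and dual: "\<And>\<sigma>. \<sigma> permutes {..<6} \<Longrightarrow>
       of_int (sign \<sigma>) * \<gamma> (map (\<lambda>i. f (\<sigma> i)) [k..<6]) = \<beta> (map (\<lambda>i. f (\<sigma> i)) [0..<k])"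
  shows "hodge_star g \<tau> k \<beta> = \<gamma>"
proof -
  let ?l = "6 - k"
  have kl: "k + ?l = 6" using k by simp
  note span = onb_span[OF f]
  have star: "wedge k ?l \<alpha> \<gamma> vs = form_inner g k \<alpha> \<beta> * vol_form g \<tau> vs" if \<alpha>: "alt_form k \<alpha>" for \<alpha> vs
  proof (rule alt_form_top_eq[OF _ _ span])
    show "alt_form 6 (wedge k ?l \<alpha> \<gamma>)"
      using alt_form_wedge[OF alt_form_multilin[OF \<alpha>] alt_form_multilin[OF \<gamma>]] kl by simp
    show "alt_form 6 (\<lambda>vs. form_inner g k \<alpha> \<beta> * vol_form g \<tau> vs)"
      using alt_form_scale[OF \<tau>(1), of "form_inner g k \<alpha> \<beta> / sqrt (form_inner g 6 \<tau> \<tau>)"]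
      by (simp add: vol_form_def)
    have "wedge k ?l \<alpha> \<gamma> (map f [0..<6]) =
      (\<Sum>\<sigma> | \<sigma> permutes {..<6}. \<alpha> (map f (map \<sigma> [0..<k])) * \<beta> (map f (map \<sigma> [0..<k]))) / (fact k * fact ?l)"
    proof -
      have "(\<Sum>\<sigma> | \<sigma> permutes {..<6}. of_int (sign \<sigma>) * \<alpha> (map (\<lambda>i. f (\<sigma> i)) [0..<k])
          * \<gamma> (map (\<lambda>i. f (\<sigma> i)) [k..<6]))
        = (\<Sum>\<sigma> | \<sigma> permutes {..<6}. \<alpha> (map f (map \<sigma> [0..<k])) * \<beta> (map f (map \<sigma> [0..<k])))"
      proof (rule sum.cong[OF refl])
        fix \<sigma> assume "\<sigma> \<in> {\<sigma>. \<sigma> permutes {..<6::nat}}"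
        then show "of_int (sign \<sigma>) * \<alpha> (map (\<lambda>i. f (\<sigma> i)) [0..<k]) * \<gamma> (map (\<lambda>i. f (\<sigma> i)) [k..<6])
          = \<alpha> (map f (map \<sigma> [0..<k])) * \<beta> (map f (map \<sigma> [0..<k]))"
          using dual[of \<sigma>] by (simp add: o_def mult.assoc mult.left_commute)
      qed
      then show ?thesis using wedge_at_basis[of k ?l \<alpha> \<gamma> f] unfolding kl by simp
    qed
    \<comment> \<open>The factor \<open>fact ?l\<close> counts the permutations with a common prefix
      and cancels against the normalization of \<open>wedge\<close>.\<close>
    also have "\<dots> = fact ?l * (\<Sum>ms | set ms \<subseteq> {..<6} \<and> length ms = k. \<alpha> (map f ms) * \<beta> (map f ms)) / (fact k * fact ?l)"
      by (subst sum_lists_eq_sum_permutations[OF _ k])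
        (auto simp: distinct_map intro!: alt_form_not_distinct[OF \<alpha>])
    also have "\<dots> = form_inner g k \<alpha> \<beta>"
      by (simp add: form_inner_onb[OF f alt_form_multilin[OF \<alpha>] alt_form_multilin[OF \<beta>]])
    finally have "wedge k ?l \<alpha> \<gamma> (map f [0..<6]) = form_inner g k \<alpha> \<beta>" .
    moreover have "vol_form g \<tau> (map f [0..<6]) = 1"
      using \<tau>(2) by (simp add: vol_form_def form_inner_self_onb[OF f \<tau>(1)])
    ultimately show "wedge k ?l \<alpha> \<gamma> (map f [0..<6]) = form_inner g k \<alpha> \<beta> * vol_form g \<tau> (map f [0..<6])"
      by simp
  qed
  show ?thesis unfolding hodge_star_def
  proof (rule the_equality)
    show "alt_form ?l \<gamma> \<and> (\<forall>\<alpha>. alt_form k \<alpha> \<longrightarrow>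
        (\<forall>vs. wedge k ?l \<alpha> \<gamma> vs = form_inner g k \<alpha> \<beta> * vol_form g \<tau> vs))"
      using \<gamma> star by blast
  next
    fix \<gamma>' assume *: "alt_form ?l \<gamma>' \<and> (\<forall>\<alpha>. alt_form k \<alpha> \<longrightarrow>
        (\<forall>vs. wedge k ?l \<alpha> \<gamma>' vs = form_inner g k \<alpha> \<beta> * vol_form g \<tau> vs))"
    have w: "wedge k ?l \<alpha> (\<lambda>vs. \<gamma>' vs - \<gamma> vs) vs = wedge k ?l \<alpha> \<gamma>' vs - wedge k ?l \<alpha> \<gamma> vs" for \<alpha> vs
      by (simp add: wedge_def right_diff_distrib sum_subtractf diff_divide_distrib)
    have "\<gamma>' vs - \<gamma> vs = 0" for vs
    proof (rule wedge_pairing_nondegenerate[where k = k and l = ?l and f = f and \<tau> = \<tau>])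
      show "wedge k ?l \<alpha> (\<lambda>vs. \<gamma>' vs - \<gamma> vs) (map f [0..<k + ?l]) = 0" if "alt_form k \<alpha>" for \<alpha>
        unfolding w using star[OF that] * that by simp
    qed (use kl span \<tau> \<gamma> * alt_form_diff in auto)
    then show "\<gamma>' = \<gamma>" by auto
  qed
qed

section \<open>Explicit permutation sums in dimension six\<close>

lemma permutes_insertE:
  assumes "\<tau> permutes insert a S" "finite S"
  obtains b \<sigma> where "b \<in> insert a S" "\<sigma> permutes S"
    "\<tau> = (\<lambda>i. Transposition.transpose a b (\<sigma> i))" "sign \<tau> = (if a = b then sign \<sigma> else - sign \<sigma>)"
proof -
  have "\<tau> \<in> {p. p permutes insert a S}" using assms(1) by simp
  then obtain b \<sigma> where *: "b \<in> insert a S" "\<sigma> permutes S" "\<tau> = Transposition.transpose a b \<circ> \<sigma>"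
    unfolding permutes_insert by auto
  have "permutation \<sigma>" using *(2) assms(2) permutation_permutes by blast
  then have "sign \<tau> = (if a = b then sign \<sigma> else - sign \<sigma>)"
    unfolding *(3) by (simp add: sign_compose[OF permutation_swap_id] sign_swap_id)
  then show thesis using that * by (simp add: o_def)
qed

text \<open>The sign is a separate argument of \<open>Q\<close>, so that repeated expansion carries
  it along and \<open>sign\<close> of an explicit composite never has to be evaluated.\<close>

lemma sum_permutations_insert_sign:
  assumes "finite S" "a \<notin> S"
  shows "(\<Sum>\<sigma> | \<sigma> permutes insert a S. Q (sign \<sigma>) \<sigma>) =
    (\<Sum>b\<in>insert a S. \<Sum>\<sigma> | \<sigma> permutes S.
       Q (if a = b then sign \<sigma> else - sign \<sigma>) (Transposition.transpose a b \<circ> \<sigma>))"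
proof -
  have s: "sign (Transposition.transpose a b \<circ> \<sigma>) = (if a = b then sign \<sigma> else - sign \<sigma>)"
    if "\<sigma> permutes S" for b \<sigma>
  proof -
    have "permutation \<sigma>" using that assms(1) permutation_permutes by blast
    then show ?thesis by (simp add: sign_compose[OF permutation_swap_id] sign_swap_id)
  qed
  show ?thesis unfolding sum_over_permutations_insert[OF assms]
    by (intro sum.cong refl) (simp only: s mem_Collect_eq)
qed

lemma lessThan_numerals:
  "{..<2::nat} = {0, 1}" "{..<3::nat} = {0, 1, 2}" "{..<4::nat} = {0, 1, 2, 3}"
  "{..<6::nat} = {0, 1, 2, 3, 4, 5}"
  by auto

text \<open>Every permutation of six indices is a product of transpositions
  \<open>(0 b\<^sub>0) (1 b\<^sub>1) (2 b\<^sub>2) (3 b\<^sub>3) (4 b\<^sub>4)\<close> with \<open>b\<^sub>a \<ge> a\<close>.\<close>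

lemma permutations_6_induct:
  assumes \<sigma>: "\<sigma> permutes {..<6}"
  and P: "\<forall>b0\<in>{0, 1, 2, 3, 4, 5}. \<forall>b1\<in>{1, 2, 3, 4, 5}. \<forall>b2\<in>{2, 3, 4, 5}. \<forall>b3\<in>{3, 4, 5}. \<forall>b4\<in>{4, 5}.
    (let t = \<lambda>a b i. if i = a then b else if i = b then a else (i::nat);
         s = \<lambda>a b e. if a = b then e else - e;
         \<sigma> = \<lambda>i. t 0 b0 (t 1 b1 (t 2 b2 (t 3 b3 (t 4 b4 i))))
     in P (s 0 b0 (s 1 b1 (s 2 b2 (s 3 b3 (s 4 b4 1))))) (\<sigma> 0) (\<sigma> 1) (\<sigma> 2) (\<sigma> 3) (\<sigma> 4) (\<sigma> 5))"
  shows "P (sign \<sigma>) (\<sigma> 0) (\<sigma> 1) (\<sigma> 2) (\<sigma> 3) (\<sigma> 4) (\<sigma> 5)"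
proof -
  have "\<sigma> permutes insert 0 {1, 2, 3, 4, 5}" using \<sigma> by (simp only: lessThan_numerals)
  then obtain b0 s1 where 0: "b0 \<in> {0, 1, 2, 3, 4, 5}" "s1 permutes insert 1 {2, 3, 4, 5}"
    "\<sigma> = (\<lambda>i. Transposition.transpose 0 b0 (s1 i))" "sign \<sigma> = (if 0 = b0 then sign s1 else - sign s1)"
    by (rule permutes_insertE) simp
  obtain b1 s2 where 1: "b1 \<in> {1, 2, 3, 4, 5}" "s2 permutes insert 2 {3, 4, 5}"
    "s1 = (\<lambda>i. Transposition.transpose 1 b1 (s2 i))" "sign s1 = (if 1 = b1 then sign s2 else - sign s2)"
    by (rule permutes_insertE[OF 0(2)]) simp
  obtain b2 s3 where 2: "b2 \<in> {2, 3, 4, 5}" "s3 permutes insert 3 {4, 5}"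
    "s2 = (\<lambda>i. Transposition.transpose 2 b2 (s3 i))" "sign s2 = (if 2 = b2 then sign s3 else - sign s3)"
    by (rule permutes_insertE[OF 1(2)]) simp
  obtain b3 s4 where 3: "b3 \<in> {3, 4, 5}" "s4 permutes insert 4 {5}"
    "s3 = (\<lambda>i. Transposition.transpose 3 b3 (s4 i))" "sign s3 = (if 3 = b3 then sign s4 else - sign s4)"
    by (rule permutes_insertE[OF 2(2)]) simp
  obtain b4 s5 where 4: "b4 \<in> {4, 5}" "s5 permutes {5}"
    "s4 = (\<lambda>i. Transposition.transpose 4 b4 (s5 i))" "sign s4 = (if 4 = b4 then sign s5 else - sign s5)"
    by (rule permutes_insertE[OF 3(2)]) simp
  have 5: "s5 = (\<lambda>i. i)" using 4(2) by (simp add: permutes_sing id_def)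
  have 6: "sign s5 = 1" by (simp add: 5 sign_id[unfolded id_def])
  show ?thesis
    unfolding 0(4) 1(4) 2(4) 3(4) 4(4) 6 unfolding 0(3) 1(3) 2(3) 3(3) 4(3) 5 Transposition.transpose_def
    using P[rule_format, OF 0(1) 1(1) 2(1) 3(1) 4(1)] by (simp only: Let_def)
qed

lemma sum_permutations_4:
  fixes Q :: "int \<Rightarrow> nat \<Rightarrow> nat \<Rightarrow> nat \<Rightarrow> nat \<Rightarrow> real"
  shows "(\<Sum>\<sigma> | \<sigma> permutes {..<4}. Q (sign \<sigma>) (\<sigma> 0) (\<sigma> 1) (\<sigma> 2) (\<sigma> 3)) =
    (\<Sum>b0\<in>{0, 1, 2, 3}. \<Sum>b1\<in>{1, 2, 3}. \<Sum>b2\<in>{2, 3}.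
    (let t = \<lambda>a b i. if i = a then b else if i = b then a else (i::nat);
         s = \<lambda>a b e. if a = b then e else - e;
         \<sigma> = \<lambda>i. t 0 b0 (t 1 b1 (t 2 b2 i))
     in Q (s 0 b0 (s 1 b1 (s 2 b2 1))) (\<sigma> 0) (\<sigma> 1) (\<sigma> 2) (\<sigma> 3)))"
proof -
  have 3: "{\<sigma>. \<sigma> permutes {3::nat}} = {id}" by (auto simp: permutes_sing)
  show ?thesis
  unfolding lessThan_numerals
  by (subst sum_permutations_insert_sign, simp, simp, rule sum.cong[OF refl],
      subst sum_permutations_insert_sign, simp, simp, rule sum.cong[OF refl],
      subst sum_permutations_insert_sign, simp, simp, rule sum.cong[OF refl],
      unfold 3, simp only: sum.insert finite.emptyI empty_iff not_False_eq_True sum.empty o_def id_def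
        add_0_right Let_def Transposition.transpose_def sign_id[unfolded id_def] if_cancel)
qed

text \<open>The 24 terms fall into the three pairings of the arguments, eight for each; division by
  2! 2! = 4 leaves the factor 2.\<close>

lemma wedge_2_2:
  fixes \<omega> :: "real form"
  assumes "alt_form 2 \<omega>"
  shows "wedge 2 2 \<omega> \<omega> [a, b, c, d] = 2 * (\<omega> [a, b] * \<omega> [c, d] - \<omega> [a, c] * \<omega> [b, d] + \<omega> [a, d] * \<omega> [b, c])"
proof -
  have sw: "\<omega> [v, u] = - \<omega> [u, v]" for u v
    using alt_form_swap[OF assms, of "[u, v]" 0 1] by simp
  have "wedge 2 2 \<omega> \<omega> [a, b, c, d] = (\<Sum>\<sigma> | \<sigma> permutes {..<4}.
       of_int (sign \<sigma>) * \<omega> [[a, b, c, d] ! \<sigma> 0, [a, b, c, d] ! \<sigma> 1] * \<omega> [[a, b, c, d] ! \<sigma> 2, [a, b, c, d] ! \<sigma> 3]) / 4"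
    by (simp add: wedge_def upt_rec fact_numeral)
  also have "\<dots> = 2 * (\<omega> [a, b] * \<omega> [c, d] - \<omega> [a, c] * \<omega> [b, d] + \<omega> [a, d] * \<omega> [b, c])"
    by (subst sum_permutations_4[of "\<lambda>s i j k l. of_int s * \<omega> [[a, b, c, d] ! i, [a, b, c, d] ! j] * \<omega> [[a, b, c, d] ! k, [a, b, c, d] ! l]"])
      (simp add: Let_def sw[of a b] sw[of a c] sw[of a d] sw[of b c] sw[of b d] sw[of c d] field_simps)
  finally show ?thesis .
qed

section \<open>Hodge duality on a frame adapted to \<open>J\<close>\<close>

lemma upt_numerals:
  "[0..<2] = [0, 1::nat]" "[0..<3] = [0, 1, 2::nat]" "[3..<6] = [3, 4, 5::nat]" "[0..<4] = [0, 1, 2, 3::nat]" "[4..<6] = [4, 5::nat]"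
  "[0..<6] = [0, 1, 2, 3, 4, 5::nat]"
  by (simp_all add: upt_rec)

lemma alt_form_2_swap: "alt_form 2 \<alpha> \<Longrightarrow> \<alpha> [b, a] = - \<alpha> [a, b]"
  using alt_form_swap[of 2 \<alpha> "[a, b]" 0 1] by simp

lemma alt_form_3_swap:
  assumes "alt_form 3 \<alpha>"
  shows "\<alpha> [b, a, c] = - \<alpha> [a, b, c]" "\<alpha> [a, c, b] = - \<alpha> [a, b, c]"
  using alt_form_swap[OF assms, of "[a, b, c]" 0 1] alt_form_swap[OF assms, of "[a, b, c]" 1 2] by simp_all

lemma alt_form_3_repeat:
  assumes "alt_form 3 \<alpha>"
  shows "\<alpha> [a, a, c] = 0" "\<alpha> [a, c, c] = 0" "\<alpha> [a, c, a] = 0"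
  by (rule alt_form_not_distinct[OF assms], simp)+

lemma alt_form_4_swap:
  assumes "alt_form 4 \<alpha>"
  shows "\<alpha> [b, a, c, d] = - \<alpha> [a, b, c, d]" "\<alpha> [a, c, b, d] = - \<alpha> [a, b, c, d]" "\<alpha> [a, b, d, c] = - \<alpha> [a, b, c, d]"
  using alt_form_swap[OF assms, of "[a, b, c, d]" 0 1] alt_form_swap[OF assms, of "[a, b, c, d]" 1 2]
    alt_form_swap[OF assms, of "[a, b, c, d]" 2 3] by simp_all

lemma alt_form_4_repeat:
  assumes "alt_form 4 \<alpha>"
  shows "\<alpha> [a, a, c, d] = 0" "\<alpha> [a, c, c, d] = 0" "\<alpha> [a, c, d, d] = 0" "\<alpha> [a, c, a, d] = 0"
    "\<alpha> [a, c, d, a] = 0" "\<alpha> [c, a, d, a] = 0"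
  by (rule alt_form_not_distinct[OF assms], simp)+

text \<open>\<open>\<phi> + \<i>\<psi>\<close> is of type \<open>(3,0)\<close> for \<open>J\<close>.\<close>

definition holo3 :: "(real^6 \<Rightarrow> real^6) \<Rightarrow> real form \<Rightarrow> real form \<Rightarrow> bool" where
  "holo3 J \<phi> \<psi> \<longleftrightarrow> alt_form 3 \<phi> \<and> alt_form 3 \<psi> \<and>
     (\<forall>X Y Z. \<phi> [J X, Y, Z] = - \<psi> [X, Y, Z] \<and> \<psi> [J X, Y, Z] = \<phi> [X, Y, Z])"

lemma holo3D:
  assumes "holo3 J \<phi> \<psi>"
  shows "\<phi> [J X, Y, Z] = - \<psi> [X, Y, Z]" "\<phi> [X, J Y, Z] = - \<psi> [X, Y, Z]" "\<phi> [X, Y, J Z] = - \<psi> [X, Y, Z]"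
    "\<psi> [J X, Y, Z] = \<phi> [X, Y, Z]" "\<psi> [X, J Y, Z] = \<phi> [X, Y, Z]" "\<psi> [X, Y, J Z] = \<phi> [X, Y, Z]"
proof -
  note a = assms[unfolded holo3_def]
  note s1 = alt_form_3_swap[OF conjunct1[OF a]] and s2 = alt_form_3_swap[OF conjunct1[OF conjunct2[OF a]]]
  show 1: "\<phi> [J X, Y, Z] = - \<psi> [X, Y, Z]" "\<psi> [J X, Y, Z] = \<phi> [X, Y, Z]" for X Y Z using a by auto
  show 2: "\<phi> [X, J Y, Z] = - \<psi> [X, Y, Z]" "\<psi> [X, J Y, Z] = \<phi> [X, Y, Z]" for X Y Z
    using s1(1)[of X "J Y" Z] s2(1)[of X "J Y" Z] s1(1)[of X Y Z] s2(1)[of X Y Z] 1[of Y X Z] by auto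
  show "\<phi> [X, Y, J Z] = - \<psi> [X, Y, Z]" "\<psi> [X, Y, J Z] = \<phi> [X, Y, Z]"
    using s1(2)[of X "J Z" Y] s2(2)[of X "J Z" Y] s1(2)[of X Z Y] s2(2)[of X Z Y] 2[of X Z Y] by auto
qed

definition complex_frame :: "(real^6 \<Rightarrow> real^6) \<Rightarrow> (nat \<Rightarrow> real^6) \<Rightarrow> bool" where
  "complex_frame J f \<longleftrightarrow> f 1 = J (f 0) \<and> f 3 = J (f 2) \<and> f 5 = J (f 4)"

text \<open>\<open>J\<close> in any slot exchanges \<phi> and \<psi> up to sign. Hence both vanish
  on frame triples that contain a pair \<open>v, J v\<close>, and on the others they are, up to
  sign, one of the two numbers \<open>p 0 2 4\<close> and \<open>q 0 2 4\<close>. With this table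
  the duality is checked permutation by permutation.\<close>

lemma holo3_dual:
  assumes h: "holo3 J \<phi> \<psi>" and f: "complex_frame J f" and \<sigma>: "\<sigma> permutes {..<6}"
  shows "of_int (sign \<sigma>) * \<psi> (map (\<lambda>i. f (\<sigma> i)) [3..<6]) = \<phi> (map (\<lambda>i. f (\<sigma> i)) [0..<3])"
proof -
  define p where "p i j k = \<phi> [f i, f j, f k]" for i j k
  define q where "q i j k = \<psi> [f i, f j, f k]" for i j k
  have alt: "alt_form 3 \<phi>" "alt_form 3 \<psi>" using h by (auto simp: holo3_def)
  have sp: "p j i k = - p i j k" "p i k j = - p i j k" "p i i k = 0" "p i k k = 0" for i j k
    unfolding p_def by (rule alt_form_3_swap[OF alt(1)] alt_form_3_repeat[OF alt(1)])+
  have sq: "q j i k = - q i j k" "q i k j = - q i j k" "q i i k = 0" "q i k k = 0" for i j k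
    unfolding q_def by (rule alt_form_3_swap[OF alt(2)] alt_form_3_repeat[OF alt(2)])+
  have bp: "i < j \<Longrightarrow> p j i k = - p i j k" "j < k \<Longrightarrow> p i k j = - p i j k" for i j k by (rule sp)+
  have bq: "i < j \<Longrightarrow> q j i k = - q i j k" "j < k \<Longrightarrow> q i k j = - q i j k" for i j k by (rule sq)+
  have J: "f 1 = J (f 0)" "f 3 = J (f 2)" "f 5 = J (f 4)" using f by (auto simp: complex_frame_def)
  note rep = alt_form_3_repeat[OF alt(1)] alt_form_3_repeat[OF alt(2)]
  have z: "p 0 1 k = 0" "p 2 3 k = 0" "p i 2 3 = 0" "p i 4 5 = 0"
      "q 0 1 k = 0" "q 2 3 k = 0" "q i 2 3 = 0" "q i 4 5 = 0" for i k
    unfolding p_def q_def J by (simp_all add: holo3D[OF h] rep)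
  have v: "p 1 2 4 = - q 0 2 4" "p 0 3 4 = - q 0 2 4" "p 0 2 5 = - q 0 2 4"
      "p 1 3 4 = - p 0 2 4" "p 1 2 5 = - p 0 2 4" "p 0 3 5 = - p 0 2 4" "p 1 3 5 = q 0 2 4"
      "q 1 2 4 = p 0 2 4" "q 0 3 4 = p 0 2 4" "q 0 2 5 = p 0 2 4"
      "q 1 3 4 = - q 0 2 4" "q 1 2 5 = - q 0 2 4" "q 0 3 5 = - q 0 2 4" "q 1 3 5 = - p 0 2 4"
    unfolding p_def q_def J by (simp_all add: holo3D[OF h])
  have "of_int (sign \<sigma>) * q (\<sigma> 3) (\<sigma> 4) (\<sigma> 5) = p (\<sigma> 0) (\<sigma> 1) (\<sigma> 2)"
    by (rule permutations_6_induct[OF \<sigma>, where P = "\<lambda>s i j k l m n. of_int s * q l m n = p i j k"])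
      ((rule ballI, elim insertE emptyE; hypsubst) ;
       ((rule ballI, elim insertE emptyE; hypsubst) ; ((rule ballI, elim insertE emptyE; hypsubst) ;
       ((rule ballI, elim insertE emptyE; hypsubst) ; ((rule ballI, elim insertE emptyE; hypsubst) ;
        simp add: bp bq sp(3,4) sq(3,4) z v del: One_nat_def)))))
  then show ?thesis by (simp add: upt_numerals p_def q_def del: upt_rec_numeral One_nat_def)
qed

text \<open>The hypotheses \<open>type\<close> and \<open>prim\<close> express that \<open>\<beta>\<close> is of type \<open>(2,2)\<close> and that \<open>\<omega> \<and> \<beta> = 0\<close>; \<open>\<gamma>\<close> is
  \<open>-\<Lambda>\<^sub>\<omega> \<beta>\<close>, and the conclusion says \<open>*\<beta> = \<gamma>\<close> in the frame \<open>f\<close>.\<close>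

lemma primitive_22_dual:
  fixes \<beta> :: "real form"
  assumes \<beta>: "alt_form 4 \<beta>" and f: "complex_frame J f" and JJ: "\<And>v. J (J v) = - v"
    and type: "\<And>v X Y. \<beta> [v, J v, J X, J Y] = \<beta> [v, J v, X, Y]"
    and prim: "\<beta> [f 0, f 1, f 2, f 3] + \<beta> [f 0, f 1, f 4, f 5] + \<beta> [f 2, f 3, f 4, f 5] = 0"
    and \<gamma>: "\<And>u v. \<gamma> [u, v] = - (\<beta> [f 0, f 1, u, v] + \<beta> [f 2, f 3, u, v] + \<beta> [f 4, f 5, u, v])"
    and \<sigma>: "\<sigma> permutes {..<6}"
  shows "of_int (sign \<sigma>) * \<gamma> (map (\<lambda>i. f (\<sigma> i)) [4..<6]) = \<beta> (map (\<lambda>i. f (\<sigma> i)) [0..<4])"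
proof -
  define b where "b i j k l = \<beta> [f i, f j, f k, f l]" for i j k l
  have s: "b j i k l = - b i j k l" "b i k j l = - b i j k l" "b i j l k = - b i j k l"
    "b i i k l = 0" "b i k k l = 0" "b i k l l = 0" for i j k l
    unfolding b_def by (rule alt_form_4_swap[OF \<beta>] alt_form_4_repeat[OF \<beta>])+
  have bb: "i < j \<Longrightarrow> b j i k l = - b i j k l" "j < k \<Longrightarrow> b i k j l = - b i j k l" "k < l \<Longrightarrow> b i j l k = - b i j k l"
    for i j k l by (rule s)+
  have J: "f 1 = J (f 0)" "f 3 = J (f 2)" "f 5 = J (f 4)" using f by (auto simp: complex_frame_def)
  have lin: "\<beta> [u, v, - X, Y] = - \<beta> [u, v, X, Y]" "\<beta> [u, v, X, - Y] = - \<beta> [u, v, X, Y]" for u v X Y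
    using linear_neg[OF alt_form_linear[OF \<beta>, of "[u, v, X, Y]" 2], of X]
      linear_neg[OF alt_form_linear[OF \<beta>, of "[u, v, X, Y]" 3], of Y] by simp_all
  note t = type[of "f 0", folded J] type[of "f 2", folded J] type[of "f 4", folded J]
  \<comment> \<open>The type condition yields six relations (\<open>v1\<close> to \<open>v3\<close>)
    and \<open>prim\<close> a seventh (\<open>v4\<close>). Of the 15 components of a 4-form eight
    remain free, the dimension of the space of primitive real (2,2)-forms.\<close>
  have v1: "b 0 1 2 4 = b 0 1 3 5" "b 0 1 2 5 = - b 0 1 3 4"
    using t(1)[of "f 2" "f 4"] t(1)[of "f 2" "f 5"] by (simp_all add: b_def J JJ lin del: One_nat_def)
  have "b 2 3 0 4 = b 2 3 1 5" "b 2 3 0 5 = - b 2 3 1 4"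
    using t(2)[of "f 0" "f 4"] t(2)[of "f 0" "f 5"] by (simp_all add: b_def J JJ lin del: One_nat_def)
  then have v2: "b 0 2 3 4 = b 1 2 3 5" "b 0 2 3 5 = - b 1 2 3 4"
    by (simp_all add: bb del: One_nat_def)
  have "b 4 5 0 2 = b 4 5 1 3" "b 4 5 0 3 = - b 4 5 1 2"
    using t(3)[of "f 0" "f 2"] t(3)[of "f 0" "f 3"] by (simp_all add: b_def J JJ lin del: One_nat_def)
  then have v3: "b 0 2 4 5 = b 1 3 4 5" "b 0 3 4 5 = - b 1 2 4 5"
    by (simp_all add: bb del: One_nat_def)
  have v4: "b 0 1 2 3 = - b 0 1 4 5 - b 2 3 4 5" using prim by (simp add: b_def)
  define g where "g i j = \<gamma> [f i, f j]" for i j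
  have g: "g i j = - (b 0 1 i j + b 2 3 i j + b 4 5 i j)" for i j by (simp add: \<gamma> b_def g_def)
  have gs: "g i i = 0" "i < j \<Longrightarrow> g j i = - g i j" for i j
    unfolding g using s(3)[of 0 1 i j] s(3)[of 2 3 i j] s(3)[of 4 5 i j] by (simp_all add: s(6) del: One_nat_def)
  have gv: "g 0 1 = b 2 3 4 5" "g 2 3 = b 0 1 4 5" "g 4 5 = - b 0 1 4 5 - b 2 3 4 5"
    "g 0 2 = - b 1 3 4 5" "g 0 3 = b 1 2 4 5" "g 0 4 = - b 1 2 3 5" "g 0 5 = b 1 2 3 4"
    "g 1 2 = - b 1 2 4 5" "g 1 3 = - b 1 3 4 5" "g 1 4 = - b 1 2 3 4" "g 1 5 = - b 1 2 3 5"
    "g 2 4 = - b 0 1 3 5" "g 2 5 = b 0 1 3 4" "g 3 4 = - b 0 1 3 4" "g 3 5 = - b 0 1 3 5"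
    unfolding g by (simp_all add: bb s(4-6) v1 v2 v3 v4 del: One_nat_def)
  have "of_int (sign \<sigma>) * g (\<sigma> 4) (\<sigma> 5) = b (\<sigma> 0) (\<sigma> 1) (\<sigma> 2) (\<sigma> 3)"
    by (rule permutations_6_induct[OF \<sigma>, where P = "\<lambda>s i j k l m n. of_int s * g m n = b i j k l"])
      ((rule ballI, elim insertE emptyE; hypsubst) ;
       ((rule ballI, elim insertE emptyE; hypsubst) ; ((rule ballI, elim insertE emptyE; hypsubst) ;
       ((rule ballI, elim insertE emptyE; hypsubst) ; ((rule ballI, elim insertE emptyE; hypsubst) ;
        simp add: bb gs gv v1 v2 v3 v4 del: One_nat_def)))))
  then show ?thesis by (simp add: upt_numerals b_def g_def del: upt_rec_numeral One_nat_def)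
qed

text \<open>A term of the sum is nonzero only if \<sigma> respects the pairs of the frame. Reversing
  a pair changes both the sign of \<sigma> and that of the product, and exchanging two pairs changes
  neither, so no term is negative; the identity gives a positive one.\<close>

lemma omega_cubed_darboux:
  fixes \<omega> :: "real form"
  assumes \<omega>: "alt_form 2 \<omega>"
    and val: "\<And>i j. i < j \<Longrightarrow> j < 6 \<Longrightarrow> \<omega> [f i, f j] = (if (i, j) \<in> {(0, 1), (2, 3), (4, 5)} then 1 else 0)"
  shows "omega_cubed \<omega> (map f [0..<6]) > 0"
proof -
  define w where "w i j = \<omega> [f i, f j]" for i j
  have s: "w i i = 0" for i
    unfolding w_def by (rule alt_form_not_distinct[OF \<omega>]) simp
  have b: "i < j \<Longrightarrow> w j i = - w i j" for i j
    unfolding w_def by (rule alt_form_2_swap[OF \<omega>])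
  have v: "w 0 1 = 1" "w 0 2 = 0" "w 0 3 = 0" "w 0 4 = 0" "w 0 5 = 0" "w 1 2 = 0" "w 1 3 = 0" "w 1 4 = 0" "w 1 5 = 0"
    "w 2 3 = 1" "w 2 4 = 0" "w 2 5 = 0" "w 3 4 = 0" "w 3 5 = 0" "w 4 5 = 1"
    unfolding w_def by (subst val; simp)+
  define T where "T s i j k l m n = real_of_int s * (2 * (w i j * w k l - w i k * w j l + w i l * w j k)) * w m n" for s i j k l m n
  define F where "F \<sigma> = of_int (sign \<sigma>) * wedge 2 2 \<omega> \<omega> (map (\<lambda>i. f (\<sigma> i)) [0..<4]) * \<omega> (map (\<lambda>i. f (\<sigma> i)) [4..<4+2])" for \<sigma>
  have FT: "F \<sigma> = T (sign \<sigma>) (\<sigma> 0) (\<sigma> 1) (\<sigma> 2) (\<sigma> 3) (\<sigma> 4) (\<sigma> 5)" for \<sigma>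
    by (simp add: F_def T_def upt_numerals wedge_2_2[OF \<omega>] w_def del: upt_rec_numeral One_nat_def)
  \<comment> \<open>48 = 4! 2! is the normalization of the outer \<open>wedge 4 2\<close>.\<close>
  have "omega_cubed \<omega> (map f [0..<6]) = (\<Sum>\<sigma> | \<sigma> permutes {..<6}. F \<sigma>) / 48"
    using wedge_at_basis[of 4 2 "wedge 2 2 \<omega> \<omega>" \<omega> f]
    by (simp add: omega_cubed_def F_def fact_numeral del: upt_rec_numeral One_nat_def)
  moreover have "(\<Sum>\<sigma> | \<sigma> permutes {..<6}. F \<sigma>) > 0"
  proof (rule sum_pos2[of _ id])
    show "0 < F id" by (simp add: FT T_def v s del: One_nat_def)
    show "0 \<le> F \<sigma>" if "\<sigma> \<in> {\<sigma>. \<sigma> permutes {..<6}}" for \<sigma>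
    proof -
      have \<sigma>: "\<sigma> permutes {..<6}" using that by simp
      show ?thesis unfolding FT
        by (rule permutations_6_induct[OF \<sigma>, where P = "\<lambda>s i j k l m n. 0 \<le> T s i j k l m n"])
          ((rule ballI, elim insertE emptyE; hypsubst) ;
       ((rule ballI, elim insertE emptyE; hypsubst) ; ((rule ballI, elim insertE emptyE; hypsubst) ;
       ((rule ballI, elim insertE emptyE; hypsubst) ; ((rule ballI, elim insertE emptyE; hypsubst) ;
        simp add: T_def b s v del: One_nat_def)))))
    qed
  qed (auto simp: finite_permutations)
  ultimately show ?thesis by simp
qed

section \<open>Symplectic frames\<close>

text \<open>Fewer than six functionals are represented by vectors spanning a proper subspace, and a
  vector orthogonal to it is a common zero. Applied to functionals \<open>\<omega> [e, _]\<close>,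
  this finds the next vector of a frame in the symplectic complement of the earlier ones.\<close>

lemma common_kernel_nontrivial:
  fixes hs :: "(real^6 \<Rightarrow> real) list"
  assumes "\<And>h. h \<in> set hs \<Longrightarrow> linear h" "length hs < 6"
  obtains v where "v \<noteq> 0" "\<And>h. h \<in> set hs \<Longrightarrow> h v = 0"
proof -
  define r where "r h = (\<chi> i. h (axis i 1))" for h :: "real^6 \<Rightarrow> real"
  have r: "h v = r h \<bullet> v" if "linear h" for h v
    using linear_expand_axis[OF that, of v] by (simp add: r_def inner_vec_def mult.commute)
  have "dim (r ` set hs) \<le> card (r ` set hs)" by (rule dim_le_card') simp
  also have "\<dots> \<le> length hs" by (metis List.finite_set card_image_le card_length le_trans)
  finally have dim: "dim (r ` set hs) < DIM(real^6)" using assms(2) by simp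
  obtain v where v: "v \<noteq> 0" "\<And>y. y \<in> span (r ` set hs) \<Longrightarrow> orthogonal v y"
    using orthogonal_to_subspace_exists[OF dim] by blast
  have "h v = 0" if "h \<in> set hs" for h
    using v(2)[of "r h"] r[OF assms(1)[OF that], of v] that
    by (simp add: span_base orthogonal_def inner_commute)
  then show thesis using that v(1) by blast
qed

lemma alt_form_2_bilinear:
  assumes "alt_form 2 \<omega>"
  shows "linear (\<lambda>u. \<omega> [u, v])" "linear (\<lambda>v. \<omega> [u, v])"
  using alt_form_linear[OF assms, of "[0, v]" 0] alt_form_linear[OF assms, of "[u, 0]" 1] by simp_all

lemma alt_form_3_linear:
  assumes "alt_form 3 \<phi>"
  shows "linear (\<lambda>u. \<phi> [u, v, w])" "linear (\<lambda>u. \<phi> [v, u, w])" "linear (\<lambda>u. \<phi> [v, w, u])"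
  using alt_form_linear[OF assms, of "[0, v, w]" 0] alt_form_linear[OF assms, of "[v, 0, w]" 1]
    alt_form_linear[OF assms, of "[v, w, 0]" 2] by simp_all

text \<open>A symplectic basis \<open>f\<^sub>0, \<dots>, f\<^sub>5\<close>, with \<open>f\<^sub>2\<^sub>k\<close> dual to \<open>f\<^sub>2\<^sub>k\<^sub>+\<^sub>1\<close>.\<close>

definition darboux :: "real form \<Rightarrow> (nat \<Rightarrow> real^6) \<Rightarrow> bool" where
  "darboux \<omega> f \<longleftrightarrow> alt_form 2 \<omega> \<and>
     (\<forall>i j. i < j \<longrightarrow> j < 6 \<longrightarrow> \<omega> [f i, f j] = (if (i, j) \<in> {(0, 1), (2, 3), (4, 5)} then 1 else 0))"

lemma nat_less_6: "i < (6::nat) \<longleftrightarrow> i = 0 \<or> i = 1 \<or> i = 2 \<or> i = 3 \<or> i = 4 \<or> i = 5"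
  by auto

lemma all_less_6_pairs:
  "(\<forall>i j. i < j \<longrightarrow> j < (6::nat) \<longrightarrow> P i j) \<longleftrightarrow>
    P 0 1 \<and> P 0 2 \<and> P 0 3 \<and> P 0 4 \<and> P 0 5 \<and> P 1 2 \<and> P 1 3 \<and> P 1 4 \<and> P 1 5 \<and>
    P 2 3 \<and> P 2 4 \<and> P 2 5 \<and> P 3 4 \<and> P 3 5 \<and> P 4 5"
  (is "?L \<longleftrightarrow> ?R")
proof
  assume ?R
  show ?L
  proof (intro allI impI)
    fix i j :: nat assume "i < j" "j < 6"
    then have "i < 6" by simp
    then show "P i j" using \<open>?R\<close> \<open>i < j\<close> \<open>j < 6\<close> unfolding nat_less_6 by (elim disjE) auto
  qed
qed simp

lemma darboux_values:
  assumes "darboux \<omega> f"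
  shows "\<omega> [f 0, f 1] = 1" "\<omega> [f 0, f 2] = 0" "\<omega> [f 0, f 3] = 0" "\<omega> [f 0, f 4] = 0" "\<omega> [f 0, f 5] = 0"
    "\<omega> [f 1, f 2] = 0" "\<omega> [f 1, f 3] = 0" "\<omega> [f 1, f 4] = 0" "\<omega> [f 1, f 5] = 0"
    "\<omega> [f 2, f 3] = 1" "\<omega> [f 2, f 4] = 0" "\<omega> [f 2, f 5] = 0" "\<omega> [f 3, f 4] = 0" "\<omega> [f 3, f 5] = 0"
    "\<omega> [f 4, f 5] = 1"
  using assms unfolding darboux_def all_less_6_pairs by auto

text \<open>Dual functionals force independence, six independent vectors span, and by linearity the
  expansion need only be checked on the \<open>f i\<close>.\<close>

lemma independent_dual_pairs:
  fixes f :: "nat \<Rightarrow> real^6" and b :: "real^6 \<Rightarrow> nat \<Rightarrow> real"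
  assumes "\<And>j. j < 6 \<Longrightarrow> linear (\<lambda>v. b v j)"
    and "\<And>i j. i < 6 \<Longrightarrow> j < 6 \<Longrightarrow> b (f i) j = (if i = j then 1 else 0)"
  shows "(\<Sum>m<6. b v m *\<^sub>R f m) = v"
proof -
  have inj: "inj_on f {..<6}"
    by (rule inj_onI) (metis assms(2) lessThan_iff zero_neq_one)
  have "independent (f ` {..<6})"
  proof (rule independent_if_scalars_zero)
    fix c x assume s: "(\<Sum>x\<in>f ` {..<6}. c x *\<^sub>R x) = 0" and x: "x \<in> f ` {..<6}"
    obtain j where j: "j < 6" "x = f j" using x by auto
    have "0 = b (\<Sum>i<6. c (f i) *\<^sub>R f i) j"
      using s linear_0[OF assms(1)[OF j(1)]] by (simp add: sum.reindex[OF inj])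
    also have "\<dots> = (\<Sum>i<6. c (f i) * b (f i) j)"
      by (simp add: linear_sum[OF assms(1)[OF j(1)]] linear_scale[OF assms(1)[OF j(1)]])
    also have "\<dots> = (\<Sum>i<6. if i = j then c (f i) else 0)"
      by (rule sum.cong[OF refl]) (simp add: assms(2) j)
    also have "\<dots> = c x" using j by (simp add: sum.delta)
    finally show "c x = 0" by simp
  qed simp
  moreover have "card (f ` {..<6}) = DIM(real^6)" by (simp add: card_image[OF inj])
  ultimately have "UNIV \<subseteq> span (f ` {..<6})"
    by (intro card_ge_dim_independent) auto
  then have v: "v \<in> span (f ` {..<6})" by blast
  have "linear (\<lambda>v. (\<Sum>m<6. b v m *\<^sub>R f m))"
  proof (rule linear_sum_fun)
    fix m :: nat assume "m \<in> {..<6}"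
    then have l: "linear (\<lambda>v. b v m)" using assms(1) by simp
    show "linear (\<lambda>v. b v m *\<^sub>R f m)"
      by (rule linearI) (simp_all add: linear_add[OF l] linear_scale[OF l] scaleR_add_left)
  qed
  moreover have "linear (\<lambda>v::real^6. v)" by (rule linear_ident)
  moreover have "(\<Sum>m<6. b x m *\<^sub>R f m) = x" if x: "x \<in> f ` {..<6}" for x
  proof -
    obtain i where i: "i < 6" "x = f i" using x by auto
    have "(\<Sum>m<6. b x m *\<^sub>R f m) = (\<Sum>m<6. if m = i then f m else 0)"
      by (rule sum.cong[OF refl]) (use assms(2) i in auto)
    then show ?thesis using i by (simp add: sum.delta)
  qed
  ultimately show ?thesis using linear_eq_on_span[of _ _ "f ` {..<6}" v] v by blast
qed

lemma sum_lessThan_6: "(\<Sum>m<6. F m) = F 0 + F 1 + F 2 + F 3 + F 4 + F (5::nat)"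
  unfolding lessThan_numerals by (simp add: add.assoc)

text \<open>The functional dual to \<open>f (2 * k)\<close> is
  \<open>\<omega> [_, f (2 * k + 1)]\<close>, and the one dual to \<open>f (2 * k + 1)\<close> is
  minus \<open>\<omega> [_, f (2 * k)]\<close>.\<close>

lemma darboux_expand:
  assumes "darboux \<omega> f"
  shows "v = \<omega> [v, f 1] *\<^sub>R f 0 - \<omega> [v, f 0] *\<^sub>R f 1 + \<omega> [v, f 3] *\<^sub>R f 2 - \<omega> [v, f 2] *\<^sub>R f 3
           + \<omega> [v, f 5] *\<^sub>R f 4 - \<omega> [v, f 4] *\<^sub>R f 5"
proof -
  have \<omega>: "alt_form 2 \<omega>" using assms by (simp add: darboux_def)
  define b where "b v m = (if even m then \<omega> [v, f (m + 1)] else - \<omega> [v, f (m - 1)])" for v m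
  note z = alt_form_not_distinct[OF \<omega>]
  have zz: "\<omega> [x, x] = 0" for x by (rule z) simp
  have bb: "i < j \<Longrightarrow> \<omega> [f j, f i] = - \<omega> [f i, f j]" for i j by (rule alt_form_2_swap[OF \<omega>])
  have "(\<Sum>m<6. b v m *\<^sub>R f m) = v"
  proof (rule independent_dual_pairs)
    show "linear (\<lambda>v. b v j)" for j
      unfolding b_def using alt_form_2_bilinear(1)[OF \<omega>] linear_compose_neg by (cases "even j") auto
    fix i j :: nat assume "i < 6" "j < 6"
    then show "b (f i) j = (if i = j then 1 else 0)"
      unfolding nat_less_6 b_def
      by (elim disjE; simp add: zz darboux_values[OF assms] bb del: One_nat_def)
  qed
  then show ?thesis unfolding sum_lessThan_6 by (simp add: b_def)
qed

lemma darboux_exists: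
  assumes \<omega>: "alt_form 2 \<omega>" and nd: "nondegenerate \<omega>"
  obtains f where "darboux \<omega> f"
proof -
  note lin = alt_form_2_bilinear[OF \<omega>]
  have zz: "\<omega> [x, x] = 0" for x by (rule alt_form_not_distinct[OF \<omega>]) simp
  note sw = alt_form_2_swap[OF \<omega>]
  have dual: "\<exists>q. \<omega> [p, q] = 1" if "p \<noteq> 0" for p
  proof -
    obtain w where w: "\<omega> [p, w] \<noteq> 0" using nd \<open>p \<noteq> 0\<close> unfolding nondegenerate_def by blast
    have "\<omega> [p, (1 / \<omega> [p, w]) *\<^sub>R w] = 1" using w by (simp add: linear_scale[OF lin(2)])
    then show ?thesis by blast
  qed
  obtain p0 q0 where 0: "\<omega> [p0, q0] = 1"
    using dual[of "axis 1 1"] by (metis axis_eq_0_iff zero_neq_one)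
  obtain p1 where p1: "p1 \<noteq> 0" "\<omega> [p0, p1] = 0" "\<omega> [q0, p1] = 0"
    by (rule common_kernel_nontrivial[of "[\<lambda>v. \<omega> [p0, v], \<lambda>v. \<omega> [q0, v]]"]) (use lin in auto)
  obtain w1 where w1: "\<omega> [p1, w1] = 1" using dual[OF p1(1)] by blast
  \<comment> \<open>Symplectic Gram-Schmidt: the corrections remove the components along
    \<open>p0\<close> and \<open>q0\<close>. Since these pair to 0 with \<open>p1\<close>, the value
    \<open>\<omega> [p1, w1] = 1\<close> is kept.\<close>
  define q1 where "q1 = w1 - \<omega> [p0, w1] *\<^sub>R q0 + \<omega> [q0, w1] *\<^sub>R p0"
  have q1: "\<omega> [p0, q1] = 0" "\<omega> [q0, q1] = 0" "\<omega> [p1, q1] = 1"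
    unfolding q1_def using 0 p1 w1 sw[of q0 p0] sw[of p1 p0] sw[of p1 q0]
    by (simp_all add: linear_add[OF lin(2)] linear_diff[OF lin(2)] linear_scale[OF lin(2)] zz)
  obtain p2 where p2: "p2 \<noteq> 0" "\<omega> [p0, p2] = 0" "\<omega> [q0, p2] = 0" "\<omega> [p1, p2] = 0" "\<omega> [q1, p2] = 0"
    by (rule common_kernel_nontrivial[of "[\<lambda>v. \<omega> [p0, v], \<lambda>v. \<omega> [q0, v], \<lambda>v. \<omega> [p1, v], \<lambda>v. \<omega> [q1, v]]"])
      (use lin in auto)
  obtain w2 where w2: "\<omega> [p2, w2] = 1" using dual[OF p2(1)] by blast
  define q2 where "q2 = w2 - \<omega> [p0, w2] *\<^sub>R q0 + \<omega> [q0, w2] *\<^sub>R p0 - \<omega> [p1, w2] *\<^sub>R q1 + \<omega> [q1, w2] *\<^sub>R p1"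
  have q2: "\<omega> [p0, q2] = 0" "\<omega> [q0, q2] = 0" "\<omega> [p1, q2] = 0" "\<omega> [q1, q2] = 0" "\<omega> [p2, q2] = 1"
    unfolding q2_def using 0 p1 w1 q1 p2 w2 sw[of q0 p0] sw[of p1 p0] sw[of p1 q0] sw[of q1 p0] sw[of q1 q0] sw[of q1 p1]
      sw[of p2 p0] sw[of p2 q0] sw[of p2 p1] sw[of p2 q1]
    by (simp_all add: linear_add[OF lin(2)] linear_diff[OF lin(2)] linear_scale[OF lin(2)] zz)
  have "darboux \<omega> (\<lambda>i. [p0, q0, p1, q1, p2, q2] ! i)"
    unfolding darboux_def all_less_6_pairs using \<omega> 0 p1 q1 p2 q2 by simp
  then show thesis by (rule that)
qed

text \<open>The inverse is the bivector dual to \<omega>, the sum of the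
  \<open>f (2 * k) \<and> f (2 * k + 1)\<close>, with the transposed index order that
  \<open>contraction\<close> uses. The second claim, that the chosen inverse is a genuine one, feeds
  Cramer's rule later.\<close>

lemma matrix_inv_darboux:
  assumes f: "darboux \<omega> f"
  defines "W \<equiv> (\<chi> i j. \<omega> [axis i 1, axis j 1]) :: real^6^6"
  shows "matrix_inv W $ j $ i = (f 0 $ i * f 1 $ j - f 1 $ i * f 0 $ j) + (f 2 $ i * f 3 $ j - f 3 $ i * f 2 $ j)
      + (f 4 $ i * f 5 $ j - f 5 $ i * f 4 $ j)"
    and "W ** matrix_inv W = mat 1"
proof -
  have \<omega>: "alt_form 2 \<omega>" using f by (simp add: darboux_def)
  let ?X = "(\<chi> j i. (f 0 $ i * f 1 $ j - f 1 $ i * f 0 $ j) + (f 2 $ i * f 3 $ j - f 3 $ i * f 2 $ j)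
      + (f 4 $ i * f 5 $ j - f 5 $ i * f 4 $ j)) :: real^6^6"
  have l: "(\<Sum>c\<in>UNIV. \<omega> [axis a 1, axis c 1] * v $ c) = \<omega> [axis a 1, v]" for a v
    using linear_expand_axis[OF alt_form_2_bilinear(2)[OF \<omega>], of "axis a 1" v] by (simp add: mult.commute)
  have "(\<Sum>c\<in>UNIV. \<omega> [axis a 1, axis c 1] * ?X $ c $ b) = (if a = b then 1 else 0)" for a b
  proof -
    have "(\<Sum>c\<in>UNIV. \<omega> [axis a 1, axis c 1] * ?X $ c $ b) =
      (\<omega> [axis a 1, f 1] * f 0 $ b - \<omega> [axis a 1, f 0] * f 1 $ b)
      + (\<omega> [axis a 1, f 3] * f 2 $ b - \<omega> [axis a 1, f 2] * f 3 $ b)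
      + (\<omega> [axis a 1, f 5] * f 4 $ b - \<omega> [axis a 1, f 4] * f 5 $ b)"
    proof -
      let ?w = "\<lambda>c. \<omega> [axis a 1, axis c 1]"
      have "(\<Sum>c\<in>UNIV. ?w c * ?X $ c $ b) =
        ((\<Sum>c\<in>UNIV. ?w c * f 1 $ c) * f 0 $ b - (\<Sum>c\<in>UNIV. ?w c * f 0 $ c) * f 1 $ b)
        + ((\<Sum>c\<in>UNIV. ?w c * f 3 $ c) * f 2 $ b - (\<Sum>c\<in>UNIV. ?w c * f 2 $ c) * f 3 $ b)
        + ((\<Sum>c\<in>UNIV. ?w c * f 5 $ c) * f 4 $ b - (\<Sum>c\<in>UNIV. ?w c * f 4 $ c) * f 5 $ b)"
        unfolding sum_distrib_right sum_subtractf[symmetric] sum.distrib[symmetric]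
        by (intro sum.cong refl) (simp add: algebra_simps)
      then show ?thesis by (simp only: l)
    qed
    also have "\<dots> = (\<omega> [axis a 1, f 1] *\<^sub>R f 0 - \<omega> [axis a 1, f 0] *\<^sub>R f 1
      + \<omega> [axis a 1, f 3] *\<^sub>R f 2 - \<omega> [axis a 1, f 2] *\<^sub>R f 3
      + \<omega> [axis a 1, f 5] *\<^sub>R f 4 - \<omega> [axis a 1, f 4] *\<^sub>R f 5) $ b" by simp
    also have "\<dots> = axis a 1 $ b" by (subst darboux_expand[OF f, symmetric]) simp
    finally show ?thesis by (simp add: axis_def)
  qed
  then have "W ** ?X = mat 1"
    by (simp add: W_def matrix_matrix_mult_def mat_def vec_eq_iff)
  moreover from this have "matrix_inv W = ?X" by (rule matrix_inv_eqI)
  ultimately show "matrix_inv W $ j $ i = (f 0 $ i * f 1 $ j - f 1 $ i * f 0 $ j) + (f 2 $ i * f 3 $ j - f 3 $ i * f 2 $ j)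
      + (f 4 $ i * f 5 $ j - f 5 $ i * f 4 $ j)" and "W ** matrix_inv W = mat 1"
    by simp_all
qed

lemma bilinear_contraction_darboux:
  assumes f: "darboux \<omega> f"
    and h: "\<And>v. linear (\<lambda>u. h u v)" "\<And>u. linear (h u)"
  shows "(\<Sum>i\<in>UNIV. \<Sum>j\<in>UNIV. matrix_inv (\<chi> i j. \<omega> [axis i 1, axis j 1]) $ j $ i * h (axis i 1) (axis j 1)) =
     (h (f 0) (f 1) - h (f 1) (f 0)) + (h (f 2) (f 3) - h (f 3) (f 2)) + (h (f 4) (f 5) - h (f 5) (f 4) :: real)"
proof -
  have e: "h u v = (\<Sum>i\<in>UNIV. \<Sum>j\<in>UNIV. u $ i * v $ j * h (axis i 1) (axis j 1))" for u v
  proof -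
    have "h u v = (\<Sum>i\<in>UNIV. u $ i * h (axis i 1) v)" by (rule linear_expand_axis[OF h(1)])
    also have "\<dots> = (\<Sum>i\<in>UNIV. u $ i * (\<Sum>j\<in>UNIV. v $ j * h (axis i 1) (axis j 1)))"
      by (subst linear_expand_axis[OF h(2), of _ v]) simp
    finally show ?thesis by (simp add: sum_distrib_left mult.assoc)
  qed
  show ?thesis
    unfolding e[of "f _" "f _"] sum.distrib[symmetric] sum_subtractf[symmetric] matrix_inv_darboux(1)[OF f]
    by (intro sum.cong refl) (simp add: algebra_simps)
qed

text \<open>The antisymmetric bivector counts each pair of the frame twice, which the division by 2
  in \<open>contraction\<close> undoes. For \<open>\<alpha> = \<omega>\<close> the value is
  3.\<close>

lemma contraction_darboux:
  assumes f: "darboux \<omega> f" and \<alpha>: "alt_form (Suc (Suc k)) \<alpha>" and vs: "length vs = k"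
  shows "contraction \<omega> \<alpha> vs = \<alpha> (f 0 # f 1 # vs) + \<alpha> (f 2 # f 3 # vs) + \<alpha> (f 4 # f 5 # vs)"
proof -
  have l: "linear (\<lambda>u. \<alpha> (u # v # vs))" "linear (\<lambda>v. \<alpha> (u # v # vs))" for u v
    using alt_form_linear[OF \<alpha>, of "0 # v # vs" 0] alt_form_linear[OF \<alpha>, of "u # 0 # vs" 1] vs by simp_all
  have s: "\<alpha> (v # u # vs) = - \<alpha> (u # v # vs)" for u v
    using alt_form_swap[OF \<alpha>, of "u # v # vs" 0 1] vs by simp
  show ?thesis
    unfolding contraction_def Let_def bilinear_contraction_darboux[OF f, of "\<lambda>u v. \<alpha> (u # v # vs)", OF l]
    using s[of "f 1" "f 0"] s[of "f 3" "f 2"] s[of "f 5" "f 4"] by simp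
qed

section \<open>The almost complex structure of a positive form\<close>

lemma sum_permutations_2:
  "(\<Sum>\<sigma> | \<sigma> permutes {..<2::nat}. Q (sign \<sigma>) (\<sigma> 0) (\<sigma> 1)) = Q 1 0 1 + (Q (-1) 1 0 :: 'b::ab_group_add)"
proof -
  have 1: "{\<sigma>. \<sigma> permutes {1::nat}} = {id}" by (auto simp: permutes_sing)
  show ?thesis unfolding lessThan_numerals
    by (subst sum_permutations_insert_sign, simp, simp, unfold 1, simp add: Transposition.transpose_def)
qed

lemma sum_permutations_3:
  "(\<Sum>\<sigma> | \<sigma> permutes {..<3::nat}. Q (sign \<sigma>) (\<sigma> 0) (\<sigma> 1) (\<sigma> 2)) =
    Q 1 0 1 2 + Q (-1) 0 2 1 + (Q (-1) 1 0 2 + Q 1 1 2 0) + (Q (-1) 2 1 0 + (Q 1 2 0 1 :: 'b::ab_group_add))"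
proof -
  have 2: "{\<sigma>. \<sigma> permutes {2::nat}} = {id}" by (auto simp: permutes_sing)
  have "(\<Sum>\<sigma> | \<sigma> permutes {..<3::nat}. Q (sign \<sigma>) (\<sigma> 0) (\<sigma> 1) (\<sigma> 2)) =
    (\<Sum>b0\<in>{0, 1, 2}. \<Sum>b1\<in>{1, 2}.
    (let t = \<lambda>a b i. if i = a then b else if i = b then a else (i::nat);
         s = \<lambda>a b e. if a = b then e else - e;
         \<sigma> = \<lambda>i. t 0 b0 (t 1 b1 i)
     in Q (s 0 b0 (s 1 b1 1)) (\<sigma> 0) (\<sigma> 1) (\<sigma> 2)))"
    unfolding lessThan_numerals
    by (subst sum_permutations_insert_sign, simp, simp, rule sum.cong[OF refl],
        subst sum_permutations_insert_sign, simp, simp, rule sum.cong[OF refl],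
        unfold 2, simp only: sum.insert finite.emptyI empty_iff not_False_eq_True sum.empty o_def id_def
        add_0_right Let_def Transposition.transpose_def sign_id[unfolded id_def] if_cancel)
  then show ?thesis by (simp add: Let_def)
qed

text \<open>The value of \<open>z 0 \<and> z 1 \<and> z 2\<close> on three vectors: the 3 by 3
  determinant, expanded along the row of \<open>z 0\<close>.\<close>

definition det3 :: "(nat \<Rightarrow> 'v \<Rightarrow> complex) \<Rightarrow> 'v \<Rightarrow> 'v \<Rightarrow> 'v \<Rightarrow> complex" where
  "det3 z u v w = z 0 u * (z 1 v * z 2 w - z 2 v * z 1 w) - z 0 v * (z 1 u * z 2 w - z 2 u * z 1 w)
     + z 0 w * (z 1 u * z 2 v - z 2 u * z 1 v)"

lemma wedge_1_1_1:
  fixes \<theta> :: "nat \<Rightarrow> complex form"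
  shows "wedge 2 1 (wedge 1 1 (\<theta> 0) (\<theta> 1)) (\<theta> 2) [u, v, w] = det3 (\<lambda>k v. \<theta> k [v]) u v w"
proof -
  have 2: "wedge 1 1 (\<theta> 0) (\<theta> 1) [x, y] = \<theta> 0 [x] * \<theta> 1 [y] - \<theta> 0 [y] * \<theta> 1 [x]" for x y
  proof -
    have "wedge 1 1 (\<theta> 0) (\<theta> 1) [x, y] = (\<Sum>\<sigma> | \<sigma> permutes {..<2}.
       of_int (sign \<sigma>) * \<theta> 0 [[x, y] ! \<sigma> 0] * \<theta> 1 [[x, y] ! \<sigma> 1])"
      by (simp add: wedge_def upt_rec flip: numeral_2_eq_2)
    also have "\<dots> = \<theta> 0 [x] * \<theta> 1 [y] - \<theta> 0 [y] * \<theta> 1 [x]"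
      by (subst sum_permutations_2[of "\<lambda>s i j. of_int s * \<theta> 0 [[x, y] ! i] * \<theta> 1 [[x, y] ! j]"]) simp
    finally show ?thesis .
  qed
  let ?W = "wedge 1 1 (\<theta> 0) (\<theta> 1)"
  have "wedge 2 1 ?W (\<theta> 2) [u, v, w] = (\<Sum>\<sigma> | \<sigma> permutes {..<3}.
       of_int (sign \<sigma>) * ?W [[u, v, w] ! \<sigma> 0, [u, v, w] ! \<sigma> 1] * \<theta> 2 [[u, v, w] ! \<sigma> 2]) / 2"
    by (subst wedge_def) (simp add: upt_rec)
  also have "\<dots> = det3 (\<lambda>k v. \<theta> k [v]) u v w"
    unfolding 2
    by (subst sum_permutations_3[of "\<lambda>s i j k. of_int s * (\<theta> 0 [[u, v, w] ! i] * \<theta> 1 [[u, v, w] ! j] - \<theta> 0 [[u, v, w] ! j] * \<theta> 1 [[u, v, w] ! i]) * \<theta> 2 [[u, v, w] ! k]"])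
      (simp add: det3_def field_simps)
  finally show ?thesis .
qed

declare One_nat_def [simp del]

text \<open>\<open>z\<close> are complex linear coordinates for \<open>(\<real>\<^sup>6, J)\<close>, with complex basis \<open>e\<close>.\<close>

definition coords :: "(real^6 \<Rightarrow> real^6) \<Rightarrow> (nat \<Rightarrow> real^6 \<Rightarrow> complex) \<Rightarrow> (nat \<Rightarrow> real^6) \<Rightarrow> bool" where
  "coords J z e \<longleftrightarrow> linear J \<and> (\<forall>v. J (J v) = - v) \<and> (\<forall>k<3. linear (z k)) \<and>
     (\<forall>k<3. \<forall>v. z k (J v) = \<i> * z k v) \<and> (\<forall>k<3. \<forall>l<3. z k (e l) = (if k = l then 1 else 0)) \<and>
     (\<forall>v. v = (\<Sum>k<3. Re (z k v) *\<^sub>R e k + Im (z k v) *\<^sub>R J (e k)))"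

lemma coords_parts:
  assumes "coords J z e"
  shows "linear J" "\<forall>v. J (J v) = - v" "\<forall>k<3. linear (z k)" "\<forall>k<3. \<forall>v. z k (J v) = \<i> * z k v"
    "\<forall>k<3. \<forall>l<3. z k (e l) = (if k = l then 1 else 0)"
    "\<forall>v. v = (\<Sum>k<3. Re (z k v) *\<^sub>R e k + Im (z k v) *\<^sub>R J (e k))"
  by (insert assms[unfolded coords_def], (elim conjE, assumption)+)

lemma coords_eqI: "coords J z e \<Longrightarrow> (\<And>k. k < 3 \<Longrightarrow> z k u = z k v) \<Longrightarrow> u = v"
proof -
  assume c: "coords J z e" and eq: "\<And>k. k < 3 \<Longrightarrow> z k u = z k v"
  have x: "(\<Sum>k<3. Re (z k v) *\<^sub>R e k + Im (z k v) *\<^sub>R J (e k)) = v" for v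
    by (rule coords_parts(6)[OF c, rule_format, symmetric])
  have "(\<Sum>k<3. Re (z k u) *\<^sub>R e k + Im (z k u) *\<^sub>R J (e k)) =
    (\<Sum>k<3. Re (z k v) *\<^sub>R e k + Im (z k v) *\<^sub>R J (e k))"
    by (rule sum.cong) (simp_all add: eq)
  then show "u = v" unfolding x .
qed

text \<open>Independence of the \<open>z k\<close> and their conjugates makes \<open>T\<close> a
  real isomorphism onto complex 3-space. \<open>J\<close> is multiplication by \<i> and
  \<open>e\<close> the standard basis, both carried back by the inverse \<open>G\<close>.\<close>

lemma coords_from_independent:
  fixes z :: "nat \<Rightarrow> real^6 \<Rightarrow> complex"
  assumes lin: "linear (z 0)" "linear (z 1)" "linear (z 2)"
    and indep: "\<And>a1 a2 a3 b1 b2 b3 :: complex.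
       (\<And>v. a1 * z 0 v + a2 * z 1 v + a3 * z 2 v
          + b1 * cnj (z 0 v) + b2 * cnj (z 1 v) + b3 * cnj (z 2 v) = 0) \<Longrightarrow> a1 = 0 \<and> a2 = 0 \<and> a3 = 0"
  obtains J e where "coords J z e"
proof -
  define T where "T v = (z 0 v, z 1 v, z 2 v)" for v
  have T: "linear T"
    by (rule linearI)
      (simp_all add: T_def linear_add[OF lin(1)] linear_add[OF lin(2)] linear_add[OF lin(3)]
        linear_scale[OF lin(1)] linear_scale[OF lin(2)] linear_scale[OF lin(3)])
  have "surj T"
  proof (rule ccontr)
    assume "\<not> surj T"
    have "subspace (range T)" using T by (simp add: linear_subspace_image)
    then have sp: "span (range T) = range T" by (simp only: span_eq_iff)
    have "span (range T) \<noteq> UNIV" unfolding sp by fact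
    then have sub: "span (range T) \<subset> span UNIV" by (simp only: psubset_eq span_UNIV subset_UNIV simp_thms)
    obtain x where x: "x \<noteq> 0" "\<And>y. y \<in> span (range T) \<Longrightarrow> orthogonal x y"
      using orthogonal_to_subspace_exists_gen[OF sub] by blast
    obtain a b c where abc: "x = (a, b, c)" by (cases x) auto
    \<comment> \<open>If (a, b, c) is orthogonal to the range, the real part of
      \<open>cnj a * z 0 v + cnj b * z 1 v + cnj c * z 2 v\<close> vanishes. Twice this real part is
      a relation between the \<open>z k\<close> and their conjugates.\<close>
    have "cnj a * z 0 v + cnj b * z 1 v + cnj c * z 2 v + a * cnj (z 0 v) + b * cnj (z 1 v) + c * cnj (z 2 v) = 0" for v
    proof -
      have "x \<bullet> T v = 0" using x(2)[of "T v"] by (simp add: span_base orthogonal_def)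
      then have "a \<bullet> z 0 v + b \<bullet> z 1 v + c \<bullet> z 2 v = 0" by (simp add: abc T_def inner_Pair add.assoc)
      then show ?thesis by (simp add: complex_eq_iff inner_complex_def algebra_simps)
    qed
    then have "cnj a = 0 \<and> cnj b = 0 \<and> cnj c = 0" by (rule indep)
    then show False using x(1) abc by (simp add: zero_prod_def)
  qed
  then obtain G where G: "linear G" "T \<circ> G = id"
    using linear_surjective_right_inverse[OF T] by blast
  then have TG: "T (G w) = w" for w by (metis comp_apply id_apply)
  have injG: "inj G" by (rule inj_on_inverseI[of _ T]) (rule TG)
  have "dim (range G) = dim (UNIV :: (complex \<times> complex \<times> complex) set)"
    by (rule dim_image_eq[OF G(1)]) (use injG in simp)
  then have "dim (range G) = DIM(real^6)" by simp
  then have "span (range G) = UNIV" unfolding dim_eq_full .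
  moreover have "subspace (range G)" using G(1) by (simp add: linear_subspace_image)
  then have "span (range G) = range G" by (simp only: span_eq_iff)
  ultimately have "surj G" by argo
  then have GT: "G (T v) = v" for v by (metis TG surjD)
  define J where "J v = G (\<i> * z 0 v, \<i> * z 1 v, \<i> * z 2 v)" for v
  define e where "e k = G (if k = (0::nat) then 1 else 0, if k = 1 then 1 else 0, if k = 2 then 1 else 0)" for k
  have zG: "z 0 (G (a, b, c)) = a" "z 1 (G (a, b, c)) = b" "z 2 (G (a, b, c)) = c" for a b c
    using TG[of "(a, b, c)"] by (simp_all add: T_def)
  have all3: "(\<forall>k<3. P k) \<longleftrightarrow> P 0 \<and> P 1 \<and> P (2::nat)" for P
  proof -
    have "k < 3 \<longleftrightarrow> k = 0 \<or> k = 1 \<or> k = 2" for k :: nat by auto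
    then show ?thesis by auto
  qed
  have "coords J z e" unfolding coords_def all3
  proof (intro conjI allI)
    show "linear J"
    proof (rule linearI)
      fix u v r
      show "J (u + v) = J u + J v" unfolding J_def linear_add[OF G(1), symmetric]
        by (simp add: linear_add[OF lin(1)] linear_add[OF lin(2)] linear_add[OF lin(3)] distrib_left)
      show "J (r *\<^sub>R v) = r *\<^sub>R J v" unfolding J_def linear_scale[OF G(1), symmetric]
        by (simp add: linear_scale[OF lin(1)] linear_scale[OF lin(2)] linear_scale[OF lin(3)])
    qed
    show "J (J v) = - v" for v
    proof -
      have "J (J v) = G (- T v)" by (simp add: J_def zG T_def mult.assoc[symmetric] del: mult.assoc)
      then show ?thesis by (simp add: linear_neg[OF G(1)] GT)
    qed
    show "v = (\<Sum>k<3. Re (z k v) *\<^sub>R e k + Im (z k v) *\<^sub>R J (e k))" for v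
    proof -
      have rc: "Re x *\<^sub>R 1 + Im x *\<^sub>R \<i> = x" for x by (simp add: complex_eq_iff)
      have "(\<Sum>k<3. Re (z k v) *\<^sub>R e k + Im (z k v) *\<^sub>R J (e k)) = G (T v)"
        unfolding lessThan_numerals
        by (simp add: e_def J_def zG linear_scale[OF G(1), symmetric] linear_add[OF G(1), symmetric] T_def rc)
      then show ?thesis by (simp add: GT)
    qed
  qed (simp_all add: lin J_def zG e_def del: One_nat_def)
  then show thesis by (rule that)
qed

lemma coordsD:
  assumes "coords J z e"
  shows "linear J" "J (J v) = - v" "linear (z 0)" "linear (z 1)" "linear (z 2)"
    "z 0 (J v) = \<i> * z 0 v" "z 1 (J v) = \<i> * z 1 v" "z 2 (J v) = \<i> * z 2 v"
    "z 0 (e 0) = 1" "z 0 (e 1) = 0" "z 0 (e 2) = 0" "z 1 (e 0) = 0" "z 1 (e 1) = 1" "z 1 (e 2) = 0"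
    "z 2 (e 0) = 0" "z 2 (e 1) = 0" "z 2 (e 2) = 1"
  using coords_parts(1-5)[OF assms] by simp_all

lemma coords_expand:
  assumes "coords J z e"
  shows "v = Re (z 0 v) *\<^sub>R e 0 + Im (z 0 v) *\<^sub>R J (e 0) + Re (z 1 v) *\<^sub>R e 1 + Im (z 1 v) *\<^sub>R J (e 1)
     + Re (z 2 v) *\<^sub>R e 2 + Im (z 2 v) *\<^sub>R J (e 2)"
proof -
  have "v = (\<Sum>k<3. Re (z k v) *\<^sub>R e k + Im (z k v) *\<^sub>R J (e k))"
    by (rule coords_parts(6)[OF assms, rule_format])
  also have "\<dots> = Re (z 0 v) *\<^sub>R e 0 + Im (z 0 v) *\<^sub>R J (e 0) + Re (z 1 v) *\<^sub>R e 1 + Im (z 1 v) *\<^sub>R J (e 1)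
     + Re (z 2 v) *\<^sub>R e 2 + Im (z 2 v) *\<^sub>R J (e 2)"
    unfolding lessThan_numerals by (simp add: add.assoc del: One_nat_def)
  finally show ?thesis .
qed

lemma complex_linear_expand:
  assumes c: "coords J z e" and X: "linear X" "\<And>v. X (J v) = \<i> * X v"
  shows "X v = X (e 0) * z 0 v + X (e 1) * z 1 v + X (e 2) * z 2 v"
proof -
  have "X v = Re (z 0 v) *\<^sub>R X (e 0) + Im (z 0 v) *\<^sub>R (\<i> * X (e 0)) + Re (z 1 v) *\<^sub>R X (e 1)
     + Im (z 1 v) *\<^sub>R (\<i> * X (e 1)) + Re (z 2 v) *\<^sub>R X (e 2) + Im (z 2 v) *\<^sub>R (\<i> * X (e 2))"
    by (subst coords_expand[OF c, of v])
      (simp add: linear_add[OF X(1)] linear_scale[OF X(1)] X(2) del: One_nat_def)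
  also have "\<dots> = X (e 0) * z 0 v + X (e 1) * z 1 v + X (e 2) * z 2 v"
    by (simp add: complex_eq_iff algebra_simps)
  finally show ?thesis .
qed

text \<open>The (3,0)-forms are a complex line: complex linearity in each slot reduces to the
  vectors \<open>e k\<close>, and alternation to the one value on
  \<open>e 0, e 1, e 2\<close>.\<close>

lemma holo3_det:
  assumes c: "coords J z e" and h: "holo3 J \<phi> \<psi>"
  shows "Complex (\<phi> [u, v, w]) (\<psi> [u, v, w]) = Complex (\<phi> [e 0, e 1, e 2]) (\<psi> [e 0, e 1, e 2]) * det3 z u v w"
proof -
  have alt: "alt_form 3 \<phi>" "alt_form 3 \<psi>" using h by (auto simp: holo3_def)
  define O3 where "O3 u v w = Complex (\<phi> [u, v, w]) (\<psi> [u, v, w])" for u v w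
  have lc: "linear (\<lambda>x. Complex (a x) (b x))" if "linear a" "linear b" for a b :: "real^6 \<Rightarrow> real"
    using that by (intro linearI) (simp_all add: linear_add linear_scale complex_eq_iff)
  have l: "linear (\<lambda>u. O3 u v w)" "linear (\<lambda>u. O3 v u w)" "linear (\<lambda>u. O3 v w u)" for v w
    unfolding O3_def by (intro lc alt_form_3_linear alt)+
  have J: "O3 (J u) v w = \<i> * O3 u v w" "O3 u (J v) w = \<i> * O3 u v w" "O3 u v (J w) = \<i> * O3 u v w" for u v w
    by (simp_all add: O3_def holo3D[OF h] complex_eq_iff)
  have s1: "O3 u v w = O3 (e 0) v w * z 0 u + O3 (e 1) v w * z 1 u + O3 (e 2) v w * z 2 u"
    and s2: "O3 u v w = O3 u (e 0) w * z 0 v + O3 u (e 1) w * z 1 v + O3 u (e 2) w * z 2 v"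
    and s3: "O3 u v w = O3 u v (e 0) * z 0 w + O3 u v (e 1) * z 1 w + O3 u v (e 2) * z 2 w" for u v w
    by (rule complex_linear_expand[OF c l(1) J(1)] complex_linear_expand[OF c l(2) J(2)]
        complex_linear_expand[OF c l(3) J(3)])+
  have b: "i < j \<Longrightarrow> O3 (e j) (e i) v = - O3 (e i) (e j) v" "i < j \<Longrightarrow> O3 v (e j) (e i) = - O3 v (e i) (e j)"
     "O3 (e i) (e i) v = 0" "O3 v (e i) (e i) = 0" "O3 (e i) v (e i) = 0" for i j :: nat and v
    by (simp_all add: O3_def complex_eq_iff alt_form_3_repeat[OF alt(1)] alt_form_3_repeat[OF alt(2)]
      alt_form_3_swap(1)[OF alt(1), of "e j" "e i" v] alt_form_3_swap(1)[OF alt(2), of "e j" "e i" v]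
      alt_form_3_swap(2)[OF alt(1), of v "e j" "e i"] alt_form_3_swap(2)[OF alt(2), of v "e j" "e i"])
  have "O3 u v w = O3 (e 0) (e 1) (e 2) * det3 z u v w"
    unfolding s1[of u v w] s2[of "e 0" v w] s2[of "e 1" v w] s2[of "e 2" v w]
      s3[of "e 0" "e 0" w] s3[of "e 0" "e 1" w] s3[of "e 0" "e 2" w]
      s3[of "e 1" "e 0" w] s3[of "e 1" "e 1" w] s3[of "e 1" "e 2" w]
      s3[of "e 2" "e 0" w] s3[of "e 2" "e 1" w] s3[of "e 2" "e 2" w]
    by (simp add: b) (simp add: det3_def algebra_simps)
  then show ?thesis by (simp add: O3_def)
qed

lemma det3_J:
  assumes "coords J z e"
  shows "det3 z (J u) v w = \<i> * det3 z u v w" "det3 z u (J v) w = \<i> * det3 z u v w" "det3 z u v (J w) = \<i> * det3 z u v w"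
  by (simp_all add: det3_def coordsD[OF assms] algebra_simps)

lemma alt_form_pullback:
  assumes "alt_form k \<phi>" "linear J" shows "alt_form k (\<lambda>vs. \<phi> (map J vs))"
  unfolding alt_form_def
proof (intro conjI allI impI)
  fix vs :: "(real^6) list" and i :: nat assume *: "length vs = k \<and> i < k"
  have "linear (\<lambda>v. \<phi> ((map J vs)[i := v]))" using * by (intro alt_form_linear[OF assms(1)]) auto
  from linear_compose[OF assms(2) this]
  show "linear (\<lambda>v. \<phi> (map J (vs[i := v])))" by (simp add: map_update o_def)
next
  fix vs :: "(real^6) list" and i j :: nat assume *: "length vs = k \<and> i < j \<and> j < k \<and> vs ! i = vs ! j"
  show "\<phi> (map J vs) = 0"
    by (rule alt_form_repeat[OF assms(1), of _ i j]) (use * in auto)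
qed (use alt_form_length[OF assms(1)] in auto)

lemma holo3_from_det:
  assumes c: "coords J z e" and \<phi>: "alt_form 3 \<phi>" and det: "\<And>u v w. \<phi> [u, v, w] = Re (det3 z u v w)"
  shows "holo3 J \<phi> (\<lambda>vs. \<phi> (map J vs))"
  unfolding holo3_def using \<phi> alt_form_pullback[OF \<phi> coordsD(1)[OF c]]
  by (simp add: det det3_J[OF c])

lemma induces_acs_iff:
  assumes \<phi>: "alt_form 3 \<phi>"
  shows "induces_acs \<omega> \<phi> J \<longleftrightarrow> linear J \<and> (\<forall>v. J (J v) = - v) \<and> holo3 J \<phi> (\<lambda>vs. \<phi> (map J vs)) \<and>
    (\<exists>vs. \<phi> vs \<noteq> 0) \<and> (\<exists>c>0. \<forall>vs. wedge 3 3 \<phi> (\<lambda>vs. \<phi> (map J vs)) vs = c * omega_cubed \<omega> vs)"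
proof -
  have t: "type_30 J (\<lambda>vs. Complex (\<phi> vs) (\<phi> (map J vs))) \<longleftrightarrow> holo3 J \<phi> (\<lambda>vs. \<phi> (map J vs))" if J: "linear J"
  proof -
    have alt: "alt_form 3 (\<lambda>vs. \<phi> (map J vs))" by (rule alt_form_pullback[OF \<phi> J])
    have lc: "linear (\<lambda>x. Complex (a x) (b x))" if "linear a" "linear b" for a b :: "real^6 \<Rightarrow> real"
      using that by (intro linearI) (simp_all add: linear_add linear_scale complex_eq_iff)
    have "alt_form 3 (\<lambda>vs. Complex (\<phi> vs) (\<phi> (map J vs)))"
      unfolding alt_form_def
    proof (intro conjI allI impI)
      fix vs :: "(real^6) list" and i :: nat assume *: "length vs = 3 \<and> i < 3"
      show "linear (\<lambda>v. Complex (\<phi> (vs[i := v])) (\<phi> (map J (vs[i := v]))))"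
        by (intro lc alt_form_linear[OF \<phi>] alt_form_linear[OF alt]) (use * in auto)
    next
      fix vs :: "(real^6) list" and i j :: nat assume *: "length vs = 3 \<and> i < j \<and> j < 3 \<and> vs ! i = vs ! j"
      have "\<phi> vs = 0" "\<phi> (map J vs) = 0"
        by (rule alt_form_repeat[OF \<phi>, of _ i j] alt_form_repeat[OF alt, of _ i j]; use * in auto)+
      then show "Complex (\<phi> vs) (\<phi> (map J vs)) = 0" by (simp add: complex_eq_iff)
    qed (use alt_form_length[OF \<phi>] alt_form_length[OF alt] in \<open>simp add: complex_eq_iff\<close>)
    then show ?thesis using \<phi> alt by (simp add: type_30_def holo3_def complex_eq_iff)
  qed
  have n: "(\<exists>vs. Complex (\<phi> vs) (\<phi> (map J vs)) \<noteq> 0) \<longleftrightarrow> (\<exists>vs. \<phi> vs \<noteq> 0)"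
    by (auto simp: complex_eq_iff)
  show ?thesis unfolding induces_acs_def Let_def n using t by auto
qed

definition real_frame :: "(real^6 \<Rightarrow> real^6) \<Rightarrow> (nat \<Rightarrow> real^6) \<Rightarrow> nat \<Rightarrow> real^6" where
  "real_frame J e i = [e 0, J (e 0), e 1, J (e 1), e 2, J (e 2)] ! i"

lemma complex_frame_real_frame: "complex_frame J (real_frame J e)"
  by (simp add: complex_frame_def real_frame_def)

lemma real_frame_span:
  assumes "coords J z e" shows "span (real_frame J e ` {..<6}) = UNIV"
proof -
  have s: "set [e 0, J (e 0), e 1, J (e 1), e 2, J (e 2)] \<subseteq> real_frame J e ` {..<6}"
    by (auto simp: lessThan_numerals real_frame_def)
  have "v \<in> span (set [e 0, J (e 0), e 1, J (e 1), e 2, J (e 2)])" for v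
    by (subst coords_expand[OF assms, of v])
      (intro span_add span_scale span_base; simp)
  then show ?thesis using span_mono[OF s] by blast
qed

lemma alt_form_omega_cubed:
  assumes "alt_form 2 \<omega>" shows "alt_form 6 (omega_cubed \<omega>)"
proof -
  have w22: "alt_form 4 (wedge 2 2 \<omega> \<omega>)"
    using alt_form_wedge[of 2 \<omega> 2 \<omega>] assms by (simp add: alt_form_multilin)
  show ?thesis
    using alt_form_wedge[of 4 "wedge 2 2 \<omega> \<omega>" 2 \<omega>] assms w22 by (simp add: omega_cubed_def alt_form_multilin)
qed

text \<open>On the frame of the \<open>e k\<close> and \<open>J (e k)\<close>, the duality
  \<open>holo3_dual\<close> turns \<phi> \<and> \<psi> into a sum of squares. So \<phi> \<and>
  \<psi> is a positive multiple of the cube of \<omega> as soon as the latter is positive on this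
  frame.\<close>

lemma induces_acs_oriented:
  assumes c: "coords J z e" and \<phi>: "alt_form 3 \<phi>" and det: "\<And>u v w. \<phi> [u, v, w] = Re (det3 z u v w)"
    and \<omega>: "alt_form 2 \<omega>" and pos: "omega_cubed \<omega> (map (real_frame J e) [0..<6]) > 0"
  shows "induces_acs \<omega> \<phi> J"
proof -
  let ?\<psi> = "\<lambda>vs. \<phi> (map J vs)" and ?f = "real_frame J e"
  note h = holo3_from_det[OF c \<phi> det]
  note dual = holo3_dual[OF h complex_frame_real_frame]
  have "wedge 3 3 \<phi> ?\<psi> (map ?f [0..<3 + 3]) > 0"
  proof -
    let ?T = "\<lambda>\<sigma>. of_int (sign \<sigma>) * \<phi> (map (\<lambda>i. ?f (\<sigma> i)) [0..<3]) * ?\<psi> (map (\<lambda>i. ?f (\<sigma> i)) [3..<3 + 3])"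
    have T: "?T \<sigma> = (\<phi> (map (\<lambda>i. ?f (\<sigma> i)) [0..<3]))\<^sup>2" if "\<sigma> permutes {..<6}" for \<sigma>
    proof -
      have "?T \<sigma> = \<phi> (map (\<lambda>i. ?f (\<sigma> i)) [0..<3]) * (of_int (sign \<sigma>) * ?\<psi> (map (\<lambda>i. ?f (\<sigma> i)) [3..<6]))"
        by (simp add: mult_ac del: upt_rec_numeral list.map map_map)
      then show ?thesis unfolding dual[OF that] by (simp add: power2_eq_square)
    qed
    \<comment> \<open>\<open>[0, 2, 4]\<close> are the positions of \<open>e 0, e 1, e 2\<close> in
      \<open>real_frame\<close>; there \<phi> is 1, which makes the sum strictly positive.\<close>
    obtain \<sigma>0 where \<sigma>0: "\<sigma>0 permutes {..<6::nat}" "map \<sigma>0 [0..<3] = [0, 2, 4]"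
      by (rule distinct_list_permutation[of "[0, 2, 4]" 6 3]) auto
    have "(\<Sum>\<sigma> | \<sigma> permutes {..<3 + 3}. ?T \<sigma>) > 0"
    proof (rule sum_pos2[of _ \<sigma>0])
      have "map (\<lambda>i. ?f (\<sigma>0 i)) [0..<3] = map ?f (map \<sigma>0 [0..<3])" by (simp del: upt_rec_numeral)
      also have "\<dots> = [e 0, e 1, e 2]" unfolding \<sigma>0(2) by (simp add: real_frame_def)
      finally have "\<phi> (map (\<lambda>i. ?f (\<sigma>0 i)) [0..<3]) = 1"
        by (simp only: det) (simp add: det3_def coordsD[OF c])
      then show "?T \<sigma>0 > 0" unfolding T[OF \<sigma>0(1)] by simp
      show "?T \<sigma> \<ge> 0" if "\<sigma> \<in> {\<sigma>. \<sigma> permutes {..<3 + 3}}" for \<sigma>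
      proof -
        have "\<sigma> permutes {..<6}" using that by simp
        then show ?thesis by (subst T) auto
      qed
    qed (use \<sigma>0(1) in \<open>auto simp: finite_permutations\<close>)
    then show ?thesis unfolding wedge_at_basis by simp
  qed
  then have w: "wedge 3 3 \<phi> ?\<psi> (map ?f [0..<6]) > 0" by simp
  have alt: "alt_form 6 (wedge 3 3 \<phi> ?\<psi>)"
    using alt_form_wedge[of 3 \<phi> 3 ?\<psi>] h by (simp add: holo3_def alt_form_multilin)
  note \<tau> = alt_form_omega_cubed[OF \<omega>]
  let ?c = "wedge 3 3 \<phi> ?\<psi> (map ?f [0..<6]) / omega_cubed \<omega> (map ?f [0..<6])"
  have "wedge 3 3 \<phi> ?\<psi> vs = ?c * omega_cubed \<omega> vs" for vs
    by (rule alt_form_top_eq[OF alt alt_form_scale[OF \<tau>] real_frame_span[OF c]]) (use pos in simp)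
  moreover have "?c > 0" using w pos by simp
  moreover have "\<phi> [e 0, e 1, e 2] \<noteq> 0" by (simp add: det det3_def coordsD[OF c])
  ultimately show ?thesis
    unfolding induces_acs_iff[OF \<phi>] using h coordsD(1,2)[OF c] by blast
qed

text \<open>A top form that vanishes on one basis vanishes identically, but on a Darboux basis the
  cube of \<omega> is positive.\<close>

lemma omega_cubed_nonzero:
  assumes \<omega>: "alt_form 2 \<omega>" "nondegenerate \<omega>" and span: "span (f ` {..<6}) = UNIV"
  shows "omega_cubed \<omega> (map f [0..<6]) \<noteq> 0"
proof
  assume 0: "omega_cubed \<omega> (map f [0..<6]) = 0"
  obtain p where p: "darboux \<omega> p" using darboux_exists[OF \<omega>] .
  have z: "alt_form 6 (\<lambda>vs. 0 :: real)" unfolding alt_form_def by (simp add: linear_zero)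
  have "omega_cubed \<omega> (map p [0..<6]) = 0"
    using alt_form_top_eq[OF alt_form_omega_cubed[OF \<omega>(1)] z span] 0 by blast
  moreover have "omega_cubed \<omega> (map p [0..<6]) > 0"
    by (rule omega_cubed_darboux[OF \<omega>(1)]) (use p in \<open>auto simp: darboux_def\<close>)
  ultimately show False by simp
qed

lemma coords_conjugate:
  assumes "coords J z e" shows "coords (\<lambda>v. - J v) (\<lambda>k v. cnj (z k v)) e"
  unfolding coords_def
proof (intro conjI allI impI)
  note c = coords_parts[OF assms]
  show "linear (\<lambda>v. - J v)" by (rule linear_compose_neg[OF c(1)])
  show "- J (- J v) = - v" for v using c(2) by (simp add: linear_neg[OF c(1)])
  show "linear (\<lambda>v. cnj (z k v))" if "k < 3" for k
    using linear_compose[OF c(3)[rule_format, OF that] linear_cnj] by (simp add: o_def)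
  show "cnj (z k (- J v)) = \<i> * cnj (z k v)" if "k < 3" for k v
    using c(4)[rule_format, OF that] linear_neg[OF c(3)[rule_format, OF that]] by simp
  show "cnj (z k (e l)) = (if k = l then 1 else 0)" if "k < 3" "l < 3" for k l
    using c(5)[rule_format, OF that] by simp
  show "v = (\<Sum>k<3. Re (cnj (z k v)) *\<^sub>R e k + Im (cnj (z k v)) *\<^sub>R - J (e k))" for v
    using c(6)[rule_format, of v] by simp
qed

text \<open>\<phi> is the real part of the determinant in the \<open>z k\<close> and also in their
  conjugates, which are coordinates for \<open>-J\<close>. Passing to \<open>-J\<close> reverses
  three of the six frame vectors, an odd number, so one of the two frames is positive.\<close>

lemma induces_acs_exists:
  assumes c: "coords J z e" and \<phi>: "alt_form 3 \<phi>" and det: "\<And>u v w. \<phi> [u, v, w] = Re (det3 z u v w)"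
    and \<omega>: "alt_form 2 \<omega>" "nondegenerate \<omega>"
  shows "induces_acs \<omega> \<phi> J \<or> induces_acs \<omega> \<phi> (\<lambda>v. - J v)"
proof -
  let ?\<tau> = "omega_cubed \<omega>"
  note \<tau> = alt_form_omega_cubed[OF \<omega>(1)]
  have ne: "?\<tau> (map (real_frame J e) [0..<6]) \<noteq> 0"
    by (rule omega_cubed_nonzero[OF \<omega> real_frame_span[OF c]])
  have n: "?\<tau> [a, - b, c, - d, x, - y] = - ?\<tau> [a, b, c, d, x, y]" for a b c d x y
    using linear_neg[OF alt_form_linear[OF \<tau>, of "[a, b, c, - d, x, - y]" 1], of b]
      linear_neg[OF alt_form_linear[OF \<tau>, of "[a, b, c, d, x, - y]" 3], of d]
      linear_neg[OF alt_form_linear[OF \<tau>, of "[a, b, c, d, x, y]" 5], of y] by (simp add: One_nat_def)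
  have "?\<tau> (map (real_frame (\<lambda>v. - J v) e) [0..<6]) = - ?\<tau> (map (real_frame J e) [0..<6])"
    using n[of "e 0" "J (e 0)" "e 1" "J (e 1)" "e 2" "J (e 2)"] by (simp add: upt_numerals real_frame_def)
  then consider "?\<tau> (map (real_frame J e) [0..<6]) > 0" | "?\<tau> (map (real_frame (\<lambda>v. - J v) e) [0..<6]) > 0"
    using ne by linarith
  then show ?thesis
  proof cases
    case 1
    then show ?thesis using induces_acs_oriented[OF c \<phi> det \<omega>(1)] by blast
  next
    case 2
    have "\<phi> [u, v, w] = Re (det3 (\<lambda>k v. cnj (z k v)) u v w)" for u v w
      by (simp add: det det3_def algebra_simps)
    then show ?thesis using induces_acs_oriented[OF coords_conjugate[OF c] \<phi> _ \<omega>(1) 2] by blast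
  qed
qed

text \<open>\<open>K\<close> can be moved between the slots of the determinant. On basis vectors
  this makes \<open>K\<close> a scalar \<open>l\<close> in the coordinates \<open>z\<close>, and
  \<open>K (K v) = - v\<close> leaves only \<open>\<i>\<close> and \<open>-\<i>\<close> for
  \<open>l\<close>.\<close>

lemma holo3_unique_up_to_sign:
  assumes c: "coords J z e" and det: "\<And>u v w. \<phi> [u, v, w] = Re (det3 z u v w)"
    and h: "holo3 K \<phi> \<psi>" and KK: "\<And>v. K (K v) = - v"
  shows "K = J \<or> K = (\<lambda>v. - J v)"
proof -
  have D: "det3 z (K u) v w = det3 z u (K v) w" "det3 z (K u) v w = det3 z u v (K w)" for u v w
  proof -
    have r: "Re (det3 z (K u) v w) = Re (det3 z u (K v) w)" "Re (det3 z u (K v) w) = Re (det3 z u v (K w))" for u v w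
      unfolding det[symmetric] by (simp_all add: holo3D[OF h])
    \<comment> \<open>The hypotheses control real parts only. Replacing \<open>w\<close> by
      \<open>J w\<close> multiplies both sides by \<i> and so supplies the imaginary parts.\<close>
    show "det3 z (K u) v w = det3 z u (K v) w"
      using r(1)[of u v w] r(1)[of u v "J w"] by (simp add: det3_J[OF c] complex_eq_iff)
    have "Re (\<i> * det3 z (K u) v w) = Re (\<i> * det3 z u v (K w))"
      using r(1)[of u "J v" w] r(2)[of u "J v" w] by (simp add: det3_J[OF c])
    then show "det3 z (K u) v w = det3 z u v (K w)"
      using r[of u v w] by (simp add: complex_eq_iff)
  qed
  note b = coordsD(9-17)[OF c]
  define l where "l = z 0 (K (e 0))"
  \<comment> \<open>With the same basis vector in two slots, moving \<open>K\<close> amounts to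
    exchanging these slots, so the coordinate equals its own negative.\<close>
  have off: "z 0 (K (e 1)) = 0" "z 0 (K (e 2)) = 0" "z 1 (K (e 2)) = 0" "z 1 (K (e 0)) = 0" "z 2 (K (e 0)) = 0" "z 2 (K (e 1)) = 0"
    using D(1)[of "e 1" "e 1" "e 2"] D(1)[of "e 2" "e 2" "e 1"] D(1)[of "e 2" "e 2" "e 0"]
      D(1)[of "e 0" "e 0" "e 2"] D(1)[of "e 0" "e 0" "e 1"] D(1)[of "e 1" "e 1" "e 0"]
    by (simp_all add: det3_def b)
  have diag: "z 1 (K (e 1)) = l" "z 2 (K (e 2)) = l"
    using D(1)[of "e 0" "e 1" "e 2"] D(2)[of "e 0" "e 1" "e 2"] by (simp_all add: det3_def b l_def)
  have zK: "z 0 (K v) = l * z 0 v" "z 1 (K v) = l * z 1 v" "z 2 (K v) = l * z 2 v" for v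
    using D(1)[of v "e 1" "e 2"] D(1)[of v "e 2" "e 0"] D(1)[of v "e 0" "e 1"]
    by (simp_all add: det3_def b off diag l_def[symmetric] mult.commute)
  have "l * l = - 1"
    using zK(1)[of "K (e 0)"] zK(1)[of "e 0"] linear_neg[OF coordsD(3)[OF c]] by (simp add: KK b)
  then have "(l - \<i>) * (l + \<i>) = 0" by (simp add: algebra_simps)
  then have "l = \<i> \<or> l = - \<i>" by (simp add: eq_neg_iff_add_eq_0)
  moreover have K: "K v = c *\<^sub>R J v" if "c = 1 \<and> l = \<i> \<or> c = - 1 \<and> l = - \<i>" for v c
  proof (rule coords_eqI[OF c])
    fix k :: nat assume "k < 3"
    then have "k = 0 \<or> k = 1 \<or> k = 2" by auto
    moreover have "l = of_real c * \<i>" using that by auto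
    ultimately show "z k (K v) = z k (c *\<^sub>R J v)"
      using zK coordsD(6-8)[OF assms(1)] linear_scale[OF coordsD(3)[OF assms(1)]]
        linear_scale[OF coordsD(4)[OF assms(1)]] linear_scale[OF coordsD(5)[OF assms(1)]]
      by (auto simp: scaleR_conv_of_real)
  qed
  ultimately show ?thesis using K[of 1] K[of "- 1"] by auto
qed

text \<open>The degree of \<phi> is odd, so \<open>-J\<close> reverses the sign of \<phi> \<and>
  \<psi>. If both signs were admissible, a positive multiple of the cube of \<omega> would
  vanish.\<close>

lemma acs_unique:
  assumes c: "coords J0 z e" and \<phi>: "alt_form 3 \<phi>" and det: "\<And>u v w. \<phi> [u, v, w] = Re (det3 z u v w)"
    and \<omega>: "alt_form 2 \<omega>" "nondegenerate \<omega>"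
    and J: "induces_acs \<omega> \<phi> J" and K: "induces_acs \<omega> \<phi> K"
  shows "K = J"
proof -
  note J' = J[unfolded induces_acs_iff[OF \<phi>]] and K' = K[unfolded induces_acs_iff[OF \<phi>]]
  have "K = J0 \<or> K = (\<lambda>v. - J0 v)" "J = J0 \<or> J = (\<lambda>v. - J0 v)"
    by (rule holo3_unique_up_to_sign[OF c det]; use J' K' in blast)+
  then consider "K = J" | "K = (\<lambda>v. - J v)" by auto
  then show ?thesis
  proof cases
    case 2
    have neg: "\<phi> (map K vs) = - \<phi> (map J vs)" for vs
    proof (cases "length vs = 3")
      case True
      then obtain u v w where vs: "vs = [u, v, w]" by (auto simp: numeral_3_eq_3 length_Suc_conv)
      show ?thesis
        using linear_neg[OF alt_form_3_linear(1)[OF \<phi>]] linear_neg[OF alt_form_3_linear(2)[OF \<phi>]]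
          linear_neg[OF alt_form_3_linear(3)[OF \<phi>]] by (simp add: vs 2)
    next
      case False
      then show ?thesis using alt_form_length[OF \<phi>] by simp
    qed
    obtain c1 where c1: "c1 > 0" "\<And>vs. wedge 3 3 \<phi> (\<lambda>vs. \<phi> (map J vs)) vs = c1 * omega_cubed \<omega> vs"
      using J' by blast
    obtain c2 where c2: "c2 > 0" "\<And>vs. wedge 3 3 \<phi> (\<lambda>vs. \<phi> (map K vs)) vs = c2 * omega_cubed \<omega> vs"
      using K' by blast
    have "wedge 3 3 \<phi> (\<lambda>vs. \<phi> (map K vs)) vs = - wedge 3 3 \<phi> (\<lambda>vs. \<phi> (map J vs)) vs" for vs
      unfolding neg by (simp add: wedge_def sum_negf)
    then have "(c1 + c2) * omega_cubed \<omega> vs = 0" for vs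
      using c1(2)[of vs] c2(2)[of vs] by (simp add: distrib_right)
    then have "omega_cubed \<omega> vs = 0" for vs using c1(1) c2(1) by (metis add_pos_pos mult_eq_0_iff less_irrefl)
    then show ?thesis using omega_cubed_nonzero[OF \<omega> real_frame_span[OF c]] by simp
  qed
qed

text \<open>\<open>q\<close> is the bivector dual to \<omega>, extended to complex functionals.
  Primitivity says that its contraction with \<open>z 0 \<and> z 1 \<and> z 2\<close> is 0, hence
  \<open>q\<close> vanishes on pairs of (1,0)-functionals. By duality \<omega> is of type (1,1),
  which is invariance under \<open>J\<close>.\<close>

lemma compatible:
  assumes p: "darboux \<omega> p" and c: "coords J z e" and det: "\<And>u v w. \<phi> [u, v, w] = Re (det3 z u v w)"
    and prim: "\<And>v. \<phi> [p 0, p 1, v] + \<phi> [p 2, p 3, v] + \<phi> [p 4, p 5, v] = 0"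
  shows "\<omega> [J u, J v] = \<omega> [u, v]"
proof -
  have \<omega>: "alt_form 2 \<omega>" using p by (simp add: darboux_def)
  note lin = alt_form_2_bilinear[OF \<omega>]
  note J = coordsD(1,2)[OF c]
  define q where "q X Y = (X (p 0) * Y (p 1) - X (p 1) * Y (p 0)) + (X (p 2) * Y (p 3) - X (p 3) * Y (p 2))
     + (X (p 4) * Y (p 5) - X (p 5) * Y (p 4))" for X Y :: "real^6 \<Rightarrow> complex"
  \<comment> \<open>\<open>prim\<close> at \<open>v\<close> and at \<open>J v\<close> gives the real
    and the imaginary part.\<close>
  have D0: "det3 z (p 0) (p 1) v + det3 z (p 2) (p 3) v + det3 z (p 4) (p 5) v = 0" for v
    using prim[of v] prim[of "J v"] by (simp add: det det3_J[OF c] complex_eq_iff)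
  have D1: "q (z 0) (z 1) * z 2 v - q (z 0) (z 2) * z 1 v + q (z 1) (z 2) * z 0 v = 0" for v
    unfolding D0[of v, symmetric] by (simp add: q_def det3_def algebra_simps)
  note b = coordsD(9-17)[OF c]
  have q0: "q (z 0) (z 1) = 0" "q (z 0) (z 2) = 0" "q (z 1) (z 2) = 0"
    using D1[of "e 2"] D1[of "e 1"] D1[of "e 0"] by (simp_all add: b)
  have qa: "q X Y = - q Y X" for X Y by (simp add: q_def algebra_simps)
  have q0': "q (z 1) (z 0) = 0" "q (z 2) (z 0) = 0" "q (z 2) (z 1) = 0" "q X X = 0" for X
    using q0 qa[of "z 1" "z 0"] qa[of "z 2" "z 0"] qa[of "z 2" "z 1"] by (simp_all add: q_def mult.commute)
  \<comment> \<open>\<open>X u\<close> is twice the (1,0) part of the functional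
    \<open>\<omega> [u, _]\<close>. The real part of \<open>q (X u) (X v) = 0\<close> compares
    \<open>q\<close> on two such functionals before and after composition with
    \<open>J\<close>.\<close>
  define X where "X u v = Complex (\<omega> [u, v]) (- \<omega> [u, J v])" for u v
  have X: "X u v = X u (e 0) * z 0 v + X u (e 1) * z 1 v + X u (e 2) * z 2 v" for u v
  proof (rule complex_linear_expand[OF c])
    show "linear (X u)"
      by (rule linearI) (simp_all add: X_def complex_eq_iff linear_add[OF J(1)] linear_scale[OF J(1)]
         linear_add[OF lin(2)] linear_scale[OF lin(2)])
    show "X u (J v) = \<i> * X u v" for v
      by (simp add: X_def complex_eq_iff J(2) linear_neg[OF lin(2)])
  qed
  have ql: "q (\<lambda>v. a * F v + b * G v + c * H v) Y = a * q F Y + b * q G Y + c * q H Y"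
    and qr: "q Y (\<lambda>v. a * F v + b * G v + c * H v) = a * q Y F + b * q Y G + c * q Y H" for a b c F G H Y
    by (simp_all add: q_def algebra_simps)
  have "q (X u) (X v) = 0" for u v
  proof -
    have "X u = (\<lambda>v. X u (e 0) * z 0 v + X u (e 1) * z 1 v + X u (e 2) * z 2 v)" for u
      by (rule ext) (rule X)
    then have "q (X u) (X v) = q (\<lambda>v. X u (e 0) * z 0 v + X u (e 1) * z 1 v + X u (e 2) * z 2 v)
      (\<lambda>w. X v (e 0) * z 0 w + X v (e 1) * z 1 w + X v (e 2) * z 2 w)" by metis
    then show ?thesis by (simp only: ql qr q0 q0' mult_zero_right add_0_right)
  qed
  then have "Re (q (X u) (X v)) = 0" for u v by simp
  then have eq: "(\<omega> [u, J (p 0)] * \<omega> [v, J (p 1)] - \<omega> [u, J (p 1)] * \<omega> [v, J (p 0)])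
     + (\<omega> [u, J (p 2)] * \<omega> [v, J (p 3)] - \<omega> [u, J (p 3)] * \<omega> [v, J (p 2)])
     + (\<omega> [u, J (p 4)] * \<omega> [v, J (p 5)] - \<omega> [u, J (p 5)] * \<omega> [v, J (p 4)])
    = (\<omega> [u, p 0] * \<omega> [v, p 1] - \<omega> [u, p 1] * \<omega> [v, p 0])
     + (\<omega> [u, p 2] * \<omega> [v, p 3] - \<omega> [u, p 3] * \<omega> [v, p 2])
     + (\<omega> [u, p 4] * \<omega> [v, p 5] - \<omega> [u, p 5] * \<omega> [v, p 4])" for u v
    by (simp add: q_def X_def algebra_simps)
  have sw: "\<omega> [y, x] = - \<omega> [x, y]" for x y by (rule alt_form_2_swap[OF \<omega>])
  have ex: "\<omega> [u, w] = (\<omega> [u, p 0] * \<omega> [w, p 1] - \<omega> [u, p 1] * \<omega> [w, p 0])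
     + (\<omega> [u, p 2] * \<omega> [w, p 3] - \<omega> [u, p 3] * \<omega> [w, p 2])
     + (\<omega> [u, p 4] * \<omega> [w, p 5] - \<omega> [u, p 5] * \<omega> [w, p 4])" for u w
    by (subst darboux_expand[OF p, of w])
      (simp add: linear_add[OF lin(2)] linear_diff[OF lin(2)] linear_scale[OF lin(2)] mult.commute)
  \<comment> \<open>\<open>A\<close> is the adjoint of \<open>J\<close> with respect to \<omega>,
    written out in the Darboux basis. By \<open>eq\<close>, \<open>J (A v) = v\<close>, so
    \<open>A = -J\<close>, that is, \<open>J\<close> is skew for \<omega>.\<close>
  define A where "A v = \<omega> [v, J (p 1)] *\<^sub>R p 0 - \<omega> [v, J (p 0)] *\<^sub>R p 1 + \<omega> [v, J (p 3)] *\<^sub>R p 2 - \<omega> [v, J (p 2)] *\<^sub>R p 3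
     + \<omega> [v, J (p 5)] *\<^sub>R p 4 - \<omega> [v, J (p 4)] *\<^sub>R p 5" for v
  have A1: "\<omega> [A v, w] = \<omega> [v, J w]" for v w
  proof -
    have "\<omega> [v, J w] = \<omega> [w, p 1] * \<omega> [v, J (p 0)] - \<omega> [w, p 0] * \<omega> [v, J (p 1)]
      + \<omega> [w, p 3] * \<omega> [v, J (p 2)] - \<omega> [w, p 2] * \<omega> [v, J (p 3)]
      + \<omega> [w, p 5] * \<omega> [v, J (p 4)] - \<omega> [w, p 4] * \<omega> [v, J (p 5)]"
      by (subst darboux_expand[OF p, of w])
        (simp add: linear_add[OF J(1)] linear_diff[OF J(1)] linear_scale[OF J(1)]
          linear_add[OF lin(2)] linear_diff[OF lin(2)] linear_scale[OF lin(2)])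
    moreover have "\<omega> [A v, w] = \<omega> [v, J (p 1)] * \<omega> [p 0, w] - \<omega> [v, J (p 0)] * \<omega> [p 1, w]
      + \<omega> [v, J (p 3)] * \<omega> [p 2, w] - \<omega> [v, J (p 2)] * \<omega> [p 3, w]
      + \<omega> [v, J (p 5)] * \<omega> [p 4, w] - \<omega> [v, J (p 4)] * \<omega> [p 5, w]"
      by (simp add: A_def linear_add[OF lin(1)] linear_diff[OF lin(1)] linear_scale[OF lin(1)])
    ultimately show ?thesis
      using sw[of "p 0" w] sw[of "p 1" w] sw[of "p 2" w] sw[of "p 3" w] sw[of "p 4" w] sw[of "p 5" w]
      by (simp add: algebra_simps)
  qed
  have A2: "\<omega> [u, J (A v)] = \<omega> [u, v]" for u v
  proof -
    have "\<omega> [u, J (A v)] = (\<omega> [u, J (p 0)] * \<omega> [v, J (p 1)] - \<omega> [u, J (p 1)] * \<omega> [v, J (p 0)])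
     + (\<omega> [u, J (p 2)] * \<omega> [v, J (p 3)] - \<omega> [u, J (p 3)] * \<omega> [v, J (p 2)])
     + (\<omega> [u, J (p 4)] * \<omega> [v, J (p 5)] - \<omega> [u, J (p 5)] * \<omega> [v, J (p 4)])"
      by (simp add: A_def linear_add[OF J(1)] linear_diff[OF J(1)] linear_scale[OF J(1)]
          linear_add[OF lin(2)] linear_diff[OF lin(2)] linear_scale[OF lin(2)] algebra_simps)
    then show ?thesis unfolding eq ex[of u v, symmetric] .
  qed
  have nd: "x = y" if "\<And>u. \<omega> [u, x] = \<omega> [u, y]" for x y
  proof -
    have xs: "\<omega> [x, u] = \<omega> [y, u]" for u using that[of u] sw[of u x] sw[of u y] by simp
    show ?thesis by (subst darboux_expand[OF p, of x], subst darboux_expand[OF p, of y]) (simp only: xs)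
  qed
  have "J (A v) = v" for v by (rule nd) (rule A2)
  then have "J (J (A v)) = J v" for v by simp
  then have AJ: "A v = - J v" for v using J(2)[of "A v"] by (metis minus_minus)
  have "\<omega> [J x, w] = - \<omega> [x, J w]" for x w
    using A1[of x w] linear_neg[OF lin(1)] by (simp add: AJ)
  then show ?thesis by (simp add: J(2) linear_neg[OF lin(2)])
qed

section \<open>SU(3)-structures at a point\<close>

lemma alt_form_add: "alt_form k \<alpha> \<Longrightarrow> alt_form k \<beta> \<Longrightarrow> alt_form k (\<lambda>vs. \<alpha> vs + \<beta> vs)"
  unfolding alt_form_def by (auto intro: linear_compose_add)

lemma complex_frameD: "complex_frame J f \<Longrightarrow> f 1 = J (f 0)" "complex_frame J f \<Longrightarrow> f 3 = J (f 2)" "complex_frame J f \<Longrightarrow> f 5 = J (f 4)"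
  by (simp_all add: complex_frame_def)

text \<open>Hermitian Gram-Schmidt. By \<open>comp\<close>, the complement under \<omega> of a
  \<open>J\<close>-invariant subspace is \<open>J\<close>-invariant, so each step adds a normalized
  vector \<open>e\<close> together with \<open>J e\<close>; \<open>pos\<close> provides the
  norm.\<close>

lemma unitary_frame_exists:
  assumes \<omega>: "alt_form 2 \<omega>" and J: "linear J" "\<And>v. J (J v) = - v"
    and comp: "\<And>u v. \<omega> [J u, J v] = \<omega> [u, v]" and pos: "\<And>v. v \<noteq> 0 \<Longrightarrow> \<omega> [v, J v] > 0"
  obtains f where "darboux \<omega> f" "complex_frame J f"
proof -
  note lin = alt_form_2_bilinear[OF \<omega>]
  have unit: "\<exists>e. e \<noteq> 0 \<and> \<omega> [e, J e] = 1 \<and> (\<exists>c. e = c *\<^sub>R v)" if "v \<noteq> 0" for v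
  proof -
    let ?r = "sqrt (\<omega> [v, J v])"
    have r: "?r > 0" "?r * ?r = \<omega> [v, J v]" using pos[OF that] by simp_all
    have "\<omega> [(1 / ?r) *\<^sub>R v, J ((1 / ?r) *\<^sub>R v)] = \<omega> [v, J v] / (?r * ?r)"
      by (simp add: linear_scale[OF J(1)] linear_scale[OF lin(1)] linear_scale[OF lin(2)] del: real_sqrt_mult_self)
    also have "\<dots> = 1" unfolding r(2) using pos[OF that] by simp
    finally show ?thesis using r(1) that by (intro exI[of _ "(1 / ?r) *\<^sub>R v"]) auto
  qed
  have mv: "\<omega> [J u, v] = - \<omega> [u, J v]" for u v
    using comp[of u "J v"] linear_neg[OF lin(2)] by (simp add: J(2))
  have nz: "axis 1 1 \<noteq> (0 :: real^6)" by (simp add: axis_eq_0_iff)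
  obtain e0 where e0: "\<omega> [e0, J e0] = 1" using unit[OF nz] by blast
  have k1: "linear (\<lambda>v. \<omega> [u, v])" for u by (rule lin(2))
  obtain v1 where v1: "v1 \<noteq> 0" "\<omega> [e0, v1] = 0" "\<omega> [J e0, v1] = 0"
    by (rule common_kernel_nontrivial[of "[\<lambda>v. \<omega> [e0, v], \<lambda>v. \<omega> [J e0, v]]"]) (use k1 in auto)
  obtain e1 where e1: "\<omega> [e1, J e1] = 1" "\<omega> [e0, e1] = 0" "\<omega> [J e0, e1] = 0"
    using unit[OF v1(1)] v1(2,3) linear_scale[OF lin(2)] by auto
  obtain v2 where v2: "v2 \<noteq> 0" "\<omega> [e0, v2] = 0" "\<omega> [J e0, v2] = 0" "\<omega> [e1, v2] = 0" "\<omega> [J e1, v2] = 0"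
    by (rule common_kernel_nontrivial[of "[\<lambda>v. \<omega> [e0, v], \<lambda>v. \<omega> [J e0, v], \<lambda>v. \<omega> [e1, v], \<lambda>v. \<omega> [J e1, v]]"])
      (use k1 in auto)
  obtain e2 where e2: "\<omega> [e2, J e2] = 1" "\<omega> [e0, e2] = 0" "\<omega> [J e0, e2] = 0" "\<omega> [e1, e2] = 0" "\<omega> [J e1, e2] = 0"
    using unit[OF v2(1)] v2(2-5) linear_scale[OF lin(2)] by auto
  define f where "f i = [e0, J e0, e1, J e1, e2, J e2] ! i" for i
  have "\<omega> [e0, J e1] = 0" "\<omega> [e0, J e2] = 0" "\<omega> [e1, J e2] = 0"
    using e1(3) e2(3,5) unfolding mv by simp_all
  then have "darboux \<omega> f"
    unfolding darboux_def all_less_6_pairs using \<omega> e0 e1 e2 by (simp add: f_def comp)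
  moreover have "complex_frame J f" by (simp add: complex_frame_def f_def)
  ultimately show thesis by (rule that)
qed

text \<open>A symplectic frame that is adapted to \<open>J\<close> is unitary.\<close>

locale su3_frame =
  fixes \<omega> \<phi> \<psi> :: "real form" and J :: "real^6 \<Rightarrow> real^6" and f :: "nat \<Rightarrow> real^6"
  assumes J: "linear J" "J (J v) = - v"
    and holo: "holo3 J \<phi> \<psi>"
    and comp: "\<omega> [J u, J v] = \<omega> [u, v]"
    and darb: "darboux \<omega> f"
    and frame: "complex_frame J f"
begin

lemma \<omega>_alt: "alt_form 2 \<omega>" using darb by (simp add: darboux_def)
lemmas \<omega>_lin = alt_form_2_bilinear[OF \<omega>_alt]
lemmas frameD = complex_frameD[OF frame]

lemma \<omega>_sw: "\<omega> [v, u] = - \<omega> [u, v]" by (rule alt_form_2_swap[OF \<omega>_alt])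

lemma \<omega>_J: "\<omega> [J u, v] = - \<omega> [u, J v]"
  using comp[of u "J v"] linear_neg[OF \<omega>_lin(2)] by (simp add: J(2))

lemma onb_frame: "onb (\<lambda>u v. \<omega> [u, J v]) f"
  unfolding onb_def
proof (intro conjI allI)
  show "linear (\<lambda>w. \<omega> [v, J w])" for v
    using linear_compose[OF J(1) \<omega>_lin(2)] by (simp add: o_def)
  show "v = (\<Sum>m<6. \<omega> [v, J (f m)] *\<^sub>R f m)" for v
  proof -
    have e: "(\<Sum>m<6. \<omega> [v, J (f m)] *\<^sub>R f m) = \<omega> [v, f 1] *\<^sub>R f 0 - \<omega> [v, f 0] *\<^sub>R f 1 + \<omega> [v, f 3] *\<^sub>R f 2
      - \<omega> [v, f 2] *\<^sub>R f 3 + \<omega> [v, f 5] *\<^sub>R f 4 - \<omega> [v, f 4] *\<^sub>R f 5"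
      unfolding sum_lessThan_6 by (simp add: frameD J linear_neg[OF \<omega>_lin(2)])
    show ?thesis unfolding e by (rule darboux_expand[OF darb])
  qed
qed

text \<open>Real and imaginary part are the coefficients of \<open>f (2 * k)\<close> and
  \<open>f (2 * k + 1) = J (f (2 * k))\<close> in \<open>darboux_expand\<close>.\<close>

definition z :: "nat \<Rightarrow> real^6 \<Rightarrow> complex" where
  "z k v = Complex (\<omega> [v, f (2 * k + 1)]) (- \<omega> [v, f (2 * k)])"

lemma z_values:
  "z 0 v = Complex (\<omega> [v, f 1]) (- \<omega> [v, f 0])" "z 1 v = Complex (\<omega> [v, f 3]) (- \<omega> [v, f 2])"
  "z 2 v = Complex (\<omega> [v, f 5]) (- \<omega> [v, f 4])"
  by (simp_all add: z_def)

lemma coords_z: "coords J z (\<lambda>k. f (2 * k))"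
  unfolding coords_def
proof (intro conjI allI impI)
  show "linear (z k)" for k
    by (rule linearI) (simp_all add: z_def complex_eq_iff linear_add[OF \<omega>_lin(1)] linear_scale[OF \<omega>_lin(1)])
  have k3: "k = 0 \<or> k = 1 \<or> k = 2" if "k < 3" for k :: nat using that by auto
  show "z k (J v) = \<i> * z k v" if "k < 3" for k v
    using k3[OF that]
    by (elim disjE) (simp_all add: z_values complex_eq_iff \<omega>_J frameD J linear_neg[OF \<omega>_lin(2)])
  show "z k (f (2 * l)) = (if k = l then 1 else 0)" if kl: "k < 3" "l < 3" for k l
    using k3[OF kl(1)] k3[OF kl(2)]
    by (elim disjE)
      (simp_all add: z_values complex_eq_iff darboux_values[OF darb] \<omega>_sw[of "f 2" "f 0"] \<omega>_sw[of "f 2" "f 1"]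
        \<omega>_sw[of "f 4" "f 0"] \<omega>_sw[of "f 4" "f 1"] \<omega>_sw[of "f 4" "f 2"] \<omega>_sw[of "f 4" "f 3"]
        alt_form_not_distinct[OF \<omega>_alt])
  show "v = (\<Sum>k<3. Re (z k v) *\<^sub>R f (2 * k) + Im (z k v) *\<^sub>R J (f (2 * k)))" for v
  proof -
    have e: "(\<Sum>k<3. Re (z k v) *\<^sub>R f (2 * k) + Im (z k v) *\<^sub>R J (f (2 * k))) =
      \<omega> [v, f 1] *\<^sub>R f 0 - \<omega> [v, f 0] *\<^sub>R f 1 + \<omega> [v, f 3] *\<^sub>R f 2 - \<omega> [v, f 2] *\<^sub>R f 3
           + \<omega> [v, f 5] *\<^sub>R f 4 - \<omega> [v, f 4] *\<^sub>R f 5"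
      unfolding lessThan_numerals by (simp add: z_values frameD)
    show ?thesis unfolding e by (rule darboux_expand[OF darb])
  qed
  show "linear J" by (rule J(1))
  show "J (J v) = - v" for v by (rule J(2))
qed

lemma \<Omega>_det: "Complex (\<phi> [u, v, w]) (\<psi> [u, v, w]) = Complex (\<phi> [f 0, f 2, f 4]) (\<psi> [f 0, f 2, f 4]) * det3 z u v w"
proof -
  have 4: "2 * 2 = (4::nat)" by simp
  show ?thesis
    using holo3_det[OF coords_z holo, of u v w] by (simp only: mult_zero_right mult_1_right 4)
qed

lemma \<omega>_coords: "\<omega> [u, v] = Im (cnj (z 0 u) * z 0 v + cnj (z 1 u) * z 1 v + cnj (z 2 u) * z 2 v)"
  by (subst darboux_expand[OF darb, of v])
    (simp add: linear_add[OF \<omega>_lin(2)] linear_diff[OF \<omega>_lin(2)] linear_scale[OF \<omega>_lin(2)] z_values)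

end

text \<open>The value of \<omega> \<and> \<psi> on five vectors, as a signed sum over the ten
  shuffles. As an explicit polynomial it can be differentiated term by term.\<close>

definition wedge5 :: "real form \<Rightarrow> real form \<Rightarrow> real^6 \<Rightarrow> real^6 \<Rightarrow> real^6 \<Rightarrow> real^6 \<Rightarrow> real^6 \<Rightarrow> real" where
  "wedge5 \<omega> \<psi> a b c d e =
     \<omega> [a, b] * \<psi> [c, d, e] - \<omega> [a, c] * \<psi> [b, d, e] + \<omega> [a, d] * \<psi> [b, c, e] - \<omega> [a, e] * \<psi> [b, c, d]
   + \<omega> [b, c] * \<psi> [a, d, e] - \<omega> [b, d] * \<psi> [a, c, e] + \<omega> [b, e] * \<psi> [a, c, d]
   + \<omega> [c, d] * \<psi> [a, b, e] - \<omega> [c, e] * \<psi> [a, b, d] + \<omega> [d, e] * \<psi> [a, b, c]"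

text \<open>Expansion of the 4 by 4 determinant with rows \<open>z k\<close>, \<open>z 0\<close>,
  \<open>z 1\<close>, \<open>z 2\<close>, in which a row is repeated.\<close>

lemma det3_relation:
  assumes "k = 0 \<or> k = 1 \<or> k = (2::nat)"
  shows "z k b * det3 z c d e - z k c * det3 z b d e + z k d * det3 z b c e - z k e * det3 z b c d = 0"
  using assms by (elim disjE) (simp_all add: det3_def algebra_simps)

text \<open>Contracting the preceding relation with \<open>z\<^sub>k(a)\<close> conjugate and antisymmetrizing shows that a \<open>(1,1)\<close>-form
  and a \<open>(3,0)\<close>-form have wedge product \<open>0\<close>.\<close>

lemma (in su3_frame) wedge5_\<omega>_\<psi>: "wedge5 \<omega> \<psi> a b c d e = 0"
proof -
  define h where "h u v = cnj (z 0 u) * z 0 v + cnj (z 1 u) * z 1 v + cnj (z 2 u) * z 2 v" for u v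
  define D where "D = det3 z"
  have E: "h a b * D c d e - h a c * D b d e + h a d * D b c e - h a e * D b c d = 0" for a b c d e
  proof -
    have "h a b * D c d e - h a c * D b d e + h a d * D b c e - h a e * D b c d =
      cnj (z 0 a) * (z 0 b * D c d e - z 0 c * D b d e + z 0 d * D b c e - z 0 e * D b c d)
      + cnj (z 1 a) * (z 1 b * D c d e - z 1 c * D b d e + z 1 d * D b c e - z 1 e * D b c d)
      + cnj (z 2 a) * (z 2 b * D c d e - z 2 c * D b d e + z 2 d * D b c e - z 2 e * D b c d)"
      by (simp add: h_def algebra_simps)
    then show ?thesis unfolding D_def by (simp add: det3_relation)
  qed
  have w: "complex_of_real (\<omega> [u, v]) = - \<i> / 2 * (h u v - h v u)" for u v
    by (simp add: \<omega>_coords h_def complex_eq_iff field_simps)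
  have "complex_of_real (\<omega> [a, b]) * D c d e - \<omega> [a, c] * D b d e + \<omega> [a, d] * D b c e - \<omega> [a, e] * D b c d
   + \<omega> [b, c] * D a d e - \<omega> [b, d] * D a c e + \<omega> [b, e] * D a c d
   + \<omega> [c, d] * D a b e - \<omega> [c, e] * D a b d + \<omega> [d, e] * D a b c
   = - \<i> / 2 * ((h a b * D c d e - h a c * D b d e + h a d * D b c e - h a e * D b c d)
     - (h b a * D c d e - h b c * D a d e + h b d * D a c e - h b e * D a c d)
     + (h c a * D b d e - h c b * D a d e + h c d * D a b e - h c e * D a b d)
     - (h d a * D b c e - h d b * D a c e + h d c * D a b e - h d e * D a b c)
     + (h e a * D b c d - h e b * D a c d + h e c * D a b d - h e d * D a b c))"
    unfolding w by (simp add: algebra_simps)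
  also have "\<dots> = 0" unfolding E by simp
  finally have 0: "complex_of_real (\<omega> [a, b]) * D c d e - \<omega> [a, c] * D b d e + \<omega> [a, d] * D b c e - \<omega> [a, e] * D b c d
   + \<omega> [b, c] * D a d e - \<omega> [b, d] * D a c e + \<omega> [b, e] * D a c d
   + \<omega> [c, d] * D a b e - \<omega> [c, e] * D a b d + \<omega> [d, e] * D a b c = 0" .
  define q where "q = Complex (\<phi> [f 0, f 2, f 4]) (\<psi> [f 0, f 2, f 4])"
  have p: "\<psi> [u, v, w] = Im (q * D u v w)" for u v w
    using arg_cong[OF \<Omega>_det[of u v w, folded q_def D_def], of Im] by simp
  have "wedge5 \<omega> \<psi> a b c d e = Im (q * (complex_of_real (\<omega> [a, b]) * D c d e - \<omega> [a, c] * D b d e + \<omega> [a, d] * D b c e - \<omega> [a, e] * D b c d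
   + \<omega> [b, c] * D a d e - \<omega> [b, d] * D a c e + \<omega> [b, e] * D a c d
   + \<omega> [c, d] * D a b e - \<omega> [c, e] * D a b d + \<omega> [d, e] * D a b c))"
    unfolding wedge5_def p by (simp add: algebra_simps)
  then show ?thesis unfolding 0 by simp
qed

text \<open>The bilinear form \<open>B(X, Y) = \<omega>\<^sup>a\<^sup>b \<omega>\<^sup>c\<^sup>d \<phi>(X, a, c) \<phi>(Y, b, d)\<close> is a negative multiple of \<open>g\<^sub>\<phi>\<close>; raising
  an index gives a multiple of \<open>J\<close>, with the factor determined by \<open>J\<^sup>2 = -1\<close>. This expresses \<open>J\<close>
  by arithmetic operations and a square root in \<open>\<omega>\<close> and \<open>\<phi>\<close>.\<close>

definition omega_inv :: "real form \<Rightarrow> real^6^6" where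
  "omega_inv \<omega> = matrix_inv (\<chi> i j. \<omega> [axis i 1, axis j 1])"

definition B_form :: "real form \<Rightarrow> real form \<Rightarrow> real^6 \<Rightarrow> real^6 \<Rightarrow> real" where
  "B_form \<omega> \<phi> X Y = (\<Sum>a\<in>UNIV. \<Sum>b\<in>UNIV. omega_inv \<omega> $ b $ a * (\<Sum>c\<in>UNIV. \<Sum>d\<in>UNIV. omega_inv \<omega> $ d $ c *
     (\<phi> [X, axis a 1, axis c 1] * \<phi> [Y, axis b 1, axis d 1])))"

definition K_op :: "real form \<Rightarrow> real form \<Rightarrow> real^6 \<Rightarrow> real^6" where
  "K_op \<omega> \<phi> Y = (\<chi> b. \<Sum>a\<in>UNIV. omega_inv \<omega> $ b $ a * B_form \<omega> \<phi> (axis a 1) Y)"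

locale su3_point = su3_frame +
  assumes nonzero: "Complex (\<phi> [f 0, f 2, f 4]) (\<psi> [f 0, f 2, f 4]) \<noteq> 0"
begin

lemma \<phi>_alt: "alt_form 3 \<phi>" and \<psi>_alt: "alt_form 3 \<psi>"
  using holo by (auto simp: holo3_def)

lemma bilinear_product:
  "linear (\<lambda>s. \<phi> [X, u, s] * c)" "linear (\<lambda>s. c * \<phi> [X, u, s])" "linear (\<lambda>s. \<phi> [X, s, u] * c)" "linear (\<lambda>s. c * \<phi> [X, s, u])"
  by (rule linearI; simp add: linear_add[OF alt_form_3_linear(2)[OF \<phi>_alt]] linear_scale[OF alt_form_3_linear(2)[OF \<phi>_alt]]
      linear_add[OF alt_form_3_linear(3)[OF \<phi>_alt]] linear_scale[OF alt_form_3_linear(3)[OF \<phi>_alt]] algebra_simps)+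

text \<open>By the rules for \<open>J\<close>, the contraction reduces to products over unordered
  pairs of the vectors \<open>f 0, f 2, f 4\<close>. Each pair occurs four times, from its two
  orders and the antisymmetry of the bivector, always with a minus sign. Its entries are the
  coordinates \<open>z k X\<close> and \<open>z k Y\<close> times the value of \<Omega> on
  \<open>f 0, f 2, f 4\<close>.\<close>

lemma B_form_eq:
  "B_form \<omega> \<phi> X Y = - 4 * ((\<phi> [f 0, f 2, f 4])\<^sup>2 + (\<psi> [f 0, f 2, f 4])\<^sup>2) * \<omega> [X, J Y]"
proof -
  define C2 where "C2 u v = (\<phi> [X, u, f 0] * \<phi> [Y, v, f 1] - \<phi> [X, u, f 1] * \<phi> [Y, v, f 0])
     + (\<phi> [X, u, f 2] * \<phi> [Y, v, f 3] - \<phi> [X, u, f 3] * \<phi> [Y, v, f 2])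
     + (\<phi> [X, u, f 4] * \<phi> [Y, v, f 5] - \<phi> [X, u, f 5] * \<phi> [Y, v, f 4])" for u v
  have 1: "(\<Sum>c\<in>UNIV. \<Sum>d\<in>UNIV. omega_inv \<omega> $ d $ c * (\<phi> [X, u, axis c 1] * \<phi> [Y, v, axis d 1])) = C2 u v" for u v
    unfolding omega_inv_def C2_def by (rule bilinear_contraction_darboux[OF darb]) (rule bilinear_product)+
  have 2: "linear (\<lambda>u. C2 u v)" "linear (C2 u)" for u v
    unfolding C2_def by (intro linear_compose_add linear_compose_sub bilinear_product)+
  have B: "B_form \<omega> \<phi> X Y = (C2 (f 0) (f 1) - C2 (f 1) (f 0)) + (C2 (f 2) (f 3) - C2 (f 3) (f 2))
      + (C2 (f 4) (f 5) - C2 (f 5) (f 4))"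
    unfolding B_form_def 1 unfolding omega_inv_def by (rule bilinear_contraction_darboux[OF darb 2])
  note sw = alt_form_3_swap(2)[OF \<phi>_alt] and sw' = alt_form_3_swap(2)[OF \<psi>_alt]
  define x where "x = \<phi> [f 0, f 2, f 4]"
  define y where "y = \<psi> [f 0, f 2, f 4]"
  have "B_form \<omega> \<phi> X Y = - 4 * (\<phi> [X, f 0, f 2] * \<phi> [Y, f 0, f 2] + \<psi> [X, f 0, f 2] * \<psi> [Y, f 0, f 2]
     + \<phi> [X, f 0, f 4] * \<phi> [Y, f 0, f 4] + \<psi> [X, f 0, f 4] * \<psi> [Y, f 0, f 4]
     + \<phi> [X, f 2, f 4] * \<phi> [Y, f 2, f 4] + \<psi> [X, f 2, f 4] * \<psi> [Y, f 2, f 4])"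
    unfolding B C2_def frameD
    by (simp add: holo3D[OF holo] alt_form_3_repeat[OF \<phi>_alt] alt_form_3_repeat[OF \<psi>_alt]
       sw[of X "f 2" "f 0"] sw[of X "f 4" "f 0"] sw[of X "f 4" "f 2"] sw[of Y "f 2" "f 0"] sw[of Y "f 4" "f 0"] sw[of Y "f 4" "f 2"]
       sw'[of X "f 2" "f 0"] sw'[of X "f 4" "f 0"] sw'[of X "f 4" "f 2"] sw'[of Y "f 2" "f 0"] sw'[of Y "f 4" "f 0"] sw'[of Y "f 4" "f 2"])
  moreover have v: "\<phi> [X, f 0, f 2] = Re (Complex x y * z 2 X)" "\<psi> [X, f 0, f 2] = Im (Complex x y * z 2 X)"
      "\<phi> [X, f 0, f 4] = - Re (Complex x y * z 1 X)" "\<psi> [X, f 0, f 4] = - Im (Complex x y * z 1 X)"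
      "\<phi> [X, f 2, f 4] = Re (Complex x y * z 0 X)" "\<psi> [X, f 2, f 4] = Im (Complex x y * z 0 X)" for X
    using \<Omega>_det[of X "f 0" "f 2", folded x_def y_def] \<Omega>_det[of X "f 0" "f 4", folded x_def y_def]
      \<Omega>_det[of X "f 2" "f 4", folded x_def y_def] coordsD(9-17)[OF coords_z, simplified]
    by (simp_all add: det3_def complex_eq_iff)
  moreover have "\<omega> [X, J Y] = Re (cnj (z 0 X) * z 0 Y + cnj (z 1 X) * z 1 Y + cnj (z 2 X) * z 2 Y)"
    by (subst \<omega>_coords) (simp add: coordsD(6-8)[OF coords_z])
  ultimately show ?thesis unfolding x_def[symmetric] y_def[symmetric]
    by (simp add: power2_eq_square algebra_simps)
qed

lemma K_op_eq: "K_op \<omega> \<phi> Y = (- 4 * ((\<phi> [f 0, f 2, f 4])\<^sup>2 + (\<psi> [f 0, f 2, f 4])\<^sup>2)) *\<^sub>R J Y"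
proof -
  let ?W = "(\<chi> i j. \<omega> [axis i 1, axis j 1]) :: real^6^6"
  have "?W ** omega_inv \<omega> = mat 1" unfolding omega_inv_def by (rule matrix_inv_darboux(2)[OF darb])
  then have inv: "omega_inv \<omega> ** ?W = mat 1" by (simp add: matrix_left_right_inverse)
  have Wv: "?W *v w = (\<chi> a. \<omega> [axis a 1, w])" for w
    using linear_expand_axis[OF \<omega>_lin(2), of _ w] by (simp add: vec_eq_iff matrix_vector_mult_def mult.commute)
  have a: "(\<Sum>a\<in>UNIV. omega_inv \<omega> $ b $ a * \<omega> [axis a 1, w]) = w $ b" for w b
  proof -
    have "omega_inv \<omega> *v (?W *v w) = w" using inv by (simp add: matrix_vector_mul_assoc)
    from arg_cong[OF this, of "\<lambda>v. v $ b"] show ?thesis unfolding Wv by (simp add: matrix_vector_mult_def)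
  qed
  define c where "c = - 4 * ((\<phi> [f 0, f 2, f 4])\<^sup>2 + (\<psi> [f 0, f 2, f 4])\<^sup>2)"
  have "K_op \<omega> \<phi> Y $ b = (c *\<^sub>R J Y) $ b" for b
  proof -
    have "K_op \<omega> \<phi> Y $ b = c * (\<Sum>a\<in>UNIV. omega_inv \<omega> $ b $ a * \<omega> [axis a 1, J Y])"
      unfolding K_op_def B_form_eq c_def[symmetric] by (simp add: sum_distrib_left mult.left_commute)
    then show ?thesis unfolding a by simp
  qed
  then show ?thesis unfolding c_def[symmetric] by (simp add: vec_eq_iff)
qed

text \<open>\<open>K_op\<close> is \<open>c\<close> times \<open>J\<close> with
  \<open>c < 0\<close>, so its square is minus \<open>c\<close> squared, and one diagonal entry of
  that square recovers \<open>c\<close>. No frame occurs in the formula, so it can be differentiated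
  in the base point.\<close>

lemma J_formula:
  "J Y = - (1 / sqrt (- (K_op \<omega> \<phi> (K_op \<omega> \<phi> (axis 1 1)) $ 1))) *\<^sub>R K_op \<omega> \<phi> Y"
  "- (K_op \<omega> \<phi> (K_op \<omega> \<phi> (axis 1 1)) $ 1) > 0"
proof -
  define c where "c = - 4 * ((\<phi> [f 0, f 2, f 4])\<^sup>2 + (\<psi> [f 0, f 2, f 4])\<^sup>2)"
  have "(\<phi> [f 0, f 2, f 4])\<^sup>2 + (\<psi> [f 0, f 2, f 4])\<^sup>2 > 0"
    using nonzero unfolding sum_power2_gt_zero_iff by (auto simp: complex_eq_iff)
  then have c: "c < 0" unfolding c_def by (intro mult_neg_pos) simp_all
  have K: "K_op \<omega> \<phi> Y = c *\<^sub>R J Y" for Y unfolding c_def by (rule K_op_eq)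
  have "K_op \<omega> \<phi> (K_op \<omega> \<phi> (axis 1 1)) = - (c\<^sup>2) *\<^sub>R axis 1 1"
    unfolding K linear_scale[OF J(1)] J(2) by (simp add: power2_eq_square)
  then have e: "- (K_op \<omega> \<phi> (K_op \<omega> \<phi> (axis 1 1)) $ 1) = c\<^sup>2" by simp
  show "- (K_op \<omega> \<phi> (K_op \<omega> \<phi> (axis 1 1)) $ 1) > 0" unfolding e using c by simp
  show "J Y = - (1 / sqrt (- (K_op \<omega> \<phi> (K_op \<omega> \<phi> (axis 1 1)) $ 1))) *\<^sub>R K_op \<omega> \<phi> Y"
    unfolding e unfolding K using c by simp
qed

lemma star_3: "hodge_star (\<lambda>u v. \<omega> [u, J v]) (omega_cubed \<omega>) 3 \<phi> = \<psi>"
proof (rule hodge_star_eqI[OF onb_frame alt_form_omega_cubed[OF \<omega>_alt] _ \<phi>_alt])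
  show "omega_cubed \<omega> (map f [0..<6]) > 0"
    by (rule omega_cubed_darboux[OF \<omega>_alt]) (use darb in \<open>auto simp: darboux_def\<close>)
  show "of_int (sign \<sigma>) * \<psi> (map (\<lambda>i. f (\<sigma> i)) [3..<6]) = \<phi> (map (\<lambda>i. f (\<sigma> i)) [0..<3])"
    if "\<sigma> permutes {..<6}" for \<sigma>
    by (rule holo3_dual[OF holo frame that])
  have 3: "6 - 3 = (3::nat)" by simp
  show "alt_form (6 - 3) \<psi>" unfolding 3 by (rule \<psi>_alt)
  show "3 \<le> (6::nat)" by simp
qed

lemma star_4:
  assumes \<beta>: "alt_form 4 \<beta>" and type: "\<And>v X Y. \<beta> [v, J v, J X, J Y] = \<beta> [v, J v, X, Y]"
    and prim: "\<beta> [f 0, f 1, f 2, f 3] + \<beta> [f 0, f 1, f 4, f 5] + \<beta> [f 2, f 3, f 4, f 5] = 0"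
  shows "hodge_star (\<lambda>u v. \<omega> [u, J v]) (omega_cubed \<omega>) 4 \<beta> = (\<lambda>vs. - contraction \<omega> \<beta> vs)"
proof -
  have con: "contraction \<omega> \<beta> vs = \<beta> ([f 0, f 1] @ vs) + \<beta> ([f 2, f 3] @ vs) + \<beta> ([f 4, f 5] @ vs)" for vs
  proof (cases "length vs = 2")
    case True
    have 4: "Suc (Suc 2) = 4" by simp
    have "alt_form (Suc (Suc 2)) \<beta>" unfolding 4 by (rule \<beta>)
    from contraction_darboux[OF darb this True] show ?thesis by simp
  next
    case False
    then show ?thesis using alt_form_length[OF \<beta>] by (simp add: contraction_def)
  qed
  have a: "alt_form 2 (\<lambda>vs. \<beta> ([f i, f j] @ vs))" for i j
    by (rule alt_form_suffix[where k = 2]) (use \<beta> in simp_all)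
  have c_alt: "alt_form 2 (\<lambda>vs. - contraction \<omega> \<beta> vs)"
    unfolding con using alt_form_scale[OF alt_form_add[OF alt_form_add[OF a a] a], of "- 1"] by simp
  show ?thesis
  proof (rule hodge_star_eqI[OF onb_frame alt_form_omega_cubed[OF \<omega>_alt] _ \<beta>])
    show "omega_cubed \<omega> (map f [0..<6]) > 0"
      by (rule omega_cubed_darboux[OF \<omega>_alt]) (use darb in \<open>auto simp: darboux_def\<close>)
    show "of_int (sign \<sigma>) * - contraction \<omega> \<beta> (map (\<lambda>i. f (\<sigma> i)) [4..<6]) = \<beta> (map (\<lambda>i. f (\<sigma> i)) [0..<4])"
      if \<sigma>: "\<sigma> permutes {..<6}" for \<sigma>
    proof (rule primitive_22_dual[OF \<beta> frame J(2) type prim _ \<sigma>, of "\<lambda>vs. - contraction \<omega> \<beta> vs"])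
      show "- contraction \<omega> \<beta> [u, v] = - (\<beta> [f 0, f 1, u, v] + \<beta> [f 2, f 3, u, v] + \<beta> [f 4, f 5, u, v])" for u v
        unfolding con by simp
    qed
    have 4: "6 - 4 = (2::nat)" by simp
    show "alt_form (6 - 4) (\<lambda>vs. - contraction \<omega> \<beta> vs)" unfolding 4 by (rule c_alt)
    show "4 \<le> (6::nat)" by simp
  qed
qed

end

text \<open>Positivity yields an almost complex structure up to sign and orientation selects the
  sign, so \<open>acs\<close> has its defining property. Primitivity then gives compatibility with
  \<omega>, and the positive metric a unitary frame.\<close>

lemma su3_point_acs:
  assumes \<omega>: "alt_form 2 \<omega>" "nondegenerate \<omega>" and \<phi>: "alt_form 3 \<phi>" "positive_3form \<phi>"
    and prim: "\<And>v. contraction \<omega> \<phi> [v] = 0" and pos: "\<And>v. v \<noteq> 0 \<Longrightarrow> metric \<omega> \<phi> v v > 0"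
  obtains f where "su3_point \<omega> \<phi> (hat \<omega> \<phi>) (acs \<omega> \<phi>) f"
proof -
  obtain \<theta>1 \<theta>2 \<theta>3 :: "complex form" where \<theta>: "alt_form 1 \<theta>1" "alt_form 1 \<theta>2" "alt_form 1 \<theta>3"
      and ind: "\<And>a1 a2 a3 b1 b2 b3 :: complex.
           (\<forall>v. a1 * \<theta>1 [v] + a2 * \<theta>2 [v] + a3 * \<theta>3 [v]
              + b1 * cnj (\<theta>1 [v]) + b2 * cnj (\<theta>2 [v]) + b3 * cnj (\<theta>3 [v]) = 0) \<Longrightarrow>
           a1 = 0 \<and> a2 = 0 \<and> a3 = 0 \<and> b1 = 0 \<and> b2 = 0 \<and> b3 = 0"
      and \<phi>_eq: "\<phi> = (\<lambda>vs. Re (wedge 2 1 (wedge 1 1 \<theta>1 \<theta>2) \<theta>3 vs))"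
    using \<phi>(2) unfolding positive_3form_def by blast
  define z where "z k v = ([\<theta>1, \<theta>2, \<theta>3] ! k) [v]" for k v
  have zv: "z 0 v = \<theta>1 [v]" "z 1 v = \<theta>2 [v]" "z 2 v = \<theta>3 [v]" for v by (simp_all add: z_def)
  have lin: "linear (z 0)" "linear (z 1)" "linear (z 2)"
    using alt_form_linear[OF \<theta>(1), of "[0]" 0] alt_form_linear[OF \<theta>(2), of "[0]" 0] alt_form_linear[OF \<theta>(3), of "[0]" 0]
    by (simp_all add: z_def[abs_def])
  obtain J e where c: "coords J z e"
  proof (rule coords_from_independent[OF lin])
    fix a1 a2 a3 b1 b2 b3 :: complex
    assume "\<And>v. a1 * z 0 v + a2 * z 1 v + a3 * z 2 v + b1 * cnj (z 0 v) + b2 * cnj (z 1 v) + b3 * cnj (z 2 v) = 0"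
    then show "a1 = 0 \<and> a2 = 0 \<and> a3 = 0" using ind[of a1 a2 a3 b1 b2 b3] unfolding zv by blast
  qed
  have det: "\<phi> [u, v, w] = Re (det3 z u v w)" for u v w
    using wedge_1_1_1[of "\<lambda>k. [\<theta>1, \<theta>2, \<theta>3] ! k" u v w] unfolding z_def[abs_def] \<phi>_eq by simp
  have "\<exists>K. induces_acs \<omega> \<phi> K" using induces_acs_exists[OF c \<phi>(1) det \<omega>] by blast
  then have "\<exists>!K. induces_acs \<omega> \<phi> K" using acs_unique[OF c \<phi>(1) det \<omega>] by blast
  then have ia: "induces_acs \<omega> \<phi> (acs \<omega> \<phi>)" unfolding acs_def by (rule theI')
  let ?J = "acs \<omega> \<phi>"
  have hat: "(\<lambda>vs. \<phi> (map ?J vs)) = hat \<omega> \<phi>" by (rule ext) (simp add: hat_def)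
  note J' = ia[unfolded induces_acs_iff[OF \<phi>(1)], unfolded hat]
  obtain p where p: "darboux \<omega> p" using darboux_exists[OF \<omega>] .
  have prim': "\<phi> [p 0, p 1, v] + \<phi> [p 2, p 3, v] + \<phi> [p 4, p 5, v] = 0" for v
  proof -
    have 3: "Suc (Suc 1) = 3" by arith
    have "alt_form (Suc (Suc 1)) \<phi>" unfolding 3 by (rule \<phi>(1))
    from contraction_darboux[OF p this, of "[v]"] show ?thesis using prim[of v] by simp
  qed
  note comp0 = compatible[OF p c det prim']
  \<comment> \<open>Compatibility was proved for the \<open>J\<close> of the coordinates;
    \<open>acs\<close> may be its negative, which leaves \<open>\<omega> [J u, J v]\<close>
    unchanged.\<close>
  have JJ: "?J = J \<or> ?J = (\<lambda>v. - J v)"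
    by (rule holo3_unique_up_to_sign[OF c det]) (use J' in blast)+
  have comp: "\<omega> [?J u, ?J v] = \<omega> [u, v]" for u v
    using JJ comp0 linear_neg[OF alt_form_2_bilinear(1)[OF \<omega>(1)]] linear_neg[OF alt_form_2_bilinear(2)[OF \<omega>(1)]] by auto
  obtain f where f: "darboux \<omega> f" "complex_frame ?J f"
    by (rule unitary_frame_exists[OF \<omega>(1), of ?J]) (use J' comp pos in \<open>auto simp: metric_def\<close>)
  interpret su3_frame \<omega> \<phi> "hat \<omega> \<phi>" ?J f
    by (rule su3_frame.intro) (use J' comp f in auto)
  have "Complex (\<phi> [f 0, f 2, f 4]) (hat \<omega> \<phi> [f 0, f 2, f 4]) \<noteq> 0"
  proof
    assume 0: "Complex (\<phi> [f 0, f 2, f 4]) (hat \<omega> \<phi> [f 0, f 2, f 4]) = 0"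
    obtain vs where vs: "\<phi> vs \<noteq> 0" using J' by blast
    then have "length vs = 3" using alt_form_length[OF \<phi>(1)] by blast
    then obtain u v w where "vs = [u, v, w]" by (auto simp: numeral_3_eq_3 length_Suc_conv)
    then show False using \<Omega>_det[of u v w] vs unfolding 0 by (simp add: complex_eq_iff)
  qed
  then show thesis by (intro that[of f] su3_point.intro su3_point_axioms.intro su3_frame_axioms)
qed

section \<open>First derivatives\<close>

lemma length_3_conv: "length vs = 3 \<Longrightarrow> \<exists>a b c. vs = [a, b, c]"
  by (auto simp: numeral_eq_Suc length_Suc_conv)

lemma length_4_conv: "length vs = 4 \<Longrightarrow> \<exists>a b c d. vs = [a, b, c, d]"
  by (auto simp: numeral_eq_Suc length_Suc_conv)

lemma smooth_on_differentiable:
  assumes "smooth_on S f" "open S" "x \<in> S"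
  shows "f differentiable (at x)"
proof -
  have "Ck_on (Suc 0) S f" using assms(1) unfolding smooth_on_def by blast
  then obtain f' where "(f has_derivative f' x) (at x within S)" using assms(3) by auto
  then show ?thesis using at_within_open[OF assms(3,2)] by (auto simp: differentiable_def)
qed

lemma has_derivative_cong_open:
  assumes "open S" "x \<in> S" "\<And>y. y \<in> S \<Longrightarrow> f y = g y"
  shows "(f has_derivative D) (at x) \<longleftrightarrow> (g has_derivative D) (at x)"
  using has_derivative_transform_within_open[of f D x UNIV S g] has_derivative_transform_within_open[of g D x UNIV S f] assms
  by auto

lemma frechet_derivative_cong_open:
  assumes "open S" "x \<in> S" "\<And>y. y \<in> S \<Longrightarrow> f y = g y"
  shows "frechet_derivative f (at x) = frechet_derivative g (at x)"
proof -
  have "(f has_derivative D) (at x) = (g has_derivative D) (at x)" for D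
    by (rule has_derivative_cong_open[OF assms])
  then show ?thesis by (simp add: frechet_derivative_def)
qed

lemma differentiable_cong_open:
  assumes "open S" "x \<in> S" "\<And>y. y \<in> S \<Longrightarrow> f y = g y" "g differentiable (at x)"
  shows "f differentiable (at x)"
proof -
  obtain D where "(g has_derivative D) (at x)" using assms(4) by (auto simp: differentiable_def)
  then have "(f has_derivative D) (at x)" using has_derivative_cong_open[OF assms(1,2), of f g] assms(3) by blast
  then show ?thesis by (auto simp: differentiable_def)
qed

lemma ext_d_cong_open:
  assumes "open S" "x \<in> S" "\<And>y. y \<in> S \<Longrightarrow> \<alpha> c y = \<beta> c y"
  shows "ext_d \<alpha> c x = ext_d \<beta> c x"
proof
  fix vs
  have "frechet_derivative (\<lambda>y. \<alpha> c y ws) (at x) = frechet_derivative (\<lambda>y. \<beta> c y ws) (at x)" for ws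
    by (rule frechet_derivative_cong_open[OF assms(1,2)]) (simp add: assms(3))
  then show "ext_d \<alpha> c x vs = ext_d \<beta> c x vs" by (simp add: ext_d_def)
qed

section \<open>Differentiability of algebraic expressions and alternating derivatives\<close>

lemma differentiable_sum_fun:
  assumes "\<And>i. i \<in> I \<Longrightarrow> f i differentiable (at x)"
  shows "(\<lambda>y. \<Sum>i\<in>I. f i y :: real) differentiable (at x)"
  using assms by (induction I rule: infinite_finite_induct) (auto intro: differentiable_add)

lemma differentiable_prod_fun:
  assumes "\<And>i. i \<in> I \<Longrightarrow> f i differentiable (at x)"
  shows "(\<lambda>y. \<Prod>i\<in>I. f i y :: real) differentiable (at x)"
  using assms by (induction I rule: infinite_finite_induct) (auto intro: differentiable_mult)

lemma differentiable_det:
  fixes M :: "'a::real_normed_vector \<Rightarrow> real^'n^'n"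
  assumes "\<And>i j. (\<lambda>y. M y $ i $ j) differentiable (at x)"
  shows "(\<lambda>y. det (M y)) differentiable (at x)"
  unfolding det_def by (intro differentiable_sum_fun differentiable_mult differentiable_prod_fun differentiable_const assms)

text \<open>By Cramer's rule an entry of the inverse is a quotient of two determinants. The rule is
  needed on a neighbourhood of \<open>x\<close>, hence the open set \<open>S\<close>.\<close>

lemma differentiable_matrix_inv:
  fixes M :: "'a::real_normed_vector \<Rightarrow> real^'n^'n"
  assumes M: "\<And>i j. (\<lambda>y. M y $ i $ j) differentiable (at x)"
    and S: "open S" "x \<in> S" "\<And>y. y \<in> S \<Longrightarrow> M y ** matrix_inv (M y) = mat 1"
  shows "(\<lambda>y. matrix_inv (M y) $ k $ l) differentiable (at x)"
proof -
  define N where "N y = (\<chi> i j. if j = k then axis l 1 $ i else M y $ i $ j)" for y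
  have d: "det (M y) \<noteq> 0" if "y \<in> S" for y
    using S(3)[OF that] invertible_right_inverse invertible_det_nz by metis
  have eq: "matrix_inv (M y) $ k $ l = det (N y) / det (M y)" if y: "y \<in> S" for y
  proof -
    have "M y *v (matrix_inv (M y) *v axis l 1) = axis l 1"
      using S(3)[OF y] by (simp add: matrix_vector_mul_assoc)
    then have "matrix_inv (M y) *v axis l 1 = (\<chi> k. det (\<chi> i j. if j = k then axis l 1 $ i else M y $ i $ j) / det (M y))"
      using cramer[OF d[OF y]] by blast
    then have "(matrix_inv (M y) *v axis l 1) $ k = det (N y) / det (M y)" by (simp add: N_def)
    then show ?thesis by (simp add: matrix_vector_mult_basis column_def)
  qed
  have "(\<lambda>y. N y $ i $ j) differentiable (at x)" for i j
    unfolding N_def by (cases "j = k") (simp_all add: M)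
  then have "(\<lambda>y. det (N y) / det (M y)) differentiable (at x)"
    using d[OF S(2)] by (intro differentiable_divide differentiable_det M) auto
  then show ?thesis by (rule differentiable_cong_open[OF S(1,2) eq, rotated])
qed

lemma alt_form_derivative:
  fixes \<alpha> :: "real^6 \<Rightarrow> real form"
  assumes S: "open S" "x \<in> S" "\<And>y. y \<in> S \<Longrightarrow> alt_form k (\<alpha> y)"
    and d: "\<And>vs. (\<lambda>y. \<alpha> y vs) differentiable (at x)"
  shows "alt_form k (\<lambda>vs. frechet_derivative (\<lambda>y. \<alpha> y vs) (at x) V)"
proof -
  have z: "frechet_derivative (\<lambda>y. \<alpha> y vs) (at x) V = 0" if "\<And>y. y \<in> S \<Longrightarrow> \<alpha> y vs = 0" for vs
    using frechet_derivative_cong_open[OF S(1,2), of "\<lambda>y. \<alpha> y vs" "\<lambda>y. 0"] that by simp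
  have w: "((\<lambda>y. \<alpha> y vs) has_derivative frechet_derivative (\<lambda>y. \<alpha> y vs) (at x)) (at x)" for vs
    using d frechet_derivative_works by blast
  have u: "frechet_derivative f (at x) V = D V" if "(f has_derivative D) (at x)" for f D
    using frechet_derivative_at[OF that] by simp
  show ?thesis unfolding alt_form_def
  proof (intro conjI allI impI)
    fix vs :: "(real^6) list" and i assume *: "length vs = k \<and> i < k"
    have l: "linear (\<lambda>v. \<alpha> y (vs[i := v]))" if "y \<in> S" for y
      using alt_form_linear[OF S(3)[OF that]] * by blast
    show "linear (\<lambda>v. frechet_derivative (\<lambda>y. \<alpha> y (vs[i := v])) (at x) V)"
    proof (rule linearI)
      fix a b and r :: real
      have "frechet_derivative (\<lambda>y. \<alpha> y (vs[i := a + b])) (at x) V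
          = frechet_derivative (\<lambda>y. \<alpha> y (vs[i := a]) + \<alpha> y (vs[i := b])) (at x) V"
        by (subst frechet_derivative_cong_open[OF S(1,2)]) (simp_all add: linear_add[OF l])
      also have "\<dots> = frechet_derivative (\<lambda>y. \<alpha> y (vs[i := a])) (at x) V + frechet_derivative (\<lambda>y. \<alpha> y (vs[i := b])) (at x) V"
        by (rule u) (intro has_derivative_add w)
      finally show "frechet_derivative (\<lambda>y. \<alpha> y (vs[i := a + b])) (at x) V
          = frechet_derivative (\<lambda>y. \<alpha> y (vs[i := a])) (at x) V + frechet_derivative (\<lambda>y. \<alpha> y (vs[i := b])) (at x) V" .
      have "frechet_derivative (\<lambda>y. \<alpha> y (vs[i := r *\<^sub>R a])) (at x) V
          = frechet_derivative (\<lambda>y. r *\<^sub>R \<alpha> y (vs[i := a])) (at x) V"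
        by (subst frechet_derivative_cong_open[OF S(1,2)]) (simp_all add: linear_scale[OF l])
      also have "\<dots> = r *\<^sub>R frechet_derivative (\<lambda>y. \<alpha> y (vs[i := a])) (at x) V"
        by (rule u) (intro has_derivative_scaleR_right w)
      finally show "frechet_derivative (\<lambda>y. \<alpha> y (vs[i := r *\<^sub>R a])) (at x) V
          = r *\<^sub>R frechet_derivative (\<lambda>y. \<alpha> y (vs[i := a])) (at x) V" .
    qed
  next
    fix vs :: "(real^6) list" and i j assume "length vs = k \<and> i < j \<and> j < k \<and> vs ! i = vs ! j"
    then show "frechet_derivative (\<lambda>y. \<alpha> y vs) (at x) V = 0"
      by (intro z alt_form_repeat[OF S(3), of _ _ i j]) auto
  next
    fix vs :: "(real^6) list" assume "length vs \<noteq> k"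
    then show "frechet_derivative (\<lambda>y. \<alpha> y vs) (at x) V = 0"
      by (intro z alt_form_length[OF S(3)]) auto
  qed
qed

lemma alt_form_4I:
  assumes len: "\<And>vs. length vs \<noteq> 4 \<Longrightarrow> \<beta> vs = 0"
    and lin: "\<And>b c d. linear (\<lambda>v. \<beta> [v, b, c, d])"
    and sw: "\<And>a b c d. \<beta> [b, a, c, d] = - \<beta> [a, b, c, d]" "\<And>a b c d. \<beta> [a, c, b, d] = - \<beta> [a, b, c, d]"
      "\<And>a b c d. \<beta> [a, b, d, c] = - (\<beta> [a, b, c, d] :: real)"
  shows "alt_form 4 \<beta>"
  unfolding alt_form_def
proof (intro conjI allI impI)
  have l1: "linear (\<lambda>v. \<beta> [a, v, c, d])" for a c d
    by (subst sw(1)) (rule linear_compose_neg[OF lin])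
  have l2: "linear (\<lambda>v. \<beta> [a, b, v, d])" for a b d
    by (subst sw(2)) (rule linear_compose_neg[OF l1])
  have l3: "linear (\<lambda>v. \<beta> [a, b, c, v])" for a b c
    by (subst sw(3)) (rule linear_compose_neg[OF l2])
  have z1: "\<beta> [a, a, c, d] = 0" and z2: "\<beta> [c, a, a, d] = 0" and z3: "\<beta> [c, d, a, a] = 0" for a c d
    using sw(1)[of a a c d] sw(2)[of c a a d] sw(3)[of c d a a] by simp_all
  have z4: "\<beta> [a, c, a, d] = 0" and z5: "\<beta> [c, a, d, a] = 0" for a c d
    using sw(2)[of a a c d] sw(3)[of c a a d] z1[of a c d] z2[of c a d] by simp_all
  have z6: "\<beta> [a, c, d, a] = 0" for a c d
    using sw(3)[of a c a d] z4[of a c d] by simp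
  fix vs :: "(real^6) list" and i j :: nat
  {
    assume v: "length vs = 4 \<and> i < 4"
    then obtain a b c d where vs: "vs = [a, b, c, d]" using length_4_conv by blast
    have "i = 0 \<or> i = 1 \<or> i = 2 \<or> i = 3" using v by auto
    then show "linear (\<lambda>v. \<beta> (vs[i := v]))"
      by (elim disjE) (simp_all add: vs lin l1 l2 l3 One_nat_def)
  next
    assume v: "length vs = 4 \<and> i < j \<and> j < 4 \<and> vs ! i = vs ! j"
    then obtain a b c d where vs: "vs = [a, b, c, d]" using length_4_conv by blast
    have "(i = 0 \<and> (j = 1 \<or> j = 2 \<or> j = 3)) \<or> (i = 1 \<and> (j = 2 \<or> j = 3)) \<or> (i = 2 \<and> j = 3)" using v by auto
    then show "\<beta> vs = 0"
      using v by (elim disjE conjE) (simp_all add: vs z1 z2 z3 z4 z5 z6 One_nat_def)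
  }
qed (use len in blast)

text \<open>The Leibniz rule for \<open>d(\<omega> \<and> \<psi>)\<close>, written out for a \<open>2\<close>-form and a \<open>3\<close>-form.\<close>

lemma wedge5_leibniz:
  fixes w h :: "real form" and dw t :: "real^6 \<Rightarrow> real form" and v :: "nat \<Rightarrow> real^6"
  assumes closed: "\<And>a b c. dw a [b, c] - dw b [a, c] + dw c [a, b] = 0"
    and E: "\<And>V a b c d e. wedge5 (dw V) h a b c d e + wedge5 w (t V) a b c d e = 0"
  defines "\<beta> \<equiv> \<lambda>i j k l. t (v i) [v j, v k, v l] - t (v j) [v i, v k, v l] + t (v k) [v i, v j, v l] - t (v l) [v i, v j, v k]"
  shows "w [v 0, v 1] * \<beta> 2 3 4 5 - w [v 0, v 2] * \<beta> 1 3 4 5 + w [v 0, v 3] * \<beta> 1 2 4 5 - w [v 0, v 4] * \<beta> 1 2 3 5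
    + w [v 0, v 5] * \<beta> 1 2 3 4 + w [v 1, v 2] * \<beta> 0 3 4 5 - w [v 1, v 3] * \<beta> 0 2 4 5 + w [v 1, v 4] * \<beta> 0 2 3 5
    - w [v 1, v 5] * \<beta> 0 2 3 4 + w [v 2, v 3] * \<beta> 0 1 4 5 - w [v 2, v 4] * \<beta> 0 1 3 5 + w [v 2, v 5] * \<beta> 0 1 3 4
    + w [v 3, v 4] * \<beta> 0 1 2 5 - w [v 3, v 5] * \<beta> 0 1 2 4 + w [v 4, v 5] * \<beta> 0 1 2 3 = 0" (is "?L = 0")
proof -
  define c where "c i j k = dw (v i) [v j, v k] - dw (v j) [v i, v k] + dw (v k) [v i, v j]" for i j k
  have c0: "c i j k = 0" for i j k unfolding c_def by (rule closed)
  define H where "H i j k = h [v i, v j, v k]" for i j k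
  \<comment> \<open>The left side is \<open>w \<and> \<beta>\<close>, the part of the exterior
    derivative of \<open>w \<and> h\<close> in which \<open>h\<close> is differentiated.
    \<open>E\<close> trades it for minus the part in which \<open>w\<close> is differentiated, and
    there the derivatives collect into the components \<open>c\<close> of the exterior derivative of
    \<open>w\<close>, which vanish.\<close>
  have "?L = wedge5 w (t (v 0)) (v 1) (v 2) (v 3) (v 4) (v 5) - wedge5 w (t (v 1)) (v 0) (v 2) (v 3) (v 4) (v 5)
    + wedge5 w (t (v 2)) (v 0) (v 1) (v 3) (v 4) (v 5) - wedge5 w (t (v 3)) (v 0) (v 1) (v 2) (v 4) (v 5)
    + wedge5 w (t (v 4)) (v 0) (v 1) (v 2) (v 3) (v 5) - wedge5 w (t (v 5)) (v 0) (v 1) (v 2) (v 3) (v 4)"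
    unfolding wedge5_def \<beta>_def by (simp add: algebra_simps)
  also have "\<dots> = - (wedge5 (dw (v 0)) h (v 1) (v 2) (v 3) (v 4) (v 5) - wedge5 (dw (v 1)) h (v 0) (v 2) (v 3) (v 4) (v 5)
    + wedge5 (dw (v 2)) h (v 0) (v 1) (v 3) (v 4) (v 5) - wedge5 (dw (v 3)) h (v 0) (v 1) (v 2) (v 4) (v 5)
    + wedge5 (dw (v 4)) h (v 0) (v 1) (v 2) (v 3) (v 5) - wedge5 (dw (v 5)) h (v 0) (v 1) (v 2) (v 3) (v 4))"
    using E[of "v 0" "v 1" "v 2" "v 3" "v 4" "v 5"] E[of "v 1" "v 0" "v 2" "v 3" "v 4" "v 5"]
      E[of "v 2" "v 0" "v 1" "v 3" "v 4" "v 5"] E[of "v 3" "v 0" "v 1" "v 2" "v 4" "v 5"]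
      E[of "v 4" "v 0" "v 1" "v 2" "v 3" "v 5"] E[of "v 5" "v 0" "v 1" "v 2" "v 3" "v 4"] by linarith
  also have "\<dots> = - (c 0 1 2 * H 3 4 5 - c 0 1 3 * H 2 4 5 + c 0 1 4 * H 2 3 5 - c 0 1 5 * H 2 3 4
    + c 0 2 3 * H 1 4 5 - c 0 2 4 * H 1 3 5 + c 0 2 5 * H 1 3 4 + c 0 3 4 * H 1 2 5 - c 0 3 5 * H 1 2 4 + c 0 4 5 * H 1 2 3
    - c 1 2 3 * H 0 4 5 + c 1 2 4 * H 0 3 5 - c 1 2 5 * H 0 3 4 - c 1 3 4 * H 0 2 5 + c 1 3 5 * H 0 2 4 - c 1 4 5 * H 0 2 3
    + c 2 3 4 * H 0 1 5 - c 2 3 5 * H 0 1 4 + c 2 4 5 * H 0 1 3 - c 3 4 5 * H 0 1 2)"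
    unfolding wedge5_def c_def H_def by (simp add: algebra_simps)
  also have "\<dots> = 0" unfolding c0 by simp
  finally show ?thesis .
qed

text \<open>Coordinate expressions of \<omega> and \<phi> near \<open>x\<close>. The frame in
  \<open>point\<close> may vary with \<open>y\<close> without any regularity, so only identities
  free of the frame are differentiated.\<close>

locale chart_point =
  fixes w p :: "real^6 \<Rightarrow> real form" and S :: "(real^6) set" and x :: "real^6"
  assumes S: "open S" "x \<in> S"
    and point: "y \<in> S \<Longrightarrow> \<exists>f. su3_point (w y) (p y) (hat (w y) (p y)) (acs (w y) (p y)) f"
    and diff_w: "(\<lambda>y. w y vs) differentiable (at x)"
    and diff_p: "(\<lambda>y. p y vs) differentiable (at x)"
begin

abbreviation "J y \<equiv> acs (w y) (p y)"
abbreviation "h y \<equiv> hat (w y) (p y)"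

lemma alt:
  assumes "y \<in> S" shows "alt_form 2 (w y)" "alt_form 3 (p y)" "alt_form 3 (h y)" "holo3 (J y) (p y) (h y)"
proof -
  obtain f where "su3_point (w y) (p y) (h y) (J y) f" using point[OF assms] by blast
  then interpret su3_point "w y" "p y" "h y" "J y" f .
  show "alt_form 2 (w y)" "alt_form 3 (p y)" "alt_form 3 (h y)" "holo3 (J y) (p y) (h y)"
    by (rule \<omega>_alt \<phi>_alt \<psi>_alt holo)+
qed

lemma slot_expand:
  assumes "alt_form 3 \<alpha>" shows "\<alpha> [v, b, c] = (\<Sum>i\<in>UNIV. v $ i * \<alpha> [axis i 1, b, c])"
  by (rule linear_expand_axis[OF alt_form_3_linear(1)[OF assms]])

lemma diff_omega_inv: "(\<lambda>y. omega_inv (w y) $ k $ l) differentiable (at x)"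
  unfolding omega_inv_def
proof (rule differentiable_matrix_inv[OF _ S])
  fix y assume "y \<in> S"
  then obtain f where "su3_point (w y) (p y) (h y) (J y) f" using point by blast
  then interpret su3_point "w y" "p y" "h y" "J y" f .
  show "(\<chi> i j. w y [axis i 1, axis j 1]) ** matrix_inv (\<chi> i j. w y [axis i 1, axis j 1]) = mat 1"
    by (rule matrix_inv_darboux(2)[OF darb])
qed (simp add: diff_w)

lemma diff_p_slot:
  assumes "\<And>b. (\<lambda>y. v y $ b) differentiable (at x)"
  shows "(\<lambda>y. p y [v y, b, c]) differentiable (at x)"
  by (rule differentiable_cong_open[OF S slot_expand[OF alt(2)]], assumption)
    (intro differentiable_sum_fun differentiable_mult assms diff_p)

lemma diff_K:
  assumes "\<And>b. (\<lambda>y. v y $ b) differentiable (at x)"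
  shows "(\<lambda>y. K_op (w y) (p y) (v y) $ k) differentiable (at x)"
  unfolding K_op_def B_form_def
  by (simp, intro differentiable_sum_fun differentiable_mult diff_omega_inv diff_p diff_p_slot assms)

lemma diff_J: "(\<lambda>y. J y X $ k) differentiable (at x)"
proof -
  define s where "s y = - (K_op (w y) (p y) (K_op (w y) (p y) (axis 1 1)) $ 1)" for y
  have eq: "J y X $ k = - (1 / sqrt (s y)) * K_op (w y) (p y) X $ k" and pos: "s y > 0" if y: "y \<in> S" for y
  proof -
    obtain f where "su3_point (w y) (p y) (h y) (J y) f" using point[OF y] by blast
    then interpret su3_point "w y" "p y" "h y" "J y" f .
    show "J y X $ k = - (1 / sqrt (s y)) * K_op (w y) (p y) X $ k"
      unfolding s_def by (subst J_formula(1)) simp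
    show "s y > 0" unfolding s_def by (rule J_formula(2))
  qed
  have c: "(\<lambda>y. axis i 1 $ b :: real) differentiable (at x)" "(\<lambda>y. X $ b) differentiable (at x)" for i b by simp_all
  have "s differentiable (at x)"
    unfolding s_def by (intro differentiable_minus diff_K c)
  moreover have "sqrt differentiable (at (s x))"
    using DERIV_real_sqrt[OF pos[OF S(2)]] real_differentiable_def by blast
  ultimately have "(\<lambda>y. sqrt (s y)) differentiable (at x)" by (rule differentiable_compose[rotated])
  then have "(\<lambda>y. - (1 / sqrt (s y)) * K_op (w y) (p y) X $ k) differentiable (at x)"
    using pos[OF S(2)] by (intro differentiable_mult differentiable_minus differentiable_divide differentiable_const diff_K c) auto
  then show ?thesis by (rule differentiable_cong_open[OF S eq, rotated])
qed

lemma diff_h: "(\<lambda>y. h y vs) differentiable (at x)"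
proof (cases "length vs = 3")
  case True
  then obtain a b c where vs: "vs = [a, b, c]" using length_3_conv by blast
  \<comment> \<open>The (3,0) type expresses \<open>h\<close> through a single \<open>J\<close>, so
    only one slot varies with \<open>J\<close> and the product of three factors \<open>J\<close> in
    the definition of \<open>hat\<close> is avoided.\<close>
  have e: "h y [a, b, c] = - p y [J y a, b, c]" if "y \<in> S" for y
    using holo3D(1)[OF alt(4)[OF that], of a b c] by simp
  have "(\<lambda>y. - p y [J y a, b, c]) differentiable (at x)" by (intro differentiable_minus diff_p_slot diff_J)
  then show ?thesis unfolding vs by (rule differentiable_cong_open[OF S e, rotated])
next
  case False
  then have e: "h y vs = 0" if "y \<in> S" for y using alt_form_length[OF alt(3)[OF that]] by simp
  have "(\<lambda>y. 0 :: real) differentiable (at x)" by simp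
  then show ?thesis by (rule differentiable_cong_open[OF S e, rotated])
qed

text \<open>\<open>dw\<close>, \<open>s\<close>, \<open>t\<close> and \<open>N\<close> are the
  derivatives at \<open>x\<close> in direction \<open>V\<close> of \<omega>, \<phi>,
  \<open>hat \<phi>\<close> and \<open>J\<close>.\<close>

definition "dw V vs = frechet_derivative (\<lambda>y. w y vs) (at x) V"
definition "s V vs = frechet_derivative (\<lambda>y. p y vs) (at x) V"
definition "t V vs = frechet_derivative (\<lambda>y. h y vs) (at x) V"
definition "N V X = (\<chi> b. frechet_derivative (\<lambda>y. J y X $ b) (at x) V)"

lemma has_derivatives:
  "((\<lambda>y. w y vs) has_derivative (\<lambda>V. dw V vs)) (at x)"
  "((\<lambda>y. p y vs) has_derivative (\<lambda>V. s V vs)) (at x)"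
  "((\<lambda>y. h y vs) has_derivative (\<lambda>V. t V vs)) (at x)"
  "((\<lambda>y. J y X $ b) has_derivative (\<lambda>V. N V X $ b)) (at x)"
  using diff_w diff_p diff_h diff_J
  by (simp_all add: frechet_derivative_works dw_def s_def t_def N_def)

lemma t_alt: "alt_form 3 (t V)" and s_alt: "alt_form 3 (s V)"
  unfolding t_def[abs_def] s_def[abs_def]
  by (rule alt_form_derivative[OF S]; use alt diff_h diff_p in blast)+

lemma slot_derivative:
  fixes \<alpha> D :: "real^6 \<Rightarrow> real form"
  assumes a: "\<And>y. y \<in> S \<Longrightarrow> alt_form 3 (\<alpha> y)" and d: "\<And>vs. ((\<lambda>y. \<alpha> y vs) has_derivative (\<lambda>V. D V vs)) (at x)"
    and D: "\<And>V. alt_form 3 (D V)"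
  shows "((\<lambda>y. \<alpha> y [J y X, b, c]) has_derivative (\<lambda>V. D V [J x X, b, c] + \<alpha> x [N V X, b, c])) (at x)"
proof -
  have "((\<lambda>y. \<Sum>i\<in>UNIV. J y X $ i * \<alpha> y [axis i 1, b, c]) has_derivative
    (\<lambda>V. \<Sum>i\<in>UNIV. J x X $ i * D V [axis i 1, b, c] + N V X $ i * \<alpha> x [axis i 1, b, c])) (at x)"
    by (intro has_derivative_sum has_derivative_mult has_derivatives d)
  moreover have "(\<Sum>i\<in>UNIV. J x X $ i * D V [axis i 1, b, c] + N V X $ i * \<alpha> x [axis i 1, b, c])
     = D V [J x X, b, c] + \<alpha> x [N V X, b, c]" for V
    by (simp add: sum.distrib slot_expand[OF D, of V "J x X"] slot_expand[OF a[OF S(2)], of "N V X"])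
  ultimately show ?thesis
    by (simp add: has_derivative_cong_open[OF S slot_expand[OF a]])
qed

text \<open>Product rule for the two identities of type (3,0), with \<open>J\<close> in the first
  slot. The terms with \<open>N\<close> measure how far the derivative of \<Omega> is from being of
  type (3,0).\<close>

lemma derivative_relations:
  "t V [J x X, Y, Z] = s V [X, Y, Z] - h x [N V X, Y, Z]"
  "s V [J x X, Y, Z] = - t V [X, Y, Z] - p x [N V X, Y, Z]"
proof -
  have D1: "((\<lambda>y. h y [J y X, Y, Z]) has_derivative (\<lambda>V. t V [J x X, Y, Z] + h x [N V X, Y, Z])) (at x)"
    by (rule slot_derivative[OF alt(3) has_derivatives(3) t_alt])
  have e1: "h y [J y X, Y, Z] = p y [X, Y, Z]" if "y \<in> S" for y by (rule holo3D(4)[OF alt(4)[OF that]])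
  have "((\<lambda>y. p y [X, Y, Z]) has_derivative (\<lambda>V. t V [J x X, Y, Z] + h x [N V X, Y, Z])) (at x)"
    by (rule has_derivative_cong_open[OF S e1, THEN iffD1, OF _ D1])
  from fun_cong[OF has_derivative_unique[OF this has_derivatives(2)], of V]
  show "t V [J x X, Y, Z] = s V [X, Y, Z] - h x [N V X, Y, Z]" by simp
  have D2: "((\<lambda>y. p y [J y X, Y, Z]) has_derivative (\<lambda>V. s V [J x X, Y, Z] + p x [N V X, Y, Z])) (at x)"
    by (rule slot_derivative[OF alt(2) has_derivatives(2) s_alt])
  have e2: "p y [J y X, Y, Z] = - h y [X, Y, Z]" if "y \<in> S" for y by (rule holo3D(1)[OF alt(4)[OF that]])
  have "((\<lambda>y. - h y [X, Y, Z]) has_derivative (\<lambda>V. s V [J x X, Y, Z] + p x [N V X, Y, Z])) (at x)"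
    by (rule has_derivative_cong_open[OF S e2, THEN iffD1, OF _ D2])
  from fun_cong[OF has_derivative_unique[OF this has_derivative_minus[OF has_derivatives(3)]], of V]
  show "s V [J x X, Y, Z] = - t V [X, Y, Z] - p x [N V X, Y, Z]" by simp
qed

text \<open>The exterior derivative of \<open>hat \<phi>\<close> at \<open>x\<close>, in the shape
  to which \<open>ext_d\<close> unfolds.\<close>

definition "\<beta> vs = (\<Sum>i<length vs. (-1) ^ i * t (vs ! i) (take i vs @ drop (Suc i) vs))"

lemma \<beta>_eq: "\<beta> [a, b, c, d] = t a [b, c, d] - t b [a, c, d] + t c [a, b, d] - t d [a, b, c]"
  by (simp add: \<beta>_def lessThan_Suc)

lemma \<beta>_alt: "alt_form 4 \<beta>"
proof (rule alt_form_4I)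
  fix vs :: "(real^6) list" assume "length vs \<noteq> 4"
  then have "t V (take i vs @ drop (Suc i) vs) = 0" if "i < length vs" for i V
    by (intro alt_form_length[OF t_alt]) (use that in auto)
  then show "\<beta> vs = 0" by (simp add: \<beta>_def)
next
  fix b c d
  have l: "linear (\<lambda>V. t V vs)" for vs
    using linear_frechet_derivative[OF diff_h] by (simp add: t_def)
  show "linear (\<lambda>v. \<beta> [v, b, c, d])"
    unfolding \<beta>_eq by (intro linear_compose_add linear_compose_sub l alt_form_3_linear t_alt)
next
  note s1 = alt_form_3_swap[OF t_alt]
  fix a b c d
  show "\<beta> [b, a, c, d] = - \<beta> [a, b, c, d]"
    unfolding \<beta>_eq using s1(1)[of c b a d] s1(1)[of d b a c] by simp
  show "\<beta> [a, c, b, d] = - \<beta> [a, b, c, d]"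
    unfolding \<beta>_eq using s1(1)[of a c b d] s1(2)[of d a c b] by simp
  show "\<beta> [a, b, d, c] = - \<beta> [a, b, c, d]"
    unfolding \<beta>_eq using s1(2)[of a b d c] s1(2)[of b a d c] by simp
qed

text \<open>The derivative \<open>N\<close> of \<open>J\<close> disappears: in \<open>R2\<close> its
  two contributions cancel, and in \<open>R3\<close> the arguments \<open>v, J v\<close> make it 0.
  What remains are derivatives of \<phi>, which assemble into the values of its exterior derivative
  on \<open>v, J v, J X, Y\<close> and \<open>v, J v, X, J Y\<close>.\<close>

lemma \<beta>_type:
  assumes closed: "\<And>a b c d. s a [b, c, d] - s b [a, c, d] + s c [a, b, d] - s d [a, b, c] = 0"
    and JJ: "\<And>v. J x (J x v) = - v"
  shows "\<beta> [v, J x v, J x X, J x Y] = \<beta> [v, J x v, X, Y]"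
proof -
  let ?J = "J x"
  note H = holo3D[OF alt(4)[OF S(2)]] and rep = alt_form_3_repeat[OF alt(3)[OF S(2)]]
  have R2: "t a [b, c, Z] - t a [?J b, ?J c, Z] = - (s a [?J b, c, Z] + s a [b, ?J c, Z])" for a b c Z
    using derivative_relations(1)[of a b "?J c" Z] derivative_relations(2)[of a b c Z] H(5)[of "N a b" c Z] by simp
  have cyc: "t V [a, b, c] = t V [c, a, b]" "s V [a, b, c] = s V [c, a, b]" for V a b c
    using alt_form_3_swap[OF t_alt, of V] alt_form_3_swap[OF s_alt, of V] by (metis minus_minus)+
  have R3: "s V [v, ?J v, ?J Z] = - t V [v, ?J v, Z]" "t V [v, ?J v, ?J Z] = s V [v, ?J v, Z]" for V Z
    using derivative_relations[of V Z v "?J v"] H(3)[of "N V Z" v v] H(6)[of "N V Z" v v] rep(2)[of "N V Z" v]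
      alt_form_3_repeat(2)[OF alt(2)[OF S(2)], of "N V Z" v]
    unfolding cyc[of V v "?J v"] by simp_all
  have "t a [b, ?J X, ?J Y] = t a [b, X, Y] + s a [b, ?J X, Y] + s a [b, X, ?J Y]" for a b
    using R2[of a X Y b] cyc(1)[of a "?J X" "?J Y" b] cyc(1)[of a X Y b] cyc(2)[of a "?J X" Y b] cyc(2)[of a X "?J Y" b]
    by linarith
  then show ?thesis
    unfolding \<beta>_eq R3
    using closed[of v "?J v" "?J X" Y] closed[of v "?J v" X "?J Y"] R3(1)[of Y X] R3(1)[of X Y] R3(2)[of "?J X" Y]
      R3(2)[of "?J Y" X] R3(1)[of "?J X" Y]
    by (simp add: R3)
qed

lemma \<beta>_primitive:
  assumes closed: "\<And>a b c. dw a [b, c] - dw b [a, c] + dw c [a, b] = 0" and f: "darboux (w x) f"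
  shows "\<beta> [f 0, f 1, f 2, f 3] + \<beta> [f 0, f 1, f 4, f 5] + \<beta> [f 2, f 3, f 4, f 5] = 0"
proof -
  have E: "wedge5 (dw V) (h x) a b c d e + wedge5 (w x) (t V) a b c d e = 0" for V a b c d e
  proof -
    have D: "((\<lambda>y. wedge5 (w y) (h y) a b c d e) has_derivative
      (\<lambda>V. wedge5 (dw V) (h x) a b c d e + wedge5 (w x) (t V) a b c d e)) (at x)"
    proof -
      have d: "((\<lambda>y. w y us * h y vs) has_derivative (\<lambda>V. w x us * t V vs + dw V us * h x vs)) (at x)" for us vs
        by (rule has_derivative_mult[OF has_derivatives(1,3)])
      show ?thesis unfolding wedge5_def
        by (rule has_derivative_eq_rhs, (rule has_derivative_add has_derivative_diff d)+) (simp add: algebra_simps)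
    qed
    have e0: "wedge5 (w y) (h y) a b c d e = 0" if y: "y \<in> S" for y
    proof -
      obtain f where "su3_point (w y) (p y) (h y) (J y) f" using point[OF y] by blast
      then interpret su3_point "w y" "p y" "h y" "J y" f .
      show ?thesis by (rule wedge5_\<omega>_\<psi>)
    qed
    have "((\<lambda>y. 0) has_derivative
      (\<lambda>V. wedge5 (dw V) (h x) a b c d e + wedge5 (w x) (t V) a b c d e)) (at x)"
      by (rule has_derivative_cong_open[OF S e0, THEN iffD1, OF _ D])
    from fun_cong[OF has_derivative_unique[OF this has_derivative_const], of V] show ?thesis .
  qed
  \<comment> \<open>On a Darboux basis three of the 15 terms survive, those with \<omega> on the
    pairs (0, 1), (2, 3), (4, 5), all with sign plus.\<close>
  show ?thesis
    using wedge5_leibniz[OF closed E, of f] unfolding darboux_values[OF f] \<beta>_eq by simp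
qed

end

section \<open>The two flows\<close>

lemma chart_point_charts:
  assumes "smooth_atlas M A" and \<omega>: "symplectic_form A \<omega>" and \<phi>: "closed_primitive_positive A \<omega> \<phi>"
    and c: "c \<in> A" and x: "x \<in> img c"
  shows "chart_point (\<omega> c) (\<phi> c) (img c) x"
proof
  show S: "open (img c)" using assms(1) c by (simp add: smooth_atlas_def)
  show "x \<in> img c" by (rule x)
  have \<omega>': "smooth_form A 2 \<omega>" and \<phi>': "smooth_form A 3 \<phi>"
    using \<omega> \<phi> by (auto simp: symplectic_form_def closed_primitive_positive_def)
  have "smooth_on (img c) (\<lambda>y. \<omega> c y vs)" "smooth_on (img c) (\<lambda>y. \<phi> c y vs)" for vs
    using \<omega>' \<phi>' c by (simp_all add: smooth_form_def)
  note smooth = this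
  show "(\<lambda>y. \<omega> c y vs) differentiable (at x)" for vs by (rule smooth_on_differentiable[OF smooth(1) S x])
  show "(\<lambda>y. \<phi> c y vs) differentiable (at x)" for vs by (rule smooth_on_differentiable[OF smooth(2) S x])
  fix y assume y: "y \<in> img c"
  show "\<exists>f. su3_point (\<omega> c y) (\<phi> c y) (hat (\<omega> c y) (\<phi> c y)) (acs (\<omega> c y) (\<phi> c y)) f"
  proof (rule su3_point_acs[of "\<omega> c y" "\<phi> c y"])
    show "alt_form 2 (\<omega> c y)" "alt_form 3 (\<phi> c y)" using \<omega>' \<phi>' c y by (simp_all add: smooth_form_def)
    show "nondegenerate (\<omega> c y)" using \<omega> c y by (simp add: symplectic_form_def)
    show "positive_3form (\<phi> c y)" using \<phi> c y by (simp add: closed_primitive_positive_def)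
    show "contraction (\<omega> c y) (\<phi> c y) [v] = 0" for v
      using \<phi> c y by (simp add: closed_primitive_positive_def form_eq_def Lambda_form_def)
    show "metric (\<omega> c y) (\<phi> c y) v v > 0" if "v \<noteq> 0" for v
      using \<phi> c y that by (simp add: closed_primitive_positive_def)
  qed blast
qed

lemma codiff_eq_Lambda_d_hat:
  assumes A: "smooth_atlas M A" and \<omega>: "symplectic_form A \<omega>" and \<phi>: "closed_primitive_positive A \<omega> \<phi>"
    and c: "c \<in> A" and x: "x \<in> img c"
  shows "codiff \<omega> \<phi> 3 \<phi> c x = Lambda_form \<omega> (ext_d (hat_form \<omega> \<phi>)) c x"
proof -
  interpret chart_point "\<omega> c" "\<phi> c" "img c" x by (rule chart_point_charts[OF A \<omega> \<phi> c x])
  have m: "metric (\<omega> c y) (\<phi> c y) = (\<lambda>u v. \<omega> c y [u, acs (\<omega> c y) (\<phi> c y) v])" for y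
    by (intro ext) (simp add: metric_def)
  have star3: "star_form \<omega> \<phi> 3 \<phi> c y = hat_form \<omega> \<phi> c y" if y: "y \<in> img c" for y
  proof -
    obtain f where "su3_point (\<omega> c y) (\<phi> c y) (h y) (J y) f" using point[OF y] by blast
    then interpret su3_point "\<omega> c y" "\<phi> c y" "h y" "J y" f .
    show ?thesis unfolding star_form_def hat_form_def m by (rule star_3)
  qed
  have \<beta>: "ext_d (hat_form \<omega> \<phi>) c x = \<beta>"
    by (rule ext) (simp add: ext_d_def \<beta>_def t_def hat_form_def)
  \<comment> \<open>The inner \<open>d\<close> looks at a neighbourhood, so \<open>star3\<close> is
    needed at every point of the chart, each with its own frame; the outer star is evaluated at
    \<open>x\<close> alone.\<close>
  have dd: "ext_d (star_form \<omega> \<phi> 3 \<phi>) c x = \<beta>"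
    unfolding \<beta>[symmetric] 
    by (rule ext_d_cong_open[where \<alpha> = "star_form \<omega> \<phi> 3 \<phi>" and \<beta> = "hat_form \<omega> \<phi>", OF S star3])
  have d2: "dw a [b, d] - dw b [a, d] + dw d [a, b] = 0" for a b d
  proof -
    have "ext_d \<omega> c x [a, b, d] = 0"
      using \<omega> c x by (simp add: symplectic_form_def closed_form_def form_eq_def)
    then show ?thesis by (simp add: ext_d_def dw_def lessThan_Suc)
  qed
  have d3: "s a [b, d, e] - s b [a, d, e] + s d [a, b, e] - s e [a, b, d] = 0" for a b d e
  proof -
    have "ext_d \<phi> c x [a, b, d, e] = 0"
      using \<phi> c x by (simp add: closed_primitive_positive_def closed_form_def form_eq_def)
    then show ?thesis by (simp add: ext_d_def s_def lessThan_Suc)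
  qed
  obtain f where "su3_point (\<omega> c x) (\<phi> c x) (h x) (J x) f" using point[OF x] by blast
  then interpret su3_point "\<omega> c x" "\<phi> c x" "h x" "J x" f .
  \<comment> \<open>The index 4 is \<open>7 - k\<close> for \<open>k = 3\<close> in
    \<open>codiff\<close>, whose minus sign cancels the one found here.\<close>
  have "star_form \<omega> \<phi> 4 (ext_d (star_form \<omega> \<phi> 3 \<phi>)) c x = (\<lambda>vs. - contraction (\<omega> c x) \<beta> vs)"
    unfolding star_form_def[of \<omega> \<phi> 4] dd m
    by (rule star_4[OF \<beta>_alt \<beta>_type[OF d3 J(2)] \<beta>_primitive[OF d2 darb]])
  then show ?thesis
    by (intro ext) (simp add: codiff_def Lambda_form_def \<beta>)
qed

theorem theorem3p1:
  fixes M :: "'a topology" and A :: "'a chart set"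
    and \<omega> \<phi>0 :: "'a dform" and I :: "real set" and \<phi> :: "real \<Rightarrow> 'a dform"
  assumes "compact_space M" and "Hausdorff_space M" and "smooth_atlas M A"
    and "symplectic_form A \<omega>"
    and "closed_primitive_positive A \<omega> \<phi>0"
    and "is_interval I" and "interior I \<noteq> {}" and "0 \<in> I"
    and "smooth_family A I \<phi>"
    and "\<And>t. t \<in> I \<Longrightarrow> closed_primitive_positive A \<omega> (\<phi> t)"
    and "form_eq A (\<phi> 0) \<phi>0"
  shows "hitchin_gradient_flow A \<omega> I \<phi> \<longleftrightarrow>
         satisfies_flow A I (\<lambda>\<phi>. ext_d (Lambda_form \<omega> (ext_d (hat_form \<omega> \<phi>)))) \<phi>"
proof -
  \<comment> \<open>The two 2-forms must agree on the whole chart image, as the outer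
    \<open>d\<close> differentiates them. Time is only a parameter: both right-hand sides are formed
    from \<phi> at a fixed \<open>t\<close>.\<close>
  have "ext_d (codiff \<omega> (\<phi> t) 3 (\<phi> t)) c x = ext_d (Lambda_form \<omega> (ext_d (hat_form \<omega> (\<phi> t)))) c x"
    if t: "t \<in> I" and c: "c \<in> A" and x: "x \<in> img c" for t c x
  proof (rule ext_d_cong_open[of "img c"])
    show "open (img c)" using assms(3) c by (simp add: smooth_atlas_def)
    show "codiff \<omega> (\<phi> t) 3 (\<phi> t) c y = Lambda_form \<omega> (ext_d (hat_form \<omega> (\<phi> t))) c y" if "y \<in> img c" for y
      by (rule codiff_eq_Lambda_d_hat[OF assms(3,4) assms(10)[OF t] c that])
  qed (rule x)
  then show ?thesis
    unfolding hitchin_gradient_flow_def satisfies_flow_def by simp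
qed

end
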